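(* For any integer $T\ge 2$ $$ \left[2^{\frac{T-3}{14}}\right]\;\le\;|\mathcal A_\kappa(T)|\;\le\;|\mathcal G_\kappa(T)|\;\le\;2^{6T\log_2 T}, $$ where $[x]$ denotes the integral part of a number $x$.
   Context: All groups are finitely presentable and all simplicial complexes are finite (and connected). The simplicial complexity $\kappa(G)$ of a group $G$ is the minimal number of $2$-simplices of a simplicial complex of dimension at most $2$ with fundamental group $G$. Every group $G$ decomposes as a free product $G=H\ast F_n$, where $F_n$ is the free group of rank $n$ and $H$ does not have $\mathbb Z$ as a free factor; the integer $n$ is uniquely determined and called the free index of $G$. Thus $G$ has free index zero iff it has no free factor isomorphic to $\mathbb Z$ (the trivial group has free index zero). For a positive integer $T$, $\mathcal G_\kappa(T)$ is the set of isomorphism classes of groups $G$ of free index zero with $\kappa(G)\le T$, and $\mathcal A_\kappa(T)$ is the subset of isomorphism classes of finite abelian groups (the trivial group included). *)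

theory Defs
  imports
    "HOL-Analysis.Analysis"
    "HOL-Algebra.Elementary_Groups"
    "HOL-Library.Extended_Nat"
begin

section \<open>Finite simplicial complexes and their fundamental groups\<close>

text \<open>A complex is given by the vertex sets of its simplices; an \<open>n\<close>-simplex has \<open>n + 1\<close>
  vertices.\<close>

definition finite_complex :: "'v set set \<Rightarrow> bool" where
  "finite_complex K \<longleftrightarrow>
     finite K \<and> (\<forall>s\<in>K. finite s \<and> s \<noteq> {}) \<and> (\<forall>s\<in>K. \<forall>t. t \<subseteq> s \<and> t \<noteq> {} \<longrightarrow> t \<in> K)"

definition simplices_of_dim :: "nat \<Rightarrow> 'v set set \<Rightarrow> 'v set set" where
  "simplices_of_dim n K = {s \<in> K. card s = Suc n}"

definition dim_at_most :: "'v set set \<Rightarrow> nat \<Rightarrow> bool" where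
  "dim_at_most K d \<longleftrightarrow> (\<forall>n>d. simplices_of_dim n K = {})"

text \<open>Barycentric coordinates. The product topology on \<open>'v \<Rightarrow> real\<close> induces on the realization of
  a finite complex the Euclidean topology, because all coordinates outside the finite vertex set
  vanish.\<close>

definition realization :: "'v set set \<Rightarrow> ('v \<Rightarrow> real) set" where
  "realization K = {x. (\<forall>v. 0 \<le> x v) \<and> {v. x v \<noteq> 0} \<in> K \<and> (\<Sum>v | x v \<noteq> 0. x v) = 1}"

text \<open>Since \<open>homotopic_paths\<close> only looks at the values of paths on \<open>[0,1]\<close>, so do the classes
  below.\<close>

definition fundamental_group ::
    "'a::topological_space set \<Rightarrow> 'a \<Rightarrow> (real \<Rightarrow> 'a) set monoid" where
  "fundamental_group X x =
     \<lparr>carrier = {Collect (homotopic_paths X p) | p.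
         path p \<and> path_image p \<subseteq> X \<and> pathstart p = x \<and> pathfinish p = x},
      monoid.mult = (\<lambda>A B. {r. \<exists>p\<in>A. \<exists>q\<in>B. homotopic_paths X (p +++ q) r}),
      one = Collect (homotopic_paths X (\<lambda>_. x))\<rparr>"

text \<open>The infimum is over \<open>enat\<close>: it is attained if a suitable complex exists, and it is \<open>\<infinity>\<close> for a
  group that is not the fundamental group of a finite complex, that is, for a group that is not
  finitely presentable. Finite complexes may be taken with natural numbers as vertices. The choice
  of the base point is irrelevant since the realization is connected; its existence excludes the
  empty complex.\<close>

definition simplicial_complexity :: "'a monoid \<Rightarrow> enat" where
  "simplicial_complexity G =
     (INF K \<in> {K :: nat set set. finite_complex K \<and> dim_at_most K 2 \<and> connected (realization K) \<and>
                 (\<exists>x \<in> realization K. fundamental_group (realization K) x \<cong> G)}.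
        enat (card (simplices_of_dim 2 K)))"

section \<open>Free groups, free products and the free index\<close>

text \<open>Words over \<open>L\<close> modulo the equivalence relation generated by \<open>r\<close>. It is only used with
  relations \<open>r\<close> that are compatible with concatenation and whose equivalence preserves
  \<open>lists L\<close>.\<close>

definition word_group :: "'l set \<Rightarrow> ('l list \<Rightarrow> 'l list \<Rightarrow> bool) \<Rightarrow> 'l list set monoid" where
  "word_group L r =
     \<lparr>carrier = {Collect (equivclp r w) | w. w \<in> lists L},
      monoid.mult = (\<lambda>A B. {w. \<exists>u\<in>A. \<exists>v\<in>B. equivclp r (u @ v) w}),
      one = Collect (equivclp r [])\<rparr>"

inductive free_product_step ::
    "'a monoid \<Rightarrow> 'b monoid \<Rightarrow> ('a + 'b) list \<Rightarrow> ('a + 'b) list \<Rightarrow> bool"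
  for G :: "'a monoid" and H :: "'b monoid" where
  one_left: "free_product_step G H (u @ [Inl \<one>\<^bsub>G\<^esub>] @ v) (u @ v)"
| one_right: "free_product_step G H (u @ [Inr \<one>\<^bsub>H\<^esub>] @ v) (u @ v)"
| mult_left: "a \<in> carrier G \<Longrightarrow> b \<in> carrier G \<Longrightarrow>
    free_product_step G H (u @ [Inl a, Inl b] @ v) (u @ [Inl (a \<otimes>\<^bsub>G\<^esub> b)] @ v)"
| mult_right: "a \<in> carrier H \<Longrightarrow> b \<in> carrier H \<Longrightarrow>
    free_product_step G H (u @ [Inr a, Inr b] @ v) (u @ [Inr (a \<otimes>\<^bsub>H\<^esub> b)] @ v)"

definition free_product :: "'a monoid \<Rightarrow> 'b monoid \<Rightarrow> ('a + 'b) list set monoid" where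
  "free_product G H = word_group (Inl ` carrier G \<union> Inr ` carrier H) (free_product_step G H)"

text \<open>The letters \<open>(i, True)\<close> and \<open>(i, False)\<close> stand for the \<open>i\<close>-th generator and its inverse.\<close>

inductive free_group_step :: "nat \<Rightarrow> (nat \<times> bool) list \<Rightarrow> (nat \<times> bool) list \<Rightarrow> bool"
  for n :: nat where
  cancel: "i < n \<Longrightarrow> free_group_step n (u @ [(i, b), (i, \<not> b)] @ v) (u @ v)"

definition free_group :: "nat \<Rightarrow> (nat \<times> bool) list set monoid" where
  "free_group n = word_group ({..<n} \<times> UNIV) (free_group_step n)"

text \<open>A free factor of \<open>G\<close> is isomorphic to a subgroup of \<open>G\<close>; hence it is no restriction to let
  \<open>H\<close> range over groups with elements in the type of \<open>G\<close>, here and in the next definition.\<close>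

definition has_integer_free_factor :: "'a monoid \<Rightarrow> bool" where
  "has_integer_free_factor G \<longleftrightarrow>
     (\<exists>H :: 'a monoid. group H \<and> G \<cong> free_product H integer_group)"

text \<open>A relation rather than a function, so that its definition does not depend on the existence
  and uniqueness of the decomposition.\<close>

definition has_free_index :: "'a monoid \<Rightarrow> nat \<Rightarrow> bool" where
  "has_free_index G n \<longleftrightarrow>
     (\<exists>H :: 'a monoid. group H \<and> \<not> has_integer_free_factor H \<and> G \<cong> free_product H (free_group n))"

section \<open>Isomorphism classes of bounded simplicial complexity\<close>

text \<open>Groups with finite simplicial complexity are countable, so each isomorphism class of such
  groups is represented by groups whose elements are natural numbers.\<close>

definition iso_class :: "nat monoid \<Rightarrow> nat monoid set" where
  "iso_class G = {H. group H \<and> G \<cong> H}"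

definition groups_of_complexity :: "nat \<Rightarrow> nat monoid set set" where
  "groups_of_complexity T =
     {iso_class G | G. group G \<and> has_free_index G 0 \<and> simplicial_complexity G \<le> enat T}"

definition finite_abelian_groups_of_complexity :: "nat \<Rightarrow> nat monoid set set" where
  "finite_abelian_groups_of_complexity T =
     {C \<in> groups_of_complexity T. \<exists>G\<in>C. comm_group G \<and> finite (carrier G)}"

end

theory Submission
  imports Defs
begin

text \<open>Both estimates use that the fundamental group of a finite complex is its edge-path group, which
  is proved by simplicial approximation of paths and of their homotopies on dyadic grids.

  Upper bound: realize a group of free index zero by a complex with at most \<open>T\<close> triangles and with as
  few simplices as possible. Suppose that an edge lies in no triangle. If its end points have a common
  neighbour, then the edge splits off a free factor \<open>\<int>\<close>; otherwise it can be contracted. Hence every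
  edge lies in a triangle, so the complex is determined by its triangles. It has at most \<open>3T + 1\<close>
  vertices, and the sets of at most \<open>T\<close> triples of vertices can be counted.

  Lower bound: the cyclic group of order \<open>m < 2 ^ (k + 1)\<close> is the fundamental group of a complex with at most
  \<open>14k + 3\<close> triangles. Following the binary expansion of \<open>m\<close>, elementary expansions of a circle (which do
  not change the fundamental group) produce a loop that is the \<open>m\<close>-th power of a generator; doubling the
  exponent costs nine triangles and increasing it by one costs five. One more triangle then
  kills that loop.\<close>

section \<open>Quotients by congruences\<close>

text \<open>Simplicial complexity is defined topologically, but after the comparison with edge paths
  everything is algebra of lists: homomorphisms out of an edge-path group come from labellings of
  the edges that are multiplicative on triangles.

  The case distinction by common neighbours serves both sides. A common neighbour \<open>d\<close>
  of \<open>a\<close> and \<open>b\<close> gives the detour a, d, b, so deleting the edge keeps the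
  complex connected; and exactly then would contraction identify two edges at \<open>d\<close> and
  destroy the circle through a, d, b. Whether the edge is a bridge never has to be decided.

  The exponent 6 leaves room for a binomial coefficient: \<open>(3 * T + 1) choose 3\<close> plus
  one is at most \<open>T ^ 6\<close> when 2 \<le> T. In the lower bound, two of the three extra
  triangles move the generating edge away from the vertex 1. With k the integral part of (T - 3) /
  14, all orders from 1 to 2 ^ (k + 1) - 1 occur, and this is enough because the integral part of
  \<open>2 powr ((T - 3) / 14)\<close> is less than 2 ^ (k + 1).\<close>

definition quot_monoid :: "'p set \<Rightarrow> ('p \<Rightarrow> 'p \<Rightarrow> 'p) \<Rightarrow> 'p \<Rightarrow> ('p \<Rightarrow> 'p \<Rightarrow> bool) \<Rightarrow> 'p set monoid" where
  "quot_monoid S f e R =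
     \<lparr>carrier = (\<lambda>p. Collect (R p)) ` S,
      monoid.mult = (\<lambda>A B. {r. \<exists>p\<in>A. \<exists>q\<in>B. R (f p q) r}),
      one = Collect (R e)\<rparr>"

text \<open>Reflexivity and compatibility are asked for only on \<open>S\<close>, because
  \<open>homotopic_paths\<close> is reflexive only on paths inside the space and respects
  concatenation only when end points match. By \<open>closed\<close>, the class of an element of
  \<open>S\<close> stays inside \<open>S\<close>.\<close>

locale congruence =
  fixes S :: "'p set" and f :: "'p \<Rightarrow> 'p \<Rightarrow> 'p" and e :: 'p and R :: "'p \<Rightarrow> 'p \<Rightarrow> bool"
  assumes refl: "p \<in> S \<Longrightarrow> R p p"
    and sym: "R p q \<Longrightarrow> R q p"
    and trans: "R p q \<Longrightarrow> R q r \<Longrightarrow> R p r"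
    and closed: "R p q \<Longrightarrow> p \<in> S \<Longrightarrow> q \<in> S"
    and op_closed: "p \<in> S \<Longrightarrow> q \<in> S \<Longrightarrow> f p q \<in> S"
    and unit_closed: "e \<in> S"
    and cong: "R p p' \<Longrightarrow> R q q' \<Longrightarrow> p \<in> S \<Longrightarrow> q \<in> S \<Longrightarrow> R (f p q) (f p' q')"
begin

abbreviation Q where "Q \<equiv> quot_monoid S f e R"
abbreviation cls where "cls p \<equiv> Collect (R p)"

lemma cls_eq_iff: "p \<in> S \<Longrightarrow> q \<in> S \<Longrightarrow> cls p = cls q \<longleftrightarrow> R p q"
  using refl[of q] sym[of p q] trans[of p q] trans[of q p] by blast

lemma carrier_Q: "carrier Q = cls ` S"
  by (simp add: quot_monoid_def)

lemma cls_in_carrier: "p \<in> S \<Longrightarrow> cls p \<in> carrier Q"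
  by (simp add: quot_monoid_def)

lemma one_Q: "\<one>\<^bsub>Q\<^esub> = cls e"
  by (simp add: quot_monoid_def)

lemma mult_Q: assumes "p \<in> S" "q \<in> S" shows "cls p \<otimes>\<^bsub>Q\<^esub> cls q = cls (f p q)"
proof -
  have "R (f p q) r" if "R p p'" "R q q'" "R (f p' q') r" for p' q' r
    using that assms cong[of p p' q q'] trans by blast
  moreover have "\<exists>p'. R p p' \<and> (\<exists>q'. R q q' \<and> R (f p' q') r)" if "R (f p q) r" for r
    using that assms refl by blast
  ultimately show ?thesis by (auto simp: quot_monoid_def)
qed

lemma group_Q:
  assumes assoc: "\<And>p q r. \<lbrakk>p \<in> S; q \<in> S; r \<in> S\<rbrakk> \<Longrightarrow> R (f (f p q) r) (f p (f q r))"
    and left_unit: "\<And>p. p \<in> S \<Longrightarrow> R (f e p) p"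
    and left_inv: "\<And>p. p \<in> S \<Longrightarrow> \<exists>q\<in>S. R (f q p) e"
  shows "group Q"
proof (rule groupI)
  fix x y z assume "x \<in> carrier Q" "y \<in> carrier Q" "z \<in> carrier Q"
  then obtain p q r where pqr: "p \<in> S" "q \<in> S" "r \<in> S" "x = cls p" "y = cls q" "z = cls r"
    by (auto simp: carrier_Q)
  have "cls (f (f p q) r) = cls (f p (f q r))"
    using pqr assoc op_closed cls_eq_iff by simp
  then show "x \<otimes>\<^bsub>Q\<^esub> y \<otimes>\<^bsub>Q\<^esub> z = x \<otimes>\<^bsub>Q\<^esub> (y \<otimes>\<^bsub>Q\<^esub> z)"
    using pqr op_closed by (simp add: mult_Q)
next
  fix x y assume "x \<in> carrier Q" "y \<in> carrier Q"
  then show "x \<otimes>\<^bsub>Q\<^esub> y \<in> carrier Q"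
    using op_closed by (auto simp: carrier_Q mult_Q)
next
  show "\<one>\<^bsub>Q\<^esub> \<in> carrier Q" using unit_closed by (simp add: one_Q cls_in_carrier)
next
  fix x assume "x \<in> carrier Q"
  then obtain p where p: "p \<in> S" "x = cls p" by (auto simp: carrier_Q)
  have "cls (f e p) = cls p" using p left_unit op_closed unit_closed cls_eq_iff by simp
  then show "\<one>\<^bsub>Q\<^esub> \<otimes>\<^bsub>Q\<^esub> x = x" using p unit_closed by (simp add: one_Q mult_Q)
  obtain q where q: "q \<in> S" "R (f q p) e" using p left_inv by blast
  have "cls (f q p) = cls e" using p q op_closed unit_closed cls_eq_iff by simp
  then show "\<exists>y\<in>carrier Q. y \<otimes>\<^bsub>Q\<^esub> x = \<one>\<^bsub>Q\<^esub>"
    using p q by (auto intro!: bexI[of _ "cls q"] simp: one_Q mult_Q cls_in_carrier)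
qed

text \<open>The first isomorphism theorem on representatives: two elements of \<open>S\<close> have
  equal values under \<open>h\<close> exactly if they are related, so evaluating \<open>h\<close> at
  a chosen representative is well defined and injective.\<close>

lemma iso_Q:
  fixes A :: "('c, 'd) monoid_scheme" and h :: "'p \<Rightarrow> 'c"
  assumes img: "h ` S = carrier A"
    and hom: "\<And>p q. p \<in> S \<Longrightarrow> q \<in> S \<Longrightarrow> h (f p q) = h p \<otimes>\<^bsub>A\<^esub> h q"
    and ker: "\<And>p q. p \<in> S \<Longrightarrow> q \<in> S \<Longrightarrow> R p q \<longleftrightarrow> h p = h q"
  shows "Q \<cong> A"
proof -
  define F where "F C = h (SOME p. p \<in> C)" for C
  have F: "F (cls p) = h p" if "p \<in> S" for p
  proof -
    have R: "R p (SOME q. R p q)" using refl[OF that] by (rule someI)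
    with that have "(SOME q. R p q) \<in> S" by (rule closed[rotated])
    then show ?thesis using that R ker[of p "SOME q. R p q"] by (simp add: F_def)
  qed
  have "F \<in> hom Q A"
    using img hom F op_closed by (intro homI) (auto simp: carrier_Q mult_Q)
  moreover have "bij_betw F (carrier Q) (carrier A)"
  proof (rule bij_betwI')
    fix x y assume "x \<in> carrier Q" "y \<in> carrier Q"
    then obtain p q where "p \<in> S" "q \<in> S" "x = cls p" "y = cls q" by (auto simp: carrier_Q)
    then show "(F x = F y) = (x = y)"
      using ker[of p q] cls_eq_iff[of p q] by (simp add: F)
  next
    fix x assume "x \<in> carrier Q" then show "F x \<in> carrier A" using img F by (auto simp: carrier_Q)
  next
    fix y assume "y \<in> carrier A"
    then obtain p where "p \<in> S" "y = h p" using img by auto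
    then show "\<exists>x\<in>carrier Q. y = F x" using F by (auto simp: carrier_Q)
  qed
  ultimately show ?thesis by (auto simp: is_iso_def iso_def)
qed

end

text \<open>The conditions \<open>hom\<close> and \<open>surj\<close> hold only up to the target
  relation, since maps such as \<open>poly_path\<close> respect concatenation only up to
  homotopy.\<close>

lemma iso_quot_monoids:
  assumes "congruence S f e R" "congruence S' f' e' R'"
    and map: "\<And>p. p \<in> S \<Longrightarrow> h p \<in> S'"
    and hom: "\<And>p q. p \<in> S \<Longrightarrow> q \<in> S \<Longrightarrow> R' (h (f p q)) (f' (h p) (h q))"
    and ker: "\<And>p q. p \<in> S \<Longrightarrow> q \<in> S \<Longrightarrow> R p q \<longleftrightarrow> R' (h p) (h q)"
    and surj: "\<And>q. q \<in> S' \<Longrightarrow> \<exists>p\<in>S. R' (h p) q"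
  shows "quot_monoid S f e R \<cong> quot_monoid S' f' e' R'"
proof -
  interpret A: congruence S f e R by fact
  interpret B: congruence S' f' e' R' by fact
  show ?thesis
  proof (rule A.iso_Q[where h = "\<lambda>p. B.cls (h p)"])
    show "(\<lambda>p. B.cls (h p)) ` S = carrier B.Q"
    proof
      show "(\<lambda>p. B.cls (h p)) ` S \<subseteq> carrier B.Q" using map by (auto simp: B.carrier_Q)
      show "carrier B.Q \<subseteq> (\<lambda>p. B.cls (h p)) ` S"
      proof
        fix x assume "x \<in> carrier B.Q"
        then obtain q where q: "q \<in> S'" "x = B.cls q" by (auto simp: B.carrier_Q)
        then obtain p where p: "p \<in> S" "R' (h p) q" using surj by blast
        then have "B.cls (h p) = x" using q map B.cls_eq_iff by simp
        then show "x \<in> (\<lambda>p. B.cls (h p)) ` S" using p by blast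
      qed
    qed
  next
    fix p q assume pq: "p \<in> S" "q \<in> S"
    show "B.cls (h (f p q)) = B.cls (h p) \<otimes>\<^bsub>B.Q\<^esub> B.cls (h q)"
      using pq B.mult_Q[of "h p" "h q"] B.cls_eq_iff hom map A.op_closed B.op_closed by simp
    show "R p q \<longleftrightarrow> B.cls (h p) = B.cls (h q)"
      using pq ker[of p q] map B.cls_eq_iff[of "h p" "h q"] by simp
  qed
qed

text \<open>The product in \<open>quot_monoid\<close> is copied from the shape shared by
  \<open>word_group\<close> and \<open>fundamental_group\<close>, so that both are instances by
  unfolding.\<close>

lemma word_group_eq_quot: "word_group L r = quot_monoid (lists L) (@) [] (equivclp r)"
  by (auto simp: word_group_def quot_monoid_def)

lemma fundamental_group_eq_quot:
  "fundamental_group X x =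
     quot_monoid {p. path p \<and> path_image p \<subseteq> X \<and> pathstart p = x \<and> pathfinish p = x} (+++) (\<lambda>_. x)
       (homotopic_paths X)"
  by (auto simp: fundamental_group_def quot_monoid_def)

section \<open>Transport of group structures\<close>

text \<open>For a group on \<open>nat\<close>, \<open>has_integer_free_factor\<close> asks for a
  complementary factor on \<open>nat\<close>, whereas edge-path groups consist of sets of lists and
  cyclic groups of integers. This transports both.\<close>

lemma countable_group_nat:
  fixes G :: "'a monoid"
  assumes G: "group G" and "countable (carrier G)"
  obtains H :: "nat monoid" where "group H" "G \<cong> H"
proof -
  interpret group G by fact
  define f where "f = to_nat_on (carrier G)"
  have inj: "inj_on f (carrier G)" unfolding f_def using assms inj_on_to_nat_on by blast
  define g where "g = inv_into (carrier G) f"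
  have g: "g (f x) = x" if "x \<in> carrier G" for x using that inj by (simp add: g_def)
  define H where "H = \<lparr>carrier = f ` carrier G, monoid.mult = (\<lambda>x y. f (g x \<otimes>\<^bsub>G\<^esub> g y)), one = f \<one>\<^bsub>G\<^esub>\<rparr>"
  have "f \<in> iso G H"
    by (auto simp: iso_def hom_def H_def g bij_betw_def inj)
  moreover have "group H"
  proof (rule groupI)
    fix x assume "x \<in> carrier H"
    then obtain y where y: "y \<in> carrier G" "x = f y" by (auto simp: H_def)
    then show "\<exists>y\<in>carrier H. y \<otimes>\<^bsub>H\<^esub> x = \<one>\<^bsub>H\<^esub>"
      by (intro bexI[of _ "f (inv\<^bsub>G\<^esub> y)"]) (auto simp: H_def g)
  qed (auto simp: H_def g m_assoc)
  ultimately show thesis using that is_isoI by blast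
qed

section \<open>The edge-path group\<close>

lemma equivclp_map:
  assumes "\<And>x y. r x y \<Longrightarrow> equivclp s (f x) (f y)" and "equivclp r x y"
  shows "equivclp s (f x) (f y)"
  using assms(2)
proof (induction rule: equivclp_induct)
  case (step y z)
  then have "equivclp s (f y) (f z)" using assms(1) equivclp_sym by metis
  then show ?case using step.IH equivclp_trans by metis
qed simp

lemma equivclp_invariant:
  assumes "\<And>x y. r x y \<Longrightarrow> P x \<longleftrightarrow> P y" and "equivclp r x y"
  shows "P x \<longleftrightarrow> P y"
  using assms(2) by (induction rule: equivclp_induct) (use assms(1) in blast)+

text \<open>The vertices in \<open>triangle\<close> may coincide: a backtrack a, b, a is a
  degenerate triangle followed by a stutter, so the cancellation of backtracks is included.\<close>

inductive edge_step :: "'v set set \<Rightarrow> 'v list \<Rightarrow> 'v list \<Rightarrow> bool" for K where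
  stutter: "edge_step K (u @ [a, a] @ v) (u @ [a] @ v)"
| triangle: "{a, b, c} \<in> K \<Longrightarrow> edge_step K (u @ [a, b, c] @ v) (u @ [a, c] @ v)"

abbreviation edge_eq :: "'v set set \<Rightarrow> 'v list \<Rightarrow> 'v list \<Rightarrow> bool" where
  "edge_eq K \<equiv> equivclp (edge_step K)"

text \<open>Since \<open>{a, a}\<close> is \<open>{a}\<close>, consecutive vertices may be equal.
  Hence a simplicial map that collapses edges still sends walks to walks.\<close>

definition walk :: "'v set set \<Rightarrow> 'v list \<Rightarrow> bool" where
  "walk K L \<longleftrightarrow> L \<noteq> [] \<and> (\<forall>a\<in>set L. {a} \<in> K) \<and> successively (\<lambda>a b. {a, b} \<in> K) L"

definition walks :: "'v set set \<Rightarrow> 'v \<Rightarrow> 'v \<Rightarrow> 'v list set" where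
  "walks K a b = {L. walk K L \<and> hd L = a \<and> last L = b}"

text \<open>Composable walks share a vertex; \<open>tl\<close> removes its second copy.\<close>

definition edge_group :: "'v set set \<Rightarrow> 'v \<Rightarrow> 'v list set monoid" where
  "edge_group K v = quot_monoid (walks K v v) (\<lambda>p q. p @ tl q) [v] (edge_eq K)"

lemma complex_face: "finite_complex K \<Longrightarrow> s \<in> K \<Longrightarrow> t \<subseteq> s \<Longrightarrow> t \<noteq> {} \<Longrightarrow> t \<in> K"
  unfolding finite_complex_def by blast

lemma edge_eq_trans [trans]: "edge_eq K p q \<Longrightarrow> edge_eq K q r \<Longrightarrow> edge_eq K p r"
  by (rule equivclp_trans)

lemma edge_eq_context: "edge_eq K p q \<Longrightarrow> edge_eq K (u @ p @ v) (u @ q @ v)"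
proof (rule equivclp_map[where f = "\<lambda>p. u @ p @ v"])
  fix x y assume "edge_step K x y"
  then have "edge_step K (u @ x @ v) (u @ y @ v)"
  proof cases
    case (stutter u' a v')
    show ?thesis using edge_step.stutter[of K "u @ u'" a "v' @ v"] stutter by simp
  next
    case (triangle a b c u' v')
    show ?thesis using edge_step.triangle[OF triangle(3), of "u @ u'" "v' @ v"] triangle by simp
  qed
  then show "edge_eq K (u @ x @ v) (u @ y @ v)" by blast
qed

lemma edge_eq_appendL: "edge_eq K p q \<Longrightarrow> edge_eq K (u @ p) (u @ q)"
  using edge_eq_context[of K p q u "[]"] by simp

lemma edge_eq_appendR: "edge_eq K p q \<Longrightarrow> edge_eq K (p @ v) (q @ v)"
  using edge_eq_context[of K p q "[]" v] by simp

lemma edge_eq_Cons: "edge_eq K p q \<Longrightarrow> edge_eq K (a # p) (a # q)"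
  using edge_eq_appendL[of K p q "[a]"] by simp

lemma edge_eq_stutter: "edge_eq K (a # a # v) (a # v)"
  using edge_step.stutter[of K "[]" a v] by auto

lemma edge_eq_triangle: "{a, b, c} \<in> K \<Longrightarrow> edge_eq K (a # b # c # v) (a # c # v)"
  using edge_step.triangle[of a b c K "[]" v] by auto

lemma edge_eq_backtrack: "{a, b} \<in> K \<Longrightarrow> edge_eq K (a # b # a # v) (a # v)"
  using edge_eq_triangle[of a b a K v] edge_eq_stutter[of K a v] by (auto simp: insert_commute intro: edge_eq_trans)

lemma edge_step_endpoints:
  "edge_step K p q \<Longrightarrow> p \<noteq> [] \<and> q \<noteq> [] \<and> hd p = hd q \<and> last p = last q"
  by (induction rule: edge_step.induct) (auto simp: hd_append)

lemma edge_eq_Nil_iff: "edge_eq K p q \<Longrightarrow> p = [] \<longleftrightarrow> q = []"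
  by (rule equivclp_invariant) (auto dest: edge_step_endpoints)

lemma edge_eq_hd: "edge_eq K p q \<Longrightarrow> hd p = hd q"
  using equivclp_invariant[of "edge_step K" "\<lambda>x. hd x = hd p" p q] edge_step_endpoints by metis

lemma edge_eq_last: "edge_eq K p q \<Longrightarrow> last p = last q"
  using equivclp_invariant[of "edge_step K" "\<lambda>x. last x = last p" p q] edge_step_endpoints by metis

section \<open>Walks under concatenation and edge-path equivalence\<close>

lemma walk_Cons_Cons: "finite_complex K \<Longrightarrow> walk K (a # b # L) \<longleftrightarrow> {a, b} \<in> K \<and> walk K (b # L)"
  using complex_face[of K "{a, b}" "{a}"] by (auto simp: walk_def)

lemma walk_single: "walk K [a] \<longleftrightarrow> {a} \<in> K"
  by (simp add: walk_def)

lemma walk_append: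
  "p \<noteq> [] \<Longrightarrow> q \<noteq> [] \<Longrightarrow> walk K (p @ q) \<longleftrightarrow> walk K p \<and> walk K q \<and> {last p, hd q} \<in> K"
  by (auto simp: walk_def successively_append_iff)

lemma walk_edge_step:
  assumes "finite_complex K" "edge_step K p q" shows "walk K p \<longleftrightarrow> walk K q"
  using assms(2)
proof cases
  case (stutter u a v)
  then show ?thesis by (auto simp: walk_def successively_append_iff successively_Cons)
next
  case (triangle a b c u v)
  then have "{b} \<in> K" "{a, b} \<in> K" "{b, c} \<in> K" "{a, c} \<in> K"
    using complex_face[OF assms(1) triangle(3)] by auto
  then show ?thesis using triangle by (auto simp: walk_def successively_append_iff successively_Cons)
qed

lemma walk_edge_eq: "finite_complex K \<Longrightarrow> edge_eq K p q \<Longrightarrow> walk K p \<longleftrightarrow> walk K q"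
  by (rule equivclp_invariant) (auto dest: walk_edge_step)

lemma walk_join:
  assumes "walk K p" "walk K q" "last p = hd q" shows "walk K (p @ tl q)"
proof (cases q)
  case (Cons a q')
  show ?thesis
  proof (cases q')
    case Nil then show ?thesis using assms Cons by simp
  next
    case (Cons b q'')
    then show ?thesis using assms \<open>q = a # q'\<close>
      by (auto simp: walk_def successively_append_iff successively_Cons)
  qed
qed (use assms in \<open>simp add: walk_def\<close>)

lemma last_join: "q \<noteq> [] \<Longrightarrow> last p = hd q \<Longrightarrow> last (p @ tl q) = last q"
  by (cases q) (auto simp: last_append)

lemma walk_rev: "walk K (rev p) \<longleftrightarrow> walk K p"
  by (simp add: walk_def insert_commute)

lemma walksD:
  assumes "p \<in> walks K a b" shows "p \<noteq> []" "walk K p" "hd p = a" "last p = b"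
  using assms by (simp_all add: walks_def walk_def)

lemma walksI: "walk K p \<Longrightarrow> hd p = a \<Longrightarrow> last p = b \<Longrightarrow> p \<in> walks K a b"
  by (simp add: walks_def)

lemma walks_join:
  assumes "p \<in> walks K a b" "q \<in> walks K b c" shows "p @ tl q \<in> walks K a c"
  using walksD[OF assms(1)] walksD[OF assms(2)] by (intro walksI) (simp_all add: walk_join last_join)

lemma walks_append:
  assumes "p \<in> walks K a b" "q \<in> walks K c d" "{b, c} \<in> K" shows "p @ q \<in> walks K a d"
  using walksD[OF assms(1)] walksD[OF assms(2)] assms(3) by (intro walksI) (simp_all add: walk_append)

lemma walks_rev:
  assumes "p \<in> walks K a b" shows "rev p \<in> walks K b a"
  using walksD[OF assms] by (intro walksI) (simp_all add: walk_rev hd_rev last_rev)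

lemma walks_single: "{a} \<in> K \<Longrightarrow> [a] \<in> walks K a a"
  by (simp add: walks_def walk_single)

lemma walks_edge: "finite_complex K \<Longrightarrow> {a, b} \<in> K \<Longrightarrow> [a, b] \<in> walks K a b"
  using complex_face[of K "{a,b}" "{b}"] by (simp add: walks_def walk_single walk_Cons_Cons)

lemma walks_edge_eq:
  "finite_complex K \<Longrightarrow> edge_eq K p q \<Longrightarrow> p \<in> walks K a b \<longleftrightarrow> q \<in> walks K a b"
  using walk_edge_eq[of K p q] edge_eq_hd[of K p q] edge_eq_last[of K p q] by (auto simp: walks_def)

text \<open>The shared vertex can be counted as the end of the first walk or as the start of the
  second, so each of the two replacements acts on a complete walk.\<close>

lemma edge_eq_join:
  assumes "edge_eq K p p'" "edge_eq K q q'" "p \<noteq> []" "q \<noteq> []" "last p = hd q"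
  shows "edge_eq K (p @ tl q) (p' @ tl q')"
proof -
  have ne: "p' \<noteq> []" "q' \<noteq> []" and ends: "last p' = last p" "hd q' = hd q"
    using assms edge_eq_Nil_iff edge_eq_last edge_eq_hd by metis+
  have "p' @ tl q = butlast p' @ q" "p' @ tl q' = butlast p' @ q'"
    using ne ends assms(3-5) by (metis append_assoc append_butlast_last_id append_Cons append_Nil list.collapse)+
  then show ?thesis
    using edge_eq_appendR[OF assms(1), of "tl q"] edge_eq_appendL[OF assms(2), of "butlast p'"]
    by (metis edge_eq_trans)
qed

text \<open>The list turns around in its middle, and each step of the induction removes the
  backtrack at the turning point.\<close>

lemma edge_eq_rev_join:
  assumes "finite_complex K" "walk K p" shows "edge_eq K (rev p @ tl p) [last p]"
  using assms(2)
proof (induction p rule: induct_list012)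
  case (3 a b L)
  then have ab: "{b, a} \<in> K" and w: "walk K (b # L)" using assms by (auto simp: walk_Cons_Cons insert_commute)
  have "edge_eq K (rev L @ (b # a # b # L)) (rev L @ (b # L))"
    by (intro edge_eq_appendL edge_eq_backtrack ab)
  with 3(2)[OF w] show ?case using edge_eq_trans by fastforce
qed (auto simp: walk_def)

lemma edge_eq_join_rev:
  assumes "finite_complex K" "walk K p" shows "edge_eq K (p @ tl (rev p)) [hd p]"
  using edge_eq_rev_join[OF assms(1), of "rev p"] assms(2) walk_rev[of K p]
  by (simp add: last_rev walk_def)

lemma congruence_edge:
  assumes "finite_complex K" "{v} \<in> K"
  shows "congruence (walks K v v) (\<lambda>p q. p @ tl q) [v] (edge_eq K)"
proof
  fix p p' q q' assume eq: "edge_eq K p p'" "edge_eq K q q'" and w: "p \<in> walks K v v" "q \<in> walks K v v"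
  show "edge_eq K (p @ tl q) (p' @ tl q')"
    using walksD[OF w(1)] walksD[OF w(2)] by (intro edge_eq_join eq) simp_all
next
  fix p q assume "edge_eq K p q" "p \<in> walks K v v"
  then show "q \<in> walks K v v" using walks_edge_eq[OF assms(1)] by blast
next
  fix p q assume "p \<in> walks K v v" "q \<in> walks K v v"
  then show "p @ tl q \<in> walks K v v" by (rule walks_join)
next
  fix p q assume "edge_eq K p q" then show "edge_eq K q p" by (rule equivclp_sym)
next
  fix p q r assume "edge_eq K p q" "edge_eq K q r" then show "edge_eq K p r" by (rule edge_eq_trans)
qed (use assms walks_single in auto)

lemma group_edge_group:
  assumes K: "finite_complex K" "{v} \<in> K"
  shows "group (edge_group K v)"
proof -
  interpret congruence "walks K v v" "\<lambda>p q. p @ tl q" "[v]" "edge_eq K" by (rule congruence_edge[OF K])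
  show ?thesis unfolding edge_group_def
  proof (rule group_Q)
    fix p q r assume "p \<in> walks K v v" "q \<in> walks K v v" "r \<in> walks K v v"
    then show "edge_eq K ((p @ tl q) @ tl r) (p @ tl (q @ tl r))"
      using walksD(1)[of q K v v] by (cases q) simp_all
  next
    fix p assume p: "p \<in> walks K v v"
    then show "edge_eq K ([v] @ tl p) p" using walksD[OF p] by (cases p) simp_all
    show "\<exists>q\<in>walks K v v. edge_eq K (q @ tl p) [v]"
      using walksD[OF p] edge_eq_rev_join[OF K(1), of p] walks_rev[OF p] by metis
  qed
qed

text \<open>Any three vertices of \<open>s\<close> span a simplex: the tail shrinks to an edge by
  induction, and one triangle then removes the second vertex.\<close>

lemma edge_eq_in_simplex:
  assumes "finite_complex K" "s \<in> K" "set L \<subseteq> s" "L \<noteq> []"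
  shows "edge_eq K L [hd L, last L]"
  using assms(3,4)
proof (induction L rule: induct_list012)
  case (2 x) then show ?case using equivclp_sym[OF edge_eq_stutter] by auto
next
  case (3 a b L)
  have "edge_eq K (a # b # L) (a # [b, last (b # L)])"
    using edge_eq_Cons[OF 3(2), of a] 3(3) by simp
  also have "edge_eq K (a # [b, last (b # L)]) [a, last (b # L)]"
  proof (rule edge_eq_triangle)
    have "last (b # L) \<in> set (b # L)" by (rule last_in_set) simp
    then show "{a, b, last (b # L)} \<in> K" using 3 by (intro complex_face[OF assms(1,2)]) auto
  qed
  finally show ?case by simp
qed simp

lemma edge_eq_same_simplex:
  assumes "finite_complex K" "s \<in> K" "set L \<subseteq> s" "set M \<subseteq> s" "L \<noteq> []" "M \<noteq> []" "hd L = hd M" "last L = last M"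
  shows "edge_eq K L M"
  using edge_eq_in_simplex[OF assms(1,2), of L] edge_eq_in_simplex[OF assms(1,2), of M] assms
  by (metis edge_eq_trans equivclp_sym)

lemma edge_eq_mono: "edge_eq K p q \<Longrightarrow> K \<subseteq> K' \<Longrightarrow> edge_eq K' p q"
proof (rule equivclp_map[where f = "\<lambda>x. x"])
  fix x y assume "K \<subseteq> K'" "edge_step K x y"
  then have "edge_step K' x y" by (auto simp: edge_step.simps)
  then show "edge_eq K' x y" by blast
qed

lemma walks_mono: "K \<subseteq> K' \<Longrightarrow> walks K a b \<subseteq> walks K' a b"
  by (auto simp: walks_def walk_def intro: successively_mono)

subsection \<open>Simplicial maps\<close>

lemma edge_eq_map:
  assumes "\<And>s. s \<in> K \<Longrightarrow> f ` s \<in> K'" and "edge_eq K p q"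
  shows "edge_eq K' (map f p) (map f q)"
proof (rule equivclp_map[OF _ assms(2)])
  fix x y assume "edge_step K x y"
  then have "edge_step K' (map f x) (map f y)"
  proof cases
    case (stutter u a v) then show ?thesis using edge_step.stutter[of K' "map f u" "f a" "map f v"] by simp
  next
    case (triangle a b c u v)
    then show ?thesis using edge_step.triangle[of "f a" "f b" "f c" K' "map f u" "map f v"] assms(1)[of "{a,b,c}"]
      by simp
  qed
  then show "edge_eq K' (map f x) (map f y)" by blast
qed

lemma walks_map:
  assumes "\<And>s. s \<in> K \<Longrightarrow> f ` s \<in> K'" and "p \<in> walks K a b"
  shows "map f p \<in> walks K' (f a) (f b)"
proof -
  have "{f x} \<in> K'" if "{x} \<in> K" for x using assms(1)[OF that] by simp
  moreover have "{f x, f y} \<in> K'" if "{x, y} \<in> K" for x y using assms(1)[OF that] by simp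
  ultimately show ?thesis using assms(2)
    by (auto simp: walks_def walk_def successively_map hd_map last_map intro: successively_mono)
qed

text \<open>The inverse \<open>g\<close> acts on walks rather than on vertices, because the inverse
  of a contraction is \<open>lift_path\<close>, which inserts vertices into a walk.\<close>

lemma edge_group_iso_map:
  assumes K: "finite_complex K" "{v} \<in> K" and K': "finite_complex K'"
    and f: "\<And>s. s \<in> K \<Longrightarrow> f ` s \<in> K'"
    and g: "\<And>p q. edge_eq K' p q \<Longrightarrow> p \<in> walks K' (f v) (f v) \<Longrightarrow> edge_eq K (g p) (g q)"
    and g_walks: "\<And>p. p \<in> walks K' (f v) (f v) \<Longrightarrow> g p \<in> walks K v v"
    and gf: "\<And>p. p \<in> walks K v v \<Longrightarrow> edge_eq K (g (map f p)) p"
    and fg: "\<And>p. p \<in> walks K' (f v) (f v) \<Longrightarrow> edge_eq K' (map f (g p)) p"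
  shows "edge_group K v \<cong> edge_group K' (f v)"
  unfolding edge_group_def
proof (rule iso_quot_monoids[where h = "map f"])
  show "congruence (walks K v v) (\<lambda>p q. p @ tl q) [v] (edge_eq K)" using K by (rule congruence_edge)
  have "{f v} \<in> K'" using f[OF K(2)] by simp
  with K' show "congruence (walks K' (f v) (f v)) (\<lambda>p q. p @ tl q) [f v] (edge_eq K')"
    by (rule congruence_edge)
next
  fix p q assume pq: "p \<in> walks K v v" "q \<in> walks K v v"
  show "map f p \<in> walks K' (f v) (f v)" using walks_map[OF f pq(1)] .
  show "edge_eq K' (map f (p @ tl q)) (map f p @ tl (map f q))" by (simp add: map_tl)
  show "edge_eq K p q \<longleftrightarrow> edge_eq K' (map f p) (map f q)"
  proof
    assume "edge_eq K' (map f p) (map f q)"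
    then have "edge_eq K (g (map f p)) (g (map f q))" using g walks_map[OF f pq(1)] by blast
    then show "edge_eq K p q" using gf pq by (meson edge_eq_trans equivclp_sym)
  qed (use edge_eq_map[OF f] in blast)
next
  fix q assume "q \<in> walks K' (f v) (f v)"
  then show "\<exists>p\<in>walks K v v. edge_eq K' (map f p) q" using g_walks fg by blast
qed

lemma finite_complex_image:
  assumes "finite_complex K" shows "finite_complex ((`) f ` K)"
  unfolding finite_complex_def
proof (intro conjI ballI allI impI)
  show "finite ((`) f ` K)" using assms by (simp add: finite_complex_def)
next
  fix s assume "s \<in> (`) f ` K" then show "finite s" "s \<noteq> {}" using assms by (auto simp: finite_complex_def)
next
  fix s t assume "s \<in> (`) f ` K" "t \<subseteq> s \<and> t \<noteq> {}"
  then obtain s' where s': "s' \<in> K" "s = f ` s'" and t: "t \<subseteq> f ` s'" "t \<noteq> {}" by auto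
  \<comment> \<open>A face of the image is the image of the part of the simplex that lies over
    it.\<close>
  then have "t = f ` {x \<in> s'. f x \<in> t}" by auto
  moreover have "{x \<in> s'. f x \<in> t} \<in> K" using t by (intro complex_face[OF assms s'(1)]) auto
  ultimately show "t \<in> (`) f ` K" by blast
qed

lemma edge_group_relabel:
  assumes K: "finite_complex K" "{v} \<in> K" and inj: "inj_on f (\<Union>K)"
  shows "edge_group K v \<cong> edge_group ((`) f ` K) (f v)"
proof -
  define g where "g = inv_into (\<Union>K) f"
  have gf: "g (f x) = x" if "x \<in> \<Union>K" for x using inj that by (simp add: g_def)
  have img: "g ` f ` s = s" if "s \<in> K" for s
  proof -
    have "(\<lambda>x. g (f x)) ` s = (\<lambda>x. x) ` s" using that gf by (intro image_cong) blast+
    then show ?thesis by (simp add: image_image)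
  qed
  have gK: "g ` s \<in> K" if "s \<in> (`) f ` K" for s
  proof -
    from that obtain s' where "s' \<in> K" "s = f ` s'" by blast
    then show ?thesis using img by simp
  qed
  have fgs: "f (g x) = x" if "{x} \<in> (`) f ` K" for x
  proof -
    from that obtain s' where "s' \<in> K" "{x} = f ` s'" by blast
    then have "x \<in> f ` \<Union>K" by blast
    then show ?thesis unfolding g_def by (rule f_inv_into_f)
  qed
  have 1: "edge_eq K (map g (map f p)) p" if "p \<in> walks K v v" for p
  proof -
    have "g (f x) = x" if "x \<in> set p" for x
    proof (rule gf)
      have "{x} \<in> K" using that walksD(2)[OF \<open>p \<in> walks K v v\<close>] by (simp add: walk_def)
      then show "x \<in> \<Union>K" by blast
    qed
    then have "map g (map f p) = p" by (simp add: map_idI)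
    then show ?thesis by simp
  qed
  have 2: "edge_eq ((`) f ` K) (map f (map g p)) p" if "p \<in> walks ((`) f ` K) (f v) (f v)" for p
  proof -
    have "f (g x) = x" if "x \<in> set p" for x
      using that walksD(2)[OF \<open>p \<in> walks _ _ _\<close>] by (intro fgs) (simp add: walk_def)
    then have "map f (map g p) = p" by (simp add: map_idI)
    then show ?thesis by simp
  qed
  have gv: "g (f v) = v" using K(2) by (intro gf) blast
  show ?thesis
  proof (rule edge_group_iso_map[OF K finite_complex_image[OF K(1)], where g = "map g"])
    show "map g p \<in> walks K v v" if "p \<in> walks ((`) f ` K) (f v) (f v)" for p
      using walks_map[OF gK that] gv by simp
    show "edge_eq K (map g p) (map g q)" if "edge_eq ((`) f ` K) p q" for p q
      using edge_eq_map[OF gK that] .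
  qed (use 1 2 in blast)+
qed

subsection \<open>Labellings of the edges\<close>

fun label_prod :: "('g, 'x) monoid_scheme \<Rightarrow> ('v \<Rightarrow> 'v \<Rightarrow> 'g) \<Rightarrow> 'v list \<Rightarrow> 'g" where
  "label_prod A w (a # b # L) = w a b \<otimes>\<^bsub>A\<^esub> label_prod A w (b # L)"
| "label_prod A w [a] = \<one>\<^bsub>A\<^esub>"
| "label_prod A w [] = \<one>\<^bsub>A\<^esub>"

text \<open>A functor from the edge-path groupoid to \<open>A\<close>, given on edges. As triangles
  may be degenerate, \<open>label_mult\<close> also forces trivial labels at vertices and inverse
  labels on reversed edges.\<close>

locale cocycle = group A for A (structure) +
  fixes K :: "'v set set" and w :: "'v \<Rightarrow> 'v \<Rightarrow> 'a"
  assumes complex: "finite_complex K"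
    and label_closed: "{a, b} \<in> K \<Longrightarrow> w a b \<in> carrier A"
    and label_mult: "{a, b, c} \<in> K \<Longrightarrow> w a b \<otimes> w b c = w a c"
begin

lemma label_refl: "{a} \<in> K \<Longrightarrow> w a a = \<one>"
  using label_mult[of a a a] label_closed[of a a] by (simp add: r_cancel_one)

lemma label_prod_closed: "walk K L \<Longrightarrow> label_prod A w L \<in> carrier A"
  by (induction L rule: induct_list012) (auto simp: walk_Cons_Cons[OF complex] label_closed)

lemma label_prod_split:
  "walk K (u @ [a] @ v) \<Longrightarrow> label_prod A w (u @ [a] @ v) = label_prod A w (u @ [a]) \<otimes> label_prod A w (a # v)"
proof (induction u)
  case Nil then show ?case by (simp add: label_prod_closed)
next
  case (Cons x u)
  obtain y u' where y: "u @ [a] = y # u'" by (cases u) auto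
  then have uv: "u @ [a] @ v = y # (u' @ v)" by (metis append_Cons append_assoc)
  then have xuv: "(x # u) @ [a] @ v = x # y # (u' @ v)" by (metis append_Cons)
  have "walk K (x # y # (u' @ v))" using Cons.prems unfolding xuv .
  then have w: "walk K (y # (u' @ v))" and xy: "{x, y} \<in> K"
    by (simp_all add: walk_Cons_Cons[OF complex])
  then have wu: "walk K (y # u')" and wa: "walk K (a # v)"
    unfolding uv[symmetric] y[symmetric] by (auto simp: walk_def successively_Cons successively_append_iff)
  have IH: "label_prod A w (y # (u' @ v)) = label_prod A w (y # u') \<otimes> label_prod A w (a # v)"
    using Cons.IH w unfolding uv y .
  have "label_prod A w ((x # u) @ [a] @ v) = w x y \<otimes> (label_prod A w (y # u') \<otimes> label_prod A w (a # v))"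
    unfolding xuv by (simp add: IH)
  also have "\<dots> = w x y \<otimes> label_prod A w (y # u') \<otimes> label_prod A w (a # v)"
    using label_closed[OF xy] label_prod_closed[OF wu] label_prod_closed[OF wa] by (simp add: m_assoc)
  also have "w x y \<otimes> label_prod A w (y # u') = label_prod A w ((x # u) @ [a])" using y by simp
  finally show ?case .
qed

lemma label_prod_join:
  assumes "walk K p" "walk K q" "last p = hd q"
  shows "label_prod A w (p @ tl q) = label_prod A w p \<otimes> label_prod A w q"
proof -
  have ne: "p \<noteq> []" "q \<noteq> []" using assms by (auto simp: walk_def)
  have p: "butlast p @ [last p] = p" using ne by simp
  have q: "last p # tl q = q" using ne assms(3) by simp
  have eq: "butlast p @ [last p] @ tl q = p @ tl q" using p by (metis append_assoc)
  then have "walk K (butlast p @ [last p] @ tl q)" using walk_join[OF assms] by metis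
  from label_prod_split[OF this] show ?thesis unfolding eq p q .
qed

lemma label_prod_step:
  assumes "edge_step K p q" "walk K p" shows "label_prod A w p = label_prod A w q"
  using assms(1)
proof cases
  case (stutter u a v)
  have "walk K q" using assms walk_edge_step[OF complex] by blast
  moreover have "{a} \<in> K" "walk K (a # v)" using assms(2) stutter
    by (auto simp: walk_def successively_append_iff successively_Cons)
  ultimately show ?thesis
    using stutter assms label_prod_split[of u a "[a] @ v"] label_prod_split[of u a v] label_refl label_prod_closed
    by simp
next
  case (triangle a b c u v)
  have "walk K q" using assms walk_edge_step[OF complex] by blast
  moreover have ab: "{a, b} \<in> K" "{b, c} \<in> K" "walk K (c # v)" using assms(2) triangle
    by (auto simp: walk_def successively_append_iff successively_Cons)
  moreover have "w a b \<otimes> (w b c \<otimes> label_prod A w (c # v)) = w a c \<otimes> label_prod A w (c # v)"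
    using label_mult[OF triangle(3)] label_closed ab label_prod_closed by (simp flip: m_assoc)
  ultimately show ?thesis
    using triangle assms label_prod_split[of u a "[b, c] @ v"] label_prod_split[of u a "[c] @ v"]
    by simp
qed

lemma label_prod_eq:
  assumes "edge_eq K p q" "walk K p" shows "label_prod A w p = label_prod A w q"
proof -
  \<comment> \<open>The invariant includes being a walk, since \<open>label_prod_step\<close>
    requires it and steps are taken in both directions.\<close>
  have "(walk K p \<and> label_prod A w p = label_prod A w p) \<longleftrightarrow> (walk K q \<and> label_prod A w q = label_prod A w p)"
    by (rule equivclp_invariant[OF _ assms(1), where P = "\<lambda>x. walk K x \<and> label_prod A w x = label_prod A w p"])
      (metis label_prod_step walk_edge_step[OF complex])
  then show ?thesis using assms by simp
qed

end

section \<open>Classes of edge paths and the labelling of edges by loops\<close>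

definition edge_class :: "'v set set \<Rightarrow> 'v list \<Rightarrow> 'v list set" where
  "edge_class K p = Collect (edge_eq K p)"

lemma edge_group_carrier: "carrier (edge_group K v) = edge_class K ` walks K v v"
  by (simp add: edge_group_def quot_monoid_def edge_class_def)

lemma edge_class_eq_iff: "edge_class K p = edge_class K q \<longleftrightarrow> edge_eq K p q"
  unfolding edge_class_def by (metis edge_eq_trans equivclp_refl equivclp_sym mem_Collect_eq Collect_cong)

lemma edge_group_mult:
  assumes "finite_complex K" "{v} \<in> K" "p \<in> walks K v v" "q \<in> walks K v v"
  shows "edge_class K p \<otimes>\<^bsub>edge_group K v\<^esub> edge_class K q = edge_class K (p @ tl q)"
proof -
  interpret congruence "walks K v v" "\<lambda>p q. p @ tl q" "[v]" "edge_eq K" by (rule congruence_edge[OF assms(1,2)])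
  show ?thesis using mult_Q[OF assms(3,4)] by (simp add: edge_group_def edge_class_def)
qed

lemma edge_group_one: "\<one>\<^bsub>edge_group K v\<^esub> = edge_class K [v]"
  by (simp add: edge_group_def quot_monoid_def edge_class_def)

text \<open>A choice of walks from the base point to all vertices turns every edge into a loop.\<close>

lemma cocycle_edge_group:
  assumes K: "finite_complex K" "{v} \<in> K" and q: "\<And>a. {a} \<in> K \<Longrightarrow> q a \<in> walks K v a"
  shows "cocycle (edge_group K v) K (\<lambda>a b. edge_class K (q a @ rev (q b)))"
proof -
  interpret group "edge_group K v" using K by (rule group_edge_group)
  have loop: "q a @ rev (q b) \<in> walks K v v" if "{a, b} \<in> K" for a b
    using that q[of a] q[of b] complex_face[OF K(1) that] by (auto intro!: walks_append walks_rev)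
  show ?thesis
  proof
    fix a b c assume abc: "{a, b, c} \<in> K"
    then have e: "{a, b} \<in> K" "{b, c} \<in> K" "{a, c} \<in> K" "{a} \<in> K" "{b} \<in> K" "{c} \<in> K"
      using complex_face[OF K(1) abc] by auto
    note D = walksD[OF q[OF e(4)]] walksD[OF q[OF e(5)]] walksD[OF q[OF e(6)]]
    obtain A where A: "q a = A @ [a]" using D by (metis append_butlast_last_id)
    obtain B where B: "q b = B @ [b]" using D by (metis append_butlast_last_id)
    obtain C where C: "q c = C @ [c]" using D by (metis append_butlast_last_id)
    have "rev (q b) @ tl (q b) = b # (rev B @ tl (q b))" using B by simp
    \<comment> \<open>The way back along \<open>q b\<close> and out again cancels to the vertex
      \<open>b\<close>, which the triangle then removes.\<close>
    have "edge_eq K (q a @ (rev (q b) @ tl (q b)) @ rev (q c)) (q a @ [b] @ rev (q c))"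
      using edge_eq_context[OF edge_eq_rev_join[OF K(1), of "q b"]] D by auto
    also have "edge_eq K \<dots> (q a @ rev (q c))"
      using edge_eq_context[OF edge_eq_triangle[OF abc, of "[]"], of A "rev C"] A C by simp
    finally have "edge_eq K ((q a @ rev (q b)) @ tl (q b @ rev (q c))) (q a @ rev (q c))"
      using D by simp
    then show "edge_class K (q a @ rev (q b)) \<otimes>\<^bsub>edge_group K v\<^esub> edge_class K (q b @ rev (q c)) = edge_class K (q a @ rev (q c))"
      using edge_group_mult[OF K loop[OF e(1)] loop[OF e(2)]] by (simp add: edge_class_eq_iff)
  qed (use K loop in \<open>auto simp: edge_group_carrier\<close>)
qed

text \<open>The product telescopes: between consecutive edges the approach walk to their common
  vertex is run back and forth, so only the two outermost approach walks survive. For a loop at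
  \<open>v\<close> and \<open>q v = [v]\<close> the result is the class of the loop itself.\<close>

lemma label_prod_edge_group:
  assumes K: "finite_complex K" "{v} \<in> K" and q: "\<And>a. {a} \<in> K \<Longrightarrow> q a \<in> walks K v a"
    and L: "walk K L"
  shows "label_prod (edge_group K v) (\<lambda>a b. edge_class K (q a @ rev (q b))) L =
           edge_class K (q (hd L) @ tl L @ tl (rev (q (last L))))"
  using L
proof (induction L rule: induct_list012)
  case (2 a)
  then have "{a} \<in> K" by (simp add: walk_single)
  note D = walksD[OF q[OF this]]
  show ?case using D edge_eq_join_rev[OF K(1), of "q a"] by (simp add: edge_group_one edge_class_eq_iff equivclp_sym)
next
  case (3 a b L)
  then have w: "walk K (b # L)" and ab: "{a, b} \<in> K" using K by (auto simp: walk_Cons_Cons)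
  define c where "c = last (b # L)"
  have v: "{a} \<in> K" "{b} \<in> K" "{c} \<in> K"
    using complex_face[OF K(1) ab] w by (auto simp: walk_def c_def)
  have qw: "q a \<in> walks K v a" "q b \<in> walks K v b" "q c \<in> walks K v c" using q v by auto
  note D = walksD[OF qw(1)] walksD[OF qw(2)] walksD[OF qw(3)]
  have bL: "b # L \<in> walks K b c" using w by (simp add: walks_def c_def)
  have l1: "q a @ rev (q b) \<in> walks K v v" using qw ab by (auto intro!: walks_append walks_rev)
  have l2: "q b @ L @ tl (rev (q c)) \<in> walks K v v"
    using walks_join[OF walks_join[OF qw(2) bL] walks_rev[OF qw(3)]] by simp
  have "label_prod (edge_group K v) (\<lambda>a b. edge_class K (q a @ rev (q b))) (a # b # L)
      = edge_class K (q a @ rev (q b)) \<otimes>\<^bsub>edge_group K v\<^esub> edge_class K (q b @ L @ tl (rev (q c)))"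
    using 3(2)[OF w] by (simp add: c_def)
  also have "\<dots> = edge_class K ((q a @ rev (q b)) @ tl (q b @ L @ tl (rev (q c))))"
    by (rule edge_group_mult[OF K l1 l2])
  also have "(q a @ rev (q b)) @ tl (q b @ L @ tl (rev (q c))) = q a @ (rev (q b) @ tl (q b)) @ (L @ tl (rev (q c)))"
    using D by simp
  also have "edge_class K \<dots> = edge_class K (q a @ [b] @ (L @ tl (rev (q c))))"
    unfolding edge_class_eq_iff
    using edge_eq_context[OF edge_eq_rev_join[OF K(1), of "q b"]] D by auto
  finally show ?case by (simp add: c_def)
qed (simp add: walk_def)

lemma label_prod_hom:
  assumes "group A" "group B" "h \<in> hom A B" "finite_complex K" "walk K L"
    and "\<And>a b. {a, b} \<in> K \<Longrightarrow> w a b \<in> carrier A"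
  shows "h (label_prod A w L) = label_prod B (\<lambda>a b. h (w a b)) L"
  using assms(5)
proof (induction L rule: induct_list012)
  case (3 a b L)
  then have ab: "{a, b} \<in> K" and w: "walk K (b # L)" using assms(4) by (auto simp: walk_Cons_Cons)
  have cl: "label_prod A w M \<in> carrier A" if "walk K M" for M
    using that by (induction M rule: induct_list012)
      (use assms in \<open>auto simp: walk_Cons_Cons group.is_monoid monoid.m_closed\<close>)
  show ?case using 3(2)[OF w] cl[OF w] assms(6)[OF ab] assms(3) by (simp add: hom_mult)
qed (use assms group.is_monoid in \<open>auto simp: hom_one\<close>)

lemma label_prod_cong:
  assumes "finite_complex K" "walk K L" "\<And>a b. {a, b} \<in> K \<Longrightarrow> w a b = w' a b"
  shows "label_prod A w L = label_prod A w' L"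
  using assms(2) by (induction L rule: induct_list012) (use assms in \<open>auto simp: walk_Cons_Cons\<close>)

section \<open>The fundamental group\<close>

definition paths_in :: "'a::topological_space set \<Rightarrow> 'a \<Rightarrow> 'a \<Rightarrow> (real \<Rightarrow> 'a) set" where
  "paths_in X x y = {p. path p \<and> path_image p \<subseteq> X \<and> pathstart p = x \<and> pathfinish p = y}"

lemma paths_inD:
  assumes "p \<in> paths_in X x y"
  shows "path p" "path_image p \<subseteq> X" "pathstart p = x" "pathfinish p = y"
  using assms by (simp_all add: paths_in_def)

lemma paths_in_join: "p \<in> paths_in X x y \<Longrightarrow> q \<in> paths_in X y z \<Longrightarrow> p +++ q \<in> paths_in X x z"
  by (simp add: paths_in_def subset_path_image_join)

lemma paths_in_rev: "p \<in> paths_in X x y \<Longrightarrow> reversepath p \<in> paths_in X y x"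
  by (simp add: paths_in_def)

lemma paths_in_const: "x \<in> X \<Longrightarrow> (\<lambda>_. x) \<in> paths_in X x x"
  by (auto simp: paths_in_def path_def path_image_def pathstart_def pathfinish_def)

lemma paths_in_homotopic: "homotopic_paths X p q \<Longrightarrow> p \<in> paths_in X x y \<Longrightarrow> q \<in> paths_in X x y"
  using homotopic_paths_imp_path[of X p q] homotopic_paths_imp_subset[of X p q]
    homotopic_paths_imp_pathstart[of X p q] homotopic_paths_imp_pathfinish[of X p q]
  by (simp add: paths_in_def)

lemma homotopic_refl: "p \<in> paths_in X x y \<Longrightarrow> homotopic_paths X p p"
  by (simp add: paths_in_def)

lemma homotopic_join:
  "homotopic_paths X p p' \<Longrightarrow> homotopic_paths X q q' \<Longrightarrow> p \<in> paths_in X x y \<Longrightarrow> q \<in> paths_in X y z \<Longrightarrow>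
     homotopic_paths X (p +++ q) (p' +++ q')"
  by (rule homotopic_paths_join) (simp_all add: paths_in_def)

lemma homotopic_joinL:
  "homotopic_paths X q q' \<Longrightarrow> p \<in> paths_in X x y \<Longrightarrow> q \<in> paths_in X y z \<Longrightarrow>
     homotopic_paths X (p +++ q) (p +++ q')"
  using homotopic_join homotopic_refl by metis

lemma homotopic_joinR:
  "homotopic_paths X p p' \<Longrightarrow> p \<in> paths_in X x y \<Longrightarrow> q \<in> paths_in X y z \<Longrightarrow>
     homotopic_paths X (p +++ q) (p' +++ q)"
  using homotopic_join homotopic_refl by metis

lemma homotopic_assoc:
  "p \<in> paths_in X x y \<Longrightarrow> q \<in> paths_in X y z \<Longrightarrow> r \<in> paths_in X z w \<Longrightarrow>
     homotopic_paths X ((p +++ q) +++ r) (p +++ (q +++ r))"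
  by (rule homotopic_paths_sym, rule homotopic_paths_assoc) (simp_all add: paths_in_def)

lemma homotopic_right_unit:
  assumes "p \<in> paths_in X x y" shows "homotopic_paths X (p +++ (\<lambda>_. y)) p"
proof (rule homotopic_paths_sym, rule homotopic_paths_reparametrize)
  let ?f = "\<lambda>t::real. min (2 * t) 1"
  show "continuous_on {0..1} ?f" by (intro continuous_intros)
  show "?f \<in> {0..1} \<rightarrow> {0..1}" by auto
  fix t :: real assume t: "t \<in> {0..1}"
  have "p 1 = y" using assms by (simp add: paths_in_def pathfinish_def)
  then show "(p +++ (\<lambda>_. y)) t = p (?f t)" by (simp add: joinpaths_def min_def)
qed (use paths_inD[OF assms] in simp_all)

lemma homotopic_left_unit:
  assumes "p \<in> paths_in X x y" shows "homotopic_paths X ((\<lambda>_. x) +++ p) p"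
proof (rule homotopic_paths_sym, rule homotopic_paths_reparametrize)
  let ?f = "\<lambda>t::real. max (2 * t - 1) 0"
  show "continuous_on {0..1} ?f" by (intro continuous_intros)
  show "?f \<in> {0..1} \<rightarrow> {0..1}" by auto
  fix t :: real assume t: "t \<in> {0..1}"
  have "p 0 = x" using assms by (simp add: paths_in_def pathstart_def)
  then show "((\<lambda>_. x) +++ p) t = p (?f t)" by (simp add: joinpaths_def max_def)
qed (use paths_inD[OF assms] in simp_all)

lemma homotopic_right_inverse:
  assumes "p \<in> paths_in X x y" shows "homotopic_paths X (p +++ reversepath p) (\<lambda>_. x)"
  unfolding homotopic_paths
proof (intro exI conjI ballI)
  \<comment> \<open>At time \<open>fst z\<close> of the homotopy the loop turns back after covering
    the fraction \<open>1 - fst z\<close> of the path.\<close>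
  let ?g = "\<lambda>z::real \<times> real. (1 - fst z) * min (2 * snd z) (2 - 2 * snd z)"
  let ?h = "\<lambda>z. p (?g z)"
  note D = paths_inD[OF assms]
  have g: "?g z \<in> {0..1}" if "z \<in> {0..1} \<times> {0..1}" for z
  proof -
    have "0 \<le> 1 - fst z" "1 - fst z \<le> 1" "0 \<le> min (2 * snd z) (2 - 2 * snd z)" "min (2 * snd z) (2 - 2 * snd z) \<le> 1"
      using that by (auto simp: mem_Times_iff min_def)
    then show ?thesis using mult_nonneg_nonneg mult_le_one unfolding atLeastAtMost_iff by blast
  qed
  have c: "continuous_on {0..1} p" using D by (simp add: path_def)
  show "continuous_on ({0..1} \<times> {0..1}) ?h"
    by (rule continuous_on_compose2[OF c]) (use g in \<open>auto intro!: continuous_intros\<close>)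
  show "?h \<in> {0..1} \<times> {0..1} \<rightarrow> X" using g D(2) by (force simp: path_image_def)
  fix t :: real assume t: "t \<in> {0..1}"
  show "?h (0, t) = (p +++ reversepath p) t" by (simp add: joinpaths_def reversepath_def min_def)
  show "?h (1, t) = x" using D(3) by (simp add: pathstart_def)
  show "pathstart (?h \<circ> Pair t) = pathstart (p +++ reversepath p)"
    "pathfinish (?h \<circ> Pair t) = pathfinish (p +++ reversepath p)"
    by (simp_all add: pathstart_def pathfinish_def joinpaths_def reversepath_def)
qed

lemma homotopic_cancel:
  assumes p: "p \<in> paths_in X x y" and q: "q \<in> paths_in X y z" and r: "r \<in> paths_in X y x"
    and u: "homotopic_paths X (r +++ p) (\<lambda>_. y)"
  shows "homotopic_paths X (r +++ (p +++ q)) q"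
proof -
  have "homotopic_paths X (r +++ (p +++ q)) ((r +++ p) +++ q)"
    by (rule homotopic_paths_sym, rule homotopic_assoc[OF r p q])
  also have "homotopic_paths X \<dots> ((\<lambda>_. y) +++ q)"
    by (rule homotopic_joinR[OF u paths_in_join[OF r p] q])
  also have "homotopic_paths X \<dots> q" by (rule homotopic_left_unit[OF q])
  finally show ?thesis .
qed

lemma fundamental_group_eq: "fundamental_group X x = quot_monoid (paths_in X x x) (+++) (\<lambda>_. x) (homotopic_paths X)"
  by (simp add: fundamental_group_eq_quot paths_in_def)

lemma congruence_paths:
  assumes "x \<in> X" shows "congruence (paths_in X x x) (+++) (\<lambda>_. x) (homotopic_paths X)"
proof
  show "homotopic_paths X p p" if "p \<in> paths_in X x x" for p by (rule homotopic_refl[OF that])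
  show "homotopic_paths X q p" if "homotopic_paths X p q" for p q by (rule homotopic_paths_sym[OF that])
  show "homotopic_paths X p r" if "homotopic_paths X p q" "homotopic_paths X q r" for p q r
    by (rule homotopic_paths_trans[OF that])
  show "q \<in> paths_in X x x" if "homotopic_paths X p q" "p \<in> paths_in X x x" for p q
    by (rule paths_in_homotopic[OF that])
  show "p +++ q \<in> paths_in X x x" if "p \<in> paths_in X x x" "q \<in> paths_in X x x" for p q
    by (rule paths_in_join[OF that])
  show "(\<lambda>_. x) \<in> paths_in X x x" by (rule paths_in_const[OF assms])
  show "homotopic_paths X (p +++ q) (p' +++ q')"
    if "homotopic_paths X p p'" "homotopic_paths X q q'" "p \<in> paths_in X x x" "q \<in> paths_in X x x" for p p' q q'
    by (rule homotopic_join[OF that])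
qed

text \<open>This gives the injectivity of the base change along \<open>s\<close>, and its
  surjectivity after exchanging \<open>s\<close> with its reverse.\<close>

lemma homotopic_conj:
  assumes s: "s \<in> paths_in X x y" and p: "p \<in> paths_in X x x"
  shows "homotopic_paths X (s +++ ((reversepath s +++ (p +++ s)) +++ reversepath s)) p"
proof -
  let ?r = "reversepath s"
  have r: "?r \<in> paths_in X y x" by (rule paths_in_rev[OF s])
  note ps = paths_in_join[OF p s] and sr = paths_in_join[OF s r]
  have x: "x \<in> X" using paths_inD[OF s] by (auto simp: path_image_def pathstart_def)
  have "homotopic_paths X (s +++ ((?r +++ (p +++ s)) +++ ?r)) (s +++ (?r +++ ((p +++ s) +++ ?r)))"
    by (rule homotopic_joinL[OF homotopic_assoc[OF r ps r] s paths_in_join[OF paths_in_join[OF r ps] r]])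
  also have "homotopic_paths X \<dots> ((p +++ s) +++ ?r)"
    by (rule homotopic_cancel[OF r paths_in_join[OF ps r] s homotopic_right_inverse[OF s]])
  also have "homotopic_paths X \<dots> (p +++ (s +++ ?r))" by (rule homotopic_assoc[OF p s r])
  also have "homotopic_paths X \<dots> (p +++ (\<lambda>_. x))"
    by (rule homotopic_joinL[OF homotopic_right_inverse[OF s] p sr])
  also have "homotopic_paths X \<dots> p" by (rule homotopic_right_unit[OF p])
  finally show ?thesis .
qed

lemma fundamental_group_base_change:
  assumes s: "s \<in> paths_in X x y"
  shows "fundamental_group X x \<cong> fundamental_group X y"
proof -
  let ?r = "reversepath s"
  have r: "?r \<in> paths_in X y x" by (rule paths_in_rev[OF s])
  have xy: "x \<in> X" "y \<in> X"
    using paths_inD[OF s] by (auto simp: path_image_def pathstart_def pathfinish_def)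
  define h where "h p = ?r +++ (p +++ s)" for p
  have h: "h p \<in> paths_in X y y" if "p \<in> paths_in X x x" for p
    unfolding h_def by (intro paths_in_join[OF r] paths_in_join[OF _ s] that)
  have hc: "homotopic_paths X (h p) (h q)" if "homotopic_paths X p q" "p \<in> paths_in X x x" for p q
    unfolding h_def
    by (rule homotopic_joinL[OF homotopic_joinR[OF that s] r paths_in_join[OF that(2) s]])
  show ?thesis unfolding fundamental_group_eq
  proof (rule iso_quot_monoids[OF congruence_paths[OF xy(1)] congruence_paths[OF xy(2)], where h = h])
    fix p q assume p: "p \<in> paths_in X x x" and q: "q \<in> paths_in X x x"
    show "h p \<in> paths_in X y y" by (rule h[OF p])
    note ps = paths_in_join[OF p s] and qs = paths_in_join[OF q s]
    have "homotopic_paths X (h p +++ h q) (?r +++ ((p +++ s) +++ h q))"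
      unfolding h_def[of p] by (rule homotopic_assoc[OF r ps h[OF q]])
    also have "homotopic_paths X \<dots> (?r +++ (p +++ (s +++ h q)))"
      by (rule homotopic_joinL[OF homotopic_assoc[OF p s h[OF q]] r paths_in_join[OF ps h[OF q]]])
    also have "homotopic_paths X \<dots> (?r +++ (p +++ (q +++ s)))"
    proof (rule homotopic_joinL[OF homotopic_joinL r])
      show "homotopic_paths X (s +++ h q) (q +++ s)" unfolding h_def
        by (rule homotopic_cancel[OF r qs s homotopic_right_inverse[OF s]])
      show "p \<in> paths_in X x x" "s +++ h q \<in> paths_in X x y" by (rule p, rule paths_in_join[OF s h[OF q]])
      then show "p +++ (s +++ h q) \<in> paths_in X x y" by (rule paths_in_join)
    qed
    also have "homotopic_paths X \<dots> (?r +++ ((p +++ q) +++ s))"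
      by (rule homotopic_joinL[OF homotopic_paths_sym[OF homotopic_assoc[OF p q s]] r paths_in_join[OF p qs]])
    finally show "homotopic_paths X (h (p +++ q)) (h p +++ h q)"
      unfolding h_def[of "p +++ q"] by (rule homotopic_paths_sym)
    show "homotopic_paths X p q \<longleftrightarrow> homotopic_paths X (h p) (h q)"
    proof
      assume hpq: "homotopic_paths X (h p) (h q)"
      have "homotopic_paths X p (s +++ (h p +++ ?r))"
        unfolding h_def by (rule homotopic_paths_sym[OF homotopic_conj[OF s p]])
      also have "homotopic_paths X \<dots> (s +++ (h q +++ ?r))"
        by (rule homotopic_joinL[OF homotopic_joinR[OF hpq h[OF p] r] s paths_in_join[OF h[OF p] r]])
      also have "homotopic_paths X \<dots> q" unfolding h_def by (rule homotopic_conj[OF s q])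
      finally show "homotopic_paths X p q" .
    qed (use hc p in blast)
  next
    fix q assume q: "q \<in> paths_in X y y"
    have "s +++ (q +++ ?r) \<in> paths_in X x x" by (rule paths_in_join[OF s paths_in_join[OF q r]])
    moreover have "homotopic_paths X (h (s +++ (q +++ ?r))) q"
      unfolding h_def using homotopic_conj[OF r q] by simp
    ultimately show "\<exists>p\<in>paths_in X x x. homotopic_paths X (h p) q" by blast
  qed
qed

section \<open>Points of the realization\<close>

definition supp :: "('v \<Rightarrow> real) \<Rightarrow> 'v set" where
  "supp x = {v. x v \<noteq> 0}"

text \<open>The closed simplex spanned by \<open>s\<close>; its convexity carries the straight-line
  homotopies.\<close>

definition cell :: "'v set \<Rightarrow> ('v \<Rightarrow> real) set" where
  "cell s = {x. (\<forall>v. 0 \<le> x v) \<and> supp x \<subseteq> s \<and> (\<Sum>v\<in>s. x v) = 1}"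

definition vertex :: "'v \<Rightarrow> 'v \<Rightarrow> real" where
  "vertex a = (\<lambda>v. if v = a then 1 else 0)"

definition seg :: "('v \<Rightarrow> real) \<Rightarrow> ('v \<Rightarrow> real) \<Rightarrow> real \<Rightarrow> 'v \<Rightarrow> real" where
  "seg x y = (\<lambda>t v. (1 - t) * x v + t * y v)"

lemma finite_simplex: "finite_complex K \<Longrightarrow> s \<in> K \<Longrightarrow> finite s"
  by (simp add: finite_complex_def)

lemma supp_realization: "x \<in> realization K \<Longrightarrow> supp x \<in> K"
  by (simp add: realization_def supp_def)

lemma realization_cell: "x \<in> realization K \<Longrightarrow> x \<in> cell (supp x)"
  by (simp add: realization_def cell_def supp_def)

lemma cell_realization:
  assumes K: "finite_complex K" and s: "s \<in> K" and x: "x \<in> cell s" shows "x \<in> realization K"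
proof -
  have "(\<Sum>v\<in>supp x. x v) = (\<Sum>v\<in>s. x v)"
    using x finite_simplex[OF K s] by (intro sum.mono_neutral_left) (auto simp: cell_def supp_def)
  then have sum: "(\<Sum>v\<in>supp x. x v) = 1" using x by (simp add: cell_def)
  then have "supp x \<noteq> {}" by auto
  then have "supp x \<in> K" using complex_face[OF K s] x by (simp add: cell_def)
  then show ?thesis using x sum by (simp add: realization_def cell_def supp_def)
qed

lemma seg_cell:
  assumes "x \<in> cell s" "y \<in> cell s" "t \<in> {0..1}" shows "seg x y t \<in> cell s"
proof -
  have "(\<Sum>v\<in>s. (1 - t) * x v + t * y v) = 1"
    using assms by (simp add: cell_def sum.distrib flip: sum_distrib_left)
  moreover have "x v = 0" "y v = 0" if "v \<notin> s" for v using assms that by (auto simp: cell_def supp_def)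
  then have "seg x y t v = 0" if "v \<notin> s" for v using that by (simp add: seg_def)
  then have "supp (seg x y t) \<subseteq> s" unfolding supp_def by blast
  ultimately show ?thesis using assms by (simp add: cell_def seg_def)
qed

lemma vertex_cell: "finite s \<Longrightarrow> a \<in> s \<Longrightarrow> vertex a \<in> cell s"
  by (auto simp: cell_def vertex_def supp_def)

lemma vertex_realization: "finite_complex K \<Longrightarrow> {a} \<in> K \<Longrightarrow> vertex a \<in> realization K"
  by (rule cell_realization[of K "{a}"]) (simp_all add: vertex_cell)

lemma seg_0 [simp]: "seg x y 0 = x" and seg_1 [simp]: "seg x y 1 = y"
  by (simp_all add: seg_def)

lemma path_seg: "path (seg x y)"
  unfolding path_def seg_def
  by (intro continuous_on_coordinatewise_then_product continuous_intros)

lemma seg_paths_in: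
  assumes K: "finite_complex K" "s \<in> K" and xy: "x \<in> cell s" "y \<in> cell s"
  shows "seg x y \<in> paths_in (realization K) x y"
  using cell_realization[OF K] seg_cell[OF xy] path_seg[of x y]
  by (auto simp: paths_in_def path_image_def pathstart_def pathfinish_def)

lemma continuous_on_coordinate: "continuous_on S f \<Longrightarrow> continuous_on S (\<lambda>z. f z v)"
  by (rule continuous_on_product_then_coordinatewise)

lemma continuous_on_path_snd: "path p \<Longrightarrow> continuous_on ({0..1::real} \<times> {0..1}) (\<lambda>z. p (snd z))"
  unfolding path_def
  by (rule continuous_on_compose2[where g = p and t = "{0..1}"]) (auto intro: continuous_on_snd continuous_on_id)

text \<open>The straight line between two points of a cell stays in the cell. The common cell may
  depend on the time in any way, because continuity comes from the formula of the homotopy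
  alone.\<close>

lemma homotopic_straight_line:
  assumes K: "finite_complex K" and p: "path p" and q: "path q"
    and ends: "pathstart p = pathstart q" "pathfinish p = pathfinish q"
    and cell: "\<And>t. t \<in> {0..1} \<Longrightarrow> \<exists>s\<in>K. p t \<in> cell s \<and> q t \<in> cell s"
  shows "homotopic_paths (realization K) p q"
  unfolding homotopic_paths
proof (intro exI conjI ballI)
  let ?h = "\<lambda>z. seg (p (snd z)) (q (snd z)) (fst z)"
  have "continuous_on ({0..1::real} \<times> {0..1}) (\<lambda>z. p (snd z))" "continuous_on ({0..1::real} \<times> {0..1}) (\<lambda>z. q (snd z))"
    by (rule continuous_on_path_snd[OF p], rule continuous_on_path_snd[OF q])
  note c = this[THEN continuous_on_coordinate]
  show "continuous_on ({0..1} \<times> {0..1}) ?h"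
    unfolding seg_def by (intro continuous_on_coordinatewise_then_product continuous_intros c)
  show "?h \<in> {0..1} \<times> {0..1} \<rightarrow> realization K"
  proof
    fix z :: "real \<times> real" assume z: "z \<in> {0..1} \<times> {0..1}"
    then obtain s where s: "s \<in> K" "p (snd z) \<in> cell s" "q (snd z) \<in> cell s" using cell[of "snd z"] by auto
    have "fst z \<in> {0..1}" using z by auto
    then show "?h z \<in> realization K" using cell_realization[OF K s(1)] seg_cell[OF s(2,3)] by blast
  qed
  fix t :: real
  show "pathstart (?h \<circ> Pair t) = pathstart p" "pathfinish (?h \<circ> Pair t) = pathfinish p"
    using ends by (simp_all add: pathstart_def pathfinish_def seg_def fun_eq_iff algebra_simps)
qed simp_all

section \<open>Edge paths as paths in the realization\<close>

text \<open>The edges take time 1/2, 1/4, 1/8 and so on, and the remaining time is spent at the last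
  vertex. So all break points lie on a dyadic grid whose fineness is governed by the length of the
  list.\<close>

fun poly_path :: "'v list \<Rightarrow> real \<Rightarrow> 'v \<Rightarrow> real" where
  "poly_path (a # b # L) = seg (vertex a) (vertex b) +++ poly_path (b # L)"
| "poly_path [a] = (\<lambda>_. vertex a)"
| "poly_path [] = (\<lambda>_ _. 0)"

lemma poly_path_cell:
  assumes "finite s" shows "set L \<subseteq> s \<Longrightarrow> L \<noteq> [] \<Longrightarrow> t \<in> {0..1} \<Longrightarrow> poly_path L t \<in> cell s"
proof (induction L arbitrary: t rule: induct_list012)
  case (3 a b L)
  show ?case
  proof (cases "t \<le> 1/2")
    case True
    then have "2 * t \<in> {0..1}" using 3(5) by simp
    then show ?thesis using True 3(3) by (simp add: joinpaths_def seg_cell vertex_cell assms)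
  next
    case False
    then have "2 * t - 1 \<in> {0..1}" using 3(5) by simp
    then show ?thesis using False 3(2,3) by (simp add: joinpaths_def)
  qed
qed (simp_all add: vertex_cell assms)

lemma poly_path_in:
  assumes K: "finite_complex K"
  shows "walk K L \<Longrightarrow> poly_path L \<in> paths_in (realization K) (vertex (hd L)) (vertex (last L))"
proof (induction L rule: induct_list012)
  case (2 a)
  then show ?case by (simp add: walk_single paths_in_const vertex_realization K)
next
  case (3 a b L)
  then have w: "walk K (b # L)" and ab: "{a, b} \<in> K" using K by (auto simp: walk_Cons_Cons)
  have "seg (vertex a) (vertex b) \<in> paths_in (realization K) (vertex a) (vertex b)"
    by (rule seg_paths_in[OF K ab]) (simp_all add: vertex_cell)
  with 3(2)[OF w] show ?case using paths_in_join by force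
qed (simp add: walk_def)

lemma poly_path_in_walks:
  "finite_complex K \<Longrightarrow> p \<in> walks K a b \<Longrightarrow> poly_path p \<in> paths_in (realization K) (vertex a) (vertex b)"
  using poly_path_in[of K p] walksD[of p K a b] by simp

lemma poly_path_join:
  assumes K: "finite_complex K"
  shows "walk K p \<Longrightarrow> walk K q \<Longrightarrow> last p = hd q \<Longrightarrow>
    homotopic_paths (realization K) (poly_path (p @ tl q)) (poly_path p +++ poly_path q)"
proof (induction p rule: induct_list012)
  case (2 a)
  have "q = a # tl q" using 2 by (cases q) (auto simp: walk_def)
  moreover have "homotopic_paths (realization K) ((\<lambda>_. vertex a) +++ poly_path q) (poly_path q)"
    using homotopic_left_unit[OF poly_path_in[OF K 2(2)]] 2(3) by simp
  ultimately show ?case by (simp add: homotopic_paths_sym)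
next
  case (3 a b L)
  then have w: "walk K (b # L)" and ab: "{a, b} \<in> K" and l: "last (b # L) = hd q"
    using K by (auto simp: walk_Cons_Cons)
  let ?s = "seg (vertex a) (vertex b)"
  have s: "?s \<in> paths_in (realization K) (vertex a) (vertex b)"
    by (rule seg_paths_in[OF K ab]) (simp_all add: vertex_cell)
  have p: "poly_path (b # L) \<in> paths_in (realization K) (vertex b) (vertex (hd q))"
    using poly_path_in[OF K w] l by simp
  note q = poly_path_in[OF K 3(4)]
  have w': "walk K ((b # L) @ tl q)" by (rule walk_join[OF w 3(4) l])
  have eq: "poly_path ((a # b # L) @ tl q) = ?s +++ poly_path ((b # L) @ tl q)" by simp
  have "homotopic_paths (realization K) (?s +++ poly_path ((b # L) @ tl q)) (?s +++ (poly_path (b # L) +++ poly_path q))"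
    using homotopic_joinL[OF 3(2)[OF w 3(4) l] s] poly_path_in[OF K w'] by simp
  also have "homotopic_paths (realization K) \<dots> ((?s +++ poly_path (b # L)) +++ poly_path q)"
    by (rule homotopic_paths_sym[OF homotopic_assoc[OF s p q]])
  finally show ?case unfolding eq by simp
qed (simp add: walk_def)

lemma poly_path_replace:
  assumes K: "finite_complex K" and P: "P \<in> walks K x a" and M: "M \<in> walks K a b" "M' \<in> walks K a b"
    and Q: "Q \<in> walks K b y" and h: "homotopic_paths (realization K) (poly_path M) (poly_path M')"
  shows "homotopic_paths (realization K) (poly_path (P @ tl (M @ tl Q))) (poly_path (P @ tl (M' @ tl Q)))"
proof -
  note [simp] = walksD[OF P] walksD[OF M(1)] walksD[OF M(2)] walksD[OF Q]
  note pin = poly_path_in_walks[OF K]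
  have *: "homotopic_paths (realization K) (poly_path (P @ tl (N @ tl Q))) (poly_path P +++ (poly_path N +++ poly_path Q))"
    if N: "N \<in> walks K a b" for N
  proof -
    note [simp] = walksD[OF N]
    have NQ: "N @ tl Q \<in> walks K a y" by (rule walks_join[OF N Q])
    note walksD[OF NQ, simp]
    have "homotopic_paths (realization K) (poly_path (P @ tl (N @ tl Q))) (poly_path P +++ poly_path (N @ tl Q))"
      by (rule poly_path_join[OF K]) simp_all
    also have "homotopic_paths (realization K) \<dots> (poly_path P +++ (poly_path N +++ poly_path Q))"
      by (rule homotopic_joinL[OF poly_path_join[OF K] pin[OF P] pin[OF NQ]]) simp_all
    finally show ?thesis .
  qed
  have "homotopic_paths (realization K) (poly_path P +++ (poly_path M +++ poly_path Q)) (poly_path P +++ (poly_path M' +++ poly_path Q))"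
    by (rule homotopic_joinL[OF homotopic_joinR[OF h pin[OF M(1)] pin[OF Q]] pin[OF P] paths_in_join[OF pin[OF M(1)] pin[OF Q]]])
  then show ?thesis using *[OF M(1)] *[OF M(2)] by (meson homotopic_paths_sym homotopic_paths_trans)
qed

lemma poly_path_simplex:
  assumes K: "finite_complex K" "s \<in> K" and p: "p \<in> walks K a b" "set p \<subseteq> s" and q: "q \<in> walks K a b" "set q \<subseteq> s"
  shows "homotopic_paths (realization K) (poly_path p) (poly_path q)"
proof (rule homotopic_straight_line[OF K(1)])
  note pin = paths_inD[OF poly_path_in_walks[OF K(1) p(1)]] and qin = paths_inD[OF poly_path_in_walks[OF K(1) q(1)]]
  show "path (poly_path p)" "path (poly_path q)" by (rule pin, rule qin)
  show "pathstart (poly_path p) = pathstart (poly_path q)" "pathfinish (poly_path p) = pathfinish (poly_path q)"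
    using pin qin by simp_all
  fix t :: real assume t: "t \<in> {0..1}"
  then show "\<exists>s\<in>K. poly_path p t \<in> cell s \<and> poly_path q t \<in> cell s"
    using poly_path_cell[OF finite_simplex[OF K]] p(2) q(2) walksD(1)[OF p(1)] walksD(1)[OF q(1)] K(2) by blast
qed

lemma poly_path_step:
  assumes K: "finite_complex K" and step: "edge_step K p q" and p: "walk K p"
  shows "homotopic_paths (realization K) (poly_path p) (poly_path q)"
proof -
  have split: "u @ [a] \<in> walks K (hd p) a \<and> c # v \<in> walks K c (last p)" if "p = u @ [a] @ w @ [c] @ v \<or> p = u @ [a] @ v \<and> c = a" for u a w c v
    using p that by (auto simp: walks_def walk_def successively_append_iff successively_Cons hd_append)
  show ?thesis using step
  proof cases
    case (stutter u a v)
    have a: "{a} \<in> K" using p stutter by (simp add: walk_def)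
    have "u @ [a] \<in> walks K (hd p) a" "a # v \<in> walks K a (last p)" using split[of u a "[]" a v] stutter by simp_all
    from poly_path_replace[OF K this(1) _ _ this(2), of "[a, a]" "[a]"]
    show ?thesis using stutter a poly_path_simplex[OF K a, of "[a, a]" a a "[a]"] walks_single[OF a] walks_edge[OF K, of a a] by simp
  next
    case (triangle a b c u v)
    have e: "{a, b} \<in> K" "{b, c} \<in> K" "{a, c} \<in> K" using complex_face[OF K triangle(3)] by auto
    have w: "[a, b, c] \<in> walks K a c" "[a, c] \<in> walks K a c"
      using e walks_edge[OF K] walks_join[of "[a, b]" K a b "[b, c]" c] by auto
    have "u @ [a] \<in> walks K (hd p) a" "c # v \<in> walks K c (last p)" using split[of u a "[b]" c v] triangle by simp_all
    from poly_path_replace[OF K this(1) w this(2)]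
    show ?thesis using triangle poly_path_simplex[OF K triangle(3) w(1) _ w(2)] by simp
  qed
qed

lemma poly_path_edge_eq:
  assumes K: "finite_complex K" and eq: "edge_eq K p q" and p: "walk K p"
  shows "homotopic_paths (realization K) (poly_path p) (poly_path q)"
  using eq
proof (induction rule: equivclp_induct)
  case base show ?case using homotopic_refl[OF poly_path_in[OF K p]] .
next
  case (step y z)
  have "walk K y" "walk K z" using step(1,2) p walk_edge_eq[OF K step(1)] walk_edge_step[OF K] by auto
  then have "homotopic_paths (realization K) (poly_path y) (poly_path z)"
    using step(2) poly_path_step[OF K] homotopic_paths_sym by blast
  then show ?case using step.IH homotopic_paths_trans by blast
qed

section \<open>Simplicial approximation\<close>

text \<open>The open star of the vertex \<open>f j\<close> contains the image under \<open>g\<close> of the interval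
  \<open>[(j - 1) / n, (j + 1) / n]\<close>.\<close>

definition approximates :: "(nat \<Rightarrow> 'v) \<Rightarrow> nat \<Rightarrow> (real \<Rightarrow> 'v \<Rightarrow> real) \<Rightarrow> bool" where
  "approximates f n g \<longleftrightarrow> (\<forall>j\<le>n. \<forall>t\<in>{0..1}. \<bar>t * real n - real j\<bar> \<le> 1 \<longrightarrow> g t (f j) \<noteq> 0)"

lemma approximatesD:
  "approximates f n g \<Longrightarrow> j \<le> n \<Longrightarrow> t \<in> {0..1} \<Longrightarrow> \<bar>t * real n - real j\<bar> \<le> 1 \<Longrightarrow> g t (f j) \<noteq> 0"
  by (simp add: approximates_def)

lemma approximates_node:
  assumes "approximates f n g" "j \<le> n" "0 < n" shows "g (real j / real n) (f j) \<noteq> 0"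
  using assms by (intro approximatesD[OF assms(1,2)]) (simp_all add: field_simps)

lemma approximates_join:
  assumes "approximates f (2 * n) (p +++ q)" "p 1 = q 0"
  shows "approximates f n p" "approximates (\<lambda>i. f (i + n)) n q"
proof -
  show "approximates f n p"
    unfolding approximates_def
  proof (intro allI impI ballI)
    fix j and t :: real assume j: "j \<le> n" and t: "t \<in> {0..1}" "\<bar>t * real n - real j\<bar> \<le> 1"
    have "(p +++ q) (t / 2) (f j) \<noteq> 0" by (rule approximatesD[OF assms(1)]) (use j t in simp_all)
    then show "p t (f j) \<noteq> 0" using t by (simp add: joinpaths_def)
  qed
  show "approximates (\<lambda>i. f (i + n)) n q"
    unfolding approximates_def
  proof (intro allI impI ballI)
    fix j and t :: real assume j: "j \<le> n" and t: "t \<in> {0..1}" "\<bar>t * real n - real j\<bar> \<le> 1"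
    have e: "(t + 1) / 2 * real (2 * n) - real (j + n) = t * real n - real j" by (simp add: field_simps)
    have "(p +++ q) ((t + 1) / 2) (f (j + n)) \<noteq> 0"
      by (rule approximatesD[OF assms(1)]) (use j t e in simp_all)
    \<comment> \<open>At the midpoint the joined path takes its value from \<open>p\<close>, which
      is where \<open>p 1 = q 0\<close> enters.\<close>
    moreover have "(p +++ q) ((t + 1) / 2) = q t"
    proof (cases "t = 0")
      case True then show ?thesis using assms(2) by (simp add: joinpaths_def)
    next
      case False
      then have "\<not> (t + 1) / 2 \<le> 1 / 2" "2 * ((t + 1) / 2) - 1 = t" using t by (simp_all add: field_simps)
      then show ?thesis unfolding joinpaths_def by metis
    qed
    ultimately show "q t (f (j + n)) \<noteq> 0" by simp
  qed
qed

text \<open>Presents an arbitrary map as a join, so that inductions on the fineness of the grid can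
  apply \<open>approximates_join\<close>.\<close>

lemma path_halves: "g = (\<lambda>t. g (t / 2)) +++ (\<lambda>t. g (t / 2 + 1 / 2))" for g :: "real \<Rightarrow> 'a::topological_space"
  by (auto simp: joinpaths_def fun_eq_iff field_simps)

text \<open>It follows the same edges as \<open>poly_path\<close> of the list of labels, but spends
  equal time on each of them; this keeps it near the path that is approximated.\<close>

fun dyadic_path :: "nat \<Rightarrow> (nat \<Rightarrow> 'v) \<Rightarrow> real \<Rightarrow> 'v \<Rightarrow> real" where
  "dyadic_path 0 f = seg (vertex (f 0)) (vertex (f 1))"
| "dyadic_path (Suc k) f = dyadic_path k f +++ dyadic_path k (\<lambda>i. f (i + 2 ^ k))"

text \<open>After halving down to a single grid interval, the stars of both end labels contain
  \<open>g t\<close> for every time in it, so the edge between the labels lies in the closed simplex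
  that carries \<open>g t\<close>.\<close>

lemma dyadic_path_cell:
  assumes K: "finite_complex K"
  shows "approximates f (2 ^ k) g \<Longrightarrow> (\<And>t. t \<in> {0..1} \<Longrightarrow> g t \<in> realization K) \<Longrightarrow> t \<in> {0..1} \<Longrightarrow>
     dyadic_path k f t \<in> cell (supp (g t))"
proof (induction k arbitrary: f g t)
  case 0
  have "g t (f 0) \<noteq> 0" "g t (f 1) \<noteq> 0" by (rule approximatesD[OF 0(1) _ 0(3)], use 0(3) in simp_all)+
  moreover have "finite (supp (g t))" using finite_simplex[OF K supp_realization[OF 0(2)[OF 0(3)]]] .
  ultimately show ?case using 0(3) by (simp add: seg_cell vertex_cell supp_def)
next
  case (Suc k)
  define p where "p = (\<lambda>t. g (t / 2))"
  define q where "q = (\<lambda>t. g (t / 2 + 1 / 2))"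
  have g: "g = p +++ q" unfolding p_def q_def by (rule path_halves)
  have "approximates f (2 * 2 ^ k) (p +++ q)" using Suc(2) unfolding g[symmetric] by simp
  moreover have "p 1 = q 0" by (simp add: p_def q_def)
  ultimately have a: "approximates f (2 ^ k) p" "approximates (\<lambda>i. f (i + 2 ^ k)) (2 ^ k) q" by (rule approximates_join)+
  show ?case
  proof (cases "t \<le> 1/2")
    case True
    have "dyadic_path k f (2 * t) \<in> cell (supp (p (2 * t)))"
      by (rule Suc.IH[OF a(1)]) (use Suc.prems True in \<open>auto simp: p_def\<close>)
    then show ?thesis using True by (simp add: joinpaths_def p_def)
  next
    case False
    have "dyadic_path k (\<lambda>i. f (i + 2 ^ k)) (2 * t - 1) \<in> cell (supp (q (2 * t - 1)))"
      by (rule Suc.IH[OF a(2)]) (use Suc.prems False in \<open>auto simp: q_def\<close>)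
    then show ?thesis using False by (simp add: joinpaths_def q_def field_simps)
  qed
qed

section \<open>Labels along a subdivided interval\<close>

definition vertex_list :: "nat \<Rightarrow> (nat \<Rightarrow> 'v) \<Rightarrow> 'v list" where
  "vertex_list n f = map f [0..<Suc n]"

lemma vertex_list_simps [simp]: "hd (vertex_list n f) = f 0" "last (vertex_list n f) = f n" "vertex_list n f \<noteq> []"
  "set (vertex_list n f) = f ` {..n}"
  by (auto simp: vertex_list_def hd_map last_map simp del: upt_Suc)

lemma vertex_list_0: "vertex_list 0 f = [f 0]"
  by (simp add: vertex_list_def)

lemma vertex_list_Suc: "vertex_list (Suc n) f = vertex_list n f @ [f (Suc n)]"
  by (simp add: vertex_list_def)

lemma vertex_list_add: "vertex_list (m + n) f = vertex_list m f @ tl (vertex_list n (\<lambda>i. f (i + m)))"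
proof (induction n)
  case (Suc n)
  have "vertex_list (m + Suc n) f = vertex_list m f @ tl (vertex_list n (\<lambda>i. f (i + m))) @ [f (Suc (m + n))]"
    using Suc by (simp add: vertex_list_Suc)
  also have "tl (vertex_list n (\<lambda>i. f (i + m))) @ [f (Suc (m + n))] = tl (vertex_list (Suc n) (\<lambda>i. f (i + m)))"
    by (simp add: vertex_list_Suc add.commute)
  finally show ?case .
qed (simp add: vertex_list_0)

lemma walk_vertex_list:
  assumes K: "finite_complex K" and v: "{f 0} \<in> K" and e: "\<And>j. j < n \<Longrightarrow> {f j, f (Suc j)} \<in> K"
  shows "vertex_list n f \<in> walks K (f 0) (f n)"
  using e
proof (induction n)
  case 0 then show ?case using walks_single[OF v] by (simp add: vertex_list_0)
next
  case (Suc n)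
  have "{f n, f (Suc n)} \<in> K" using Suc by simp
  then have "vertex_list n f @ tl [f n, f (Suc n)] \<in> walks K (f 0) (f (Suc n))"
    using Suc by (intro walks_join[OF _ walks_edge[OF K]]) auto
  then show ?case by (simp add: vertex_list_Suc)
qed

lemma dyadic_path_in:
  assumes K: "finite_complex K"
  shows "(\<And>j. j < 2 ^ k \<Longrightarrow> {f j, f (Suc j)} \<in> K) \<Longrightarrow>
    dyadic_path k f \<in> paths_in (realization K) (vertex (f 0)) (vertex (f (2 ^ k)))"
proof (induction k arbitrary: f)
  case 0
  then show ?case using seg_paths_in[OF K, of "{f 0, f 1}" "vertex (f 0)" "vertex (f 1)"] by (simp add: vertex_cell)
next
  case (Suc k)
  have "dyadic_path k f \<in> paths_in (realization K) (vertex (f 0)) (vertex (f (2 ^ k)))"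
    by (rule Suc.IH) (simp add: Suc.prems)
  moreover have "dyadic_path k (\<lambda>i. f (i + 2 ^ k)) \<in> paths_in (realization K) (vertex (f (0 + 2 ^ k))) (vertex (f (2 ^ k + 2 ^ k)))"
  proof (rule Suc.IH)
    fix j :: nat assume "j < 2 ^ k"
    then show "{f (j + 2 ^ k), f (Suc j + 2 ^ k)} \<in> K" using Suc.prems[of "j + 2 ^ k"] by simp
  qed
  ultimately show ?case using paths_in_join by (fastforce simp: mult_2)
qed

text \<open>The two paths differ only in how time is divided among the edges, and
  \<open>poly_path_join\<close> regroups the concatenation at the middle vertex.\<close>

lemma dyadic_poly_path:
  assumes K: "finite_complex K"
  shows "(\<And>j. j < 2 ^ k \<Longrightarrow> {f j, f (Suc j)} \<in> K) \<Longrightarrow>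
    homotopic_paths (realization K) (poly_path (vertex_list (2 ^ k) f)) (dyadic_path k f)"
proof (induction k arbitrary: f)
  case 0
  then have e: "{f 0, f 1} \<in> K" by simp
  have "homotopic_paths (realization K) (seg (vertex (f 0)) (vertex (f 1)) +++ (\<lambda>_. vertex (f 1))) (seg (vertex (f 0)) (vertex (f 1)))"
    by (rule homotopic_right_unit[OF seg_paths_in[OF K e]]) (simp_all add: vertex_cell)
  then show ?case by (simp add: vertex_list_def)
next
  case (Suc k)
  let ?g = "\<lambda>i. f (i + 2 ^ k)"
  have f: "{f j, f (Suc j)} \<in> K" if "j < 2 ^ k" for j using that Suc.prems by simp
  have g: "{?g j, ?g (Suc j)} \<in> K" if "j < 2 ^ k" for j using that Suc.prems[of "j + 2 ^ k"] by simp
  have v: "{f 0} \<in> K" "{?g 0} \<in> K" using f[of 0] g[of 0] complex_face[OF K, of "{f 0, f (Suc 0)}" "{f 0}"]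
      complex_face[OF K, of "{?g 0, ?g (Suc 0)}" "{?g 0}"] by auto
  note wf = walksD[OF walk_vertex_list[of K f, OF K v(1) f]] and wg = walksD[OF walk_vertex_list[of K ?g, OF K v(2) g]]
  have eq: "vertex_list (2 ^ Suc k) f = vertex_list (2 ^ k) f @ tl (vertex_list (2 ^ k) ?g)"
    by (simp add: mult_2 vertex_list_add)
  have "homotopic_paths (realization K) (poly_path (vertex_list (2 ^ Suc k) f))
      (poly_path (vertex_list (2 ^ k) f) +++ poly_path (vertex_list (2 ^ k) ?g))"
    unfolding eq by (rule poly_path_join[OF K]) (use wf wg in simp_all)
  also have "homotopic_paths (realization K) \<dots> (dyadic_path k f +++ dyadic_path k ?g)"
  proof (rule homotopic_join[OF Suc.IH[of f, OF f] Suc.IH[of ?g, OF g]])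
    show "poly_path (vertex_list (2 ^ k) f) \<in> paths_in (realization K) (vertex (f 0)) (vertex (f (2 ^ k)))"
      by (rule poly_path_in_walks[OF K walk_vertex_list[of K f, OF K v(1) f]])
    show "poly_path (vertex_list (2 ^ k) ?g) \<in> paths_in (realization K) (vertex (f (2 ^ k))) (vertex (?g (2 ^ k)))"
      using poly_path_in_walks[OF K walk_vertex_list[of K ?g, OF K v(2) g]] by simp
  qed
  finally show ?case by simp
qed

text \<open>An approximation of an edge path on a sufficiently fine dyadic grid contains the vertices
  of the edge path, since the star of a vertex contains no other vertex.\<close>

lemma approximates_poly_path:
  assumes K: "finite_complex K"
  shows "walk K L \<Longrightarrow> length L \<le> Suc k \<Longrightarrow> approximates f (2 ^ k) (poly_path L) \<Longrightarrow>
    edge_eq K (vertex_list (2 ^ k) f) L"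
proof (induction L arbitrary: k f rule: induct_list012)
  case (2 a)
  have "f j = a" if "j \<le> 2 ^ k" for j
  proof -
    have "vertex a (f j) \<noteq> 0"
      using approximates_node[OF 2(3)] that by simp
    then show ?thesis by (simp add: vertex_def split: if_splits)
  qed
  then have "set (vertex_list (2 ^ k) f) \<subseteq> {a}" "f 0 = a" "f (2 ^ k) = a" by auto
  moreover have "{a} \<in> K" using 2(1) by (simp add: walk_single)
  ultimately show ?case by (intro edge_eq_same_simplex[OF K]) auto
next
  case (3 a b L)
  then have w: "walk K (b # L)" and ab: "{a, b} \<in> K" using K by (auto simp: walk_Cons_Cons)
  \<comment> \<open>The first edge fills the first half of the time, so every edge of the walk uses
    up one level of the dyadic grid; this is the bound on the length.\<close>
  obtain k' where k: "k = Suc k'" using 3(4) by (cases k) auto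
  let ?g = "\<lambda>i. f (i + 2 ^ k')"
  have "approximates f (2 * 2 ^ k') (seg (vertex a) (vertex b) +++ poly_path (b # L))" using 3(5) k by simp
  moreover have "poly_path (b # L) 0 = vertex b"
    using poly_path_in[OF K w] by (simp add: paths_in_def pathstart_def)
  ultimately have ap: "approximates f (2 ^ k') (seg (vertex a) (vertex b))" "approximates ?g (2 ^ k') (poly_path (b # L))"
    using approximates_join[of f "2 ^ k'"] by simp_all
  have nz: "seg (vertex a) (vertex b) (real j / 2 ^ k') (f j) \<noteq> 0" if "j \<le> 2 ^ k'" for j
    using approximates_node[OF ap(1)] that by simp
  have "f j \<in> {a, b}" if "j \<le> 2 ^ k'" for j using nz[OF that] by (auto simp: seg_def vertex_def split: if_splits)
  moreover have "f 0 = a" "f (2 ^ k') = b" using nz[of 0] nz[of "2 ^ k'"] by (auto simp: vertex_def split: if_splits)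
  ultimately have e1: "edge_eq K (vertex_list (2 ^ k') f) [a, b]"
    by (intro edge_eq_same_simplex[OF K ab]) auto
  have e2: "edge_eq K (vertex_list (2 ^ k') ?g) (b # L)"
    using 3(2)[OF w _ ap(2)] 3(4) k by simp
  have "edge_eq K (vertex_list (2 ^ k') f @ tl (vertex_list (2 ^ k') ?g)) ([a, b] @ tl (b # L))"
    by (rule edge_eq_join[OF e1 e2]) simp_all
  then show ?case by (simp add: k mult_2 vertex_list_add)
qed (simp add: walk_def)

text \<open>A Lebesgue number for the cover by preimages of open stars. The block around node (i, j)
  is mapped into the star of \<open>l i j\<close>; neighbouring blocks overlap in nodes, so that
  neighbouring labels will span simplices. \<open>N\<close> makes the grid fine enough for given
  edge paths.\<close>

lemma simplicial_grid:
  fixes h :: "real \<times> real \<Rightarrow> 'v \<Rightarrow> real"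
  assumes h: "continuous_on ({0..1} \<times> {0..1}) h" and img: "\<And>z. z \<in> {0..1} \<times> {0..1} \<Longrightarrow> h z \<in> realization K"
    and K: "finite_complex K"
  obtains k l where "N \<le> k"
    "\<And>i j s t. \<lbrakk>i \<le> 2 ^ k; j \<le> 2 ^ k; s \<in> {0..1}; t \<in> {0..1}; \<bar>s * 2 ^ k - real i\<bar> \<le> 1; \<bar>t * 2 ^ k - real j\<bar> \<le> 1\<rbrakk>
       \<Longrightarrow> h (s, t) (l i j) \<noteq> 0"
proof -
  let ?S = "{0..1::real} \<times> {0..1::real}"
  have "\<exists>U. open U \<and> U \<inter> ?S = {z \<in> ?S. h z u \<noteq> 0}" for u
  proof -
    have "continuous_on ?S (\<lambda>z. h z u)" by (rule continuous_on_coordinate[OF h])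
    moreover have "open (- {0::real})" by (intro open_Compl closed_singleton)
    ultimately obtain U where U: "open U" "U \<inter> ?S = (\<lambda>z. h z u) -` (- {0}) \<inter> ?S"
      unfolding continuous_on_open_invariant by blast
    have "U \<inter> ?S = {z \<in> ?S. h z u \<noteq> 0}" unfolding U(2) by blast
    with U(1) show ?thesis by blast
  qed
  then obtain U where U: "\<And>u. open (U u)" "\<And>u. U u \<inter> ?S = {z \<in> ?S. h z u \<noteq> 0}" by metis
  have sub: "?S \<subseteq> \<Union>(range U)"
  proof
    fix z assume z: "z \<in> ?S"
    have "supp (h z) \<in> K" by (rule supp_realization[OF img[OF z]])
    then obtain u where "h z u \<noteq> 0" using K by (fastforce simp: finite_complex_def supp_def)
    then have "z \<in> U u" using U(2)[of u] z by blast
    then show "z \<in> \<Union>(range U)" by blast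
  qed
  have cS: "compact ?S" by (intro compact_Times compact_Icc)
  obtain d where d: "0 < d" "\<And>T. T \<subseteq> ?S \<Longrightarrow> diameter T < d \<Longrightarrow> \<exists>B\<in>range U. T \<subseteq> B"
    by (rule Lebesgue_number_lemma[OF cS _ sub]) (use U(1) in blast)+
  obtain m where m: "4 / d < 2 ^ m" using real_arch_pow[of 2 "4 / d"] by auto
  define k where "k = max m N"
  have "(2::real) ^ m \<le> 2 ^ k" by (simp add: k_def)
  then have "d * 2 ^ m \<le> d * 2 ^ k" using d(1) by (intro mult_left_mono) simp_all
  moreover have "4 < d * 2 ^ m" using m d(1) by (simp add: pos_divide_less_eq mult.commute)
  ultimately have k: "4 / 2 ^ k < d" by (simp add: pos_divide_less_eq)
  define T where "T i j = {z \<in> ?S. \<bar>fst z * 2 ^ k - real i\<bar> \<le> 1 \<and> \<bar>snd z * 2 ^ k - real j\<bar> \<le> 1}" for i j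
  have "\<exists>u. T i j \<subseteq> U u" for i j
  proof -
    \<comment> \<open>A block has sides of length at most 2 / 2 ^ k, and the norm is bounded by the
      sum of the two coordinate differences.\<close>
    have "diameter (T i j) \<le> 4 / 2 ^ k"
    proof (rule diameter_le)
      fix x y assume xy: "x \<in> T i j" "y \<in> T i j"
      have "\<bar>(fst x - fst y) * 2 ^ k\<bar> \<le> 2" "\<bar>(snd x - snd y) * 2 ^ k\<bar> \<le> 2"
        using xy by (auto simp: T_def left_diff_distrib)
      then have "\<bar>fst x - fst y\<bar> \<le> 2 / 2 ^ k" "\<bar>snd x - snd y\<bar> \<le> 2 / 2 ^ k"
        unfolding abs_mult by (simp_all add: pos_le_divide_eq)
      moreover have "norm (x - y) \<le> \<bar>fst x - fst y\<bar> + \<bar>snd x - snd y\<bar>"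
        by (simp add: norm_prod_def sqrt_sum_squares_le_sum_abs)
      ultimately show "norm (x - y) \<le> 4 / 2 ^ k" by simp
    qed simp
    then show ?thesis using d(2)[of "T i j"] k by (auto simp: T_def)
  qed
  then obtain l where l: "\<And>i j. T i j \<subseteq> U (l i j)" by metis
  have "h (s, t) (l i j) \<noteq> 0" if "s \<in> {0..1}" "t \<in> {0..1}" "\<bar>s * 2 ^ k - real i\<bar> \<le> 1" "\<bar>t * 2 ^ k - real j\<bar> \<le> 1" for i j s t
  proof -
    have "(s, t) \<in> T i j" using that by (simp add: T_def)
    then have "(s, t) \<in> U (l i j) \<inter> ?S" using l that by blast
    then show ?thesis using U(2) by blast
  qed
  then show thesis using that[of k l] by (simp add: k_def)
qed

text \<open>The rung between the two rows is pushed from right to left through squares that each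
  span a simplex.\<close>

lemma edge_eq_rows:
  assumes K: "finite_complex K"
  shows "{f 0, g 0} \<in> K \<Longrightarrow> (\<And>j. j < n \<Longrightarrow> {f j, f (Suc j), g j, g (Suc j)} \<in> K) \<Longrightarrow>
    edge_eq K (vertex_list n f @ [g n]) (f 0 # vertex_list n g)"
proof (induction n)
  case (Suc n)
  have s: "{f n, f (Suc n), g n, g (Suc n)} \<in> K" using Suc.prems by simp
  have v: "vertex_list n f = butlast (vertex_list n f) @ [f n]" by (metis append_butlast_last_id vertex_list_simps(2,3))
  have "edge_eq K [f n, f (Suc n), g (Suc n)] [f n, g n, g (Suc n)]"
    by (rule edge_eq_same_simplex[OF K s]) auto
  from edge_eq_appendL[OF this, of "butlast (vertex_list n f)"]
  have "edge_eq K (vertex_list n f @ [f (Suc n), g (Suc n)]) (vertex_list n f @ [g n, g (Suc n)])"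
    using v by (metis append_Cons append_Nil append_assoc)
  also have "edge_eq K \<dots> ((f 0 # vertex_list n g) @ [g (Suc n)])"
    using edge_eq_appendR[OF Suc.IH[OF Suc.prems(1)], of "[g (Suc n)]"] Suc.prems by simp
  finally show ?case by (simp add: vertex_list_Suc)
qed (simp add: vertex_list_0)

text \<open>The grid is applied to a map that ignores its first coordinate. The point over a node
  lies in the stars of its own label and of the next one, hence these two labels are joined by an
  edge.\<close>

lemma poly_path_surj:
  assumes K: "finite_complex K" and g: "g \<in> paths_in (realization K) (vertex v) (vertex w)"
  shows "\<exists>L\<in>walks K v w. homotopic_paths (realization K) (poly_path L) g"
proof -
  note D = paths_inD[OF g]
  have img: "g t \<in> realization K" if "t \<in> {0..1}" for t using D(2) that by (auto simp: path_image_def)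
  have "continuous_on ({0..1::real} \<times> {0..1}) (\<lambda>z. g (snd z))"
    by (rule continuous_on_path_snd[OF D(1)])
  then obtain k l where kl: "\<And>i j s t. \<lbrakk>i \<le> 2 ^ k; j \<le> 2 ^ k; s \<in> {0..1}; t \<in> {0..1}; \<bar>s * 2 ^ k - real i\<bar> \<le> 1; \<bar>t * 2 ^ k - real j\<bar> \<le> 1\<rbrakk>
       \<Longrightarrow> g (snd (s, t)) (l i j) \<noteq> 0"
    by (rule simplicial_grid[where N = 0 and K = K]) (use img K in auto)
  define f where "f = l 0"
  have fnz: "g t (f j) \<noteq> 0" if "j \<le> 2 ^ k" "t \<in> {0..1}" "\<bar>t * 2 ^ k - real j\<bar> \<le> 1" for j t
    using kl[of 0 j 0 t] that by (simp add: f_def)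
  then have ap: "approximates f (2 ^ k) g" by (simp add: approximates_def)
  have e: "{f j, f (Suc j)} \<in> K" if "j < 2 ^ k" for j
  proof -
    have t: "real j / 2 ^ k \<in> {0..1}" using that by (simp add: field_simps)
    have "{f j, f (Suc j)} \<subseteq> supp (g (real j / 2 ^ k))" using fnz[OF _ t] that by (simp add: supp_def)
    then show ?thesis by (rule complex_face[OF K supp_realization[OF img[OF t]]]) simp
  qed
  \<comment> \<open>The points over the two ends are vertices, and a vertex lies in no star but its
    own.\<close>
  have "g 0 (f 0) \<noteq> 0" "g 1 (f (2 ^ k)) \<noteq> 0" using fnz by simp_all
  then have ends: "f 0 = v" "f (2 ^ k) = w" using D(3,4) by (auto simp: pathstart_def pathfinish_def vertex_def split: if_splits)
  have "{f 0} \<in> K" by (rule complex_face[OF K e[of 0]]) simp_all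
  then have L: "vertex_list (2 ^ k) f \<in> walks K v w" using walk_vertex_list[of K f, OF K _ e] ends by metis
  have dp: "dyadic_path k f \<in> paths_in (realization K) (vertex v) (vertex w)" using dyadic_path_in[of K k f, OF K e] ends by simp
  have "homotopic_paths (realization K) (poly_path (vertex_list (2 ^ k) f)) (dyadic_path k f)"
    by (rule dyadic_poly_path[of K k f, OF K e])
  also have "homotopic_paths (realization K) \<dots> g"
  proof (rule homotopic_straight_line[OF K])
    show "path (dyadic_path k f)" "path g" by (rule paths_inD[OF dp], rule D)
    show "pathstart (dyadic_path k f) = pathstart g" "pathfinish (dyadic_path k f) = pathfinish g"
      using D paths_inD[OF dp] by simp_all
    fix t :: real assume t: "t \<in> {0..1}"
    show "\<exists>s\<in>K. dyadic_path k f t \<in> cell s \<and> g t \<in> cell s"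
      using dyadic_path_cell[OF K ap img t] realization_cell[OF img[OF t]] supp_realization[OF img[OF t]] by blast
  qed
  finally show ?thesis using L by blast
qed

text \<open>The first and the last row of the labelled grid approximate the two edge paths, and
  adjacent rows are equivalent by \<open>edge_eq_rows\<close>. As the homotopy fixes the end points,
  the rungs at both ends are stutters.\<close>

lemma poly_path_inj:
  assumes K: "finite_complex K" and L: "L \<in> walks K v w" "M \<in> walks K v w"
    and hom: "homotopic_paths (realization K) (poly_path L) (poly_path M)"
  shows "edge_eq K L M"
proof -
  obtain h where h: "continuous_on ({0..1} \<times> {0..1}) h" "h \<in> {0..1} \<times> {0..1} \<rightarrow> realization K"
    "\<And>x. x \<in> {0..1} \<Longrightarrow> h (0, x) = poly_path L x" "\<And>x. x \<in> {0..1} \<Longrightarrow> h (1, x) = poly_path M x"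
    "\<And>t. t \<in> {0..1::real} \<Longrightarrow> h (t, 0) = vertex v" "\<And>t. t \<in> {0..1::real} \<Longrightarrow> h (t, 1) = vertex w"
    using hom paths_inD(3,4)[OF poly_path_in_walks[OF K L(1)]] unfolding homotopic_paths
    by (auto simp: pathstart_def pathfinish_def)
  have img: "h z \<in> realization K" if "z \<in> {0..1} \<times> {0..1}" for z using h(2) that by blast
  obtain k l where k: "max (length L) (length M) \<le> k"
    and kl: "\<And>i j s t. \<lbrakk>i \<le> 2 ^ k; j \<le> 2 ^ k; s \<in> {0..1}; t \<in> {0..1}; \<bar>s * 2 ^ k - real i\<bar> \<le> 1; \<bar>t * 2 ^ k - real j\<bar> \<le> 1\<rbrakk>
       \<Longrightarrow> h (s, t) (l i j) \<noteq> 0"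
    using simplicial_grid[OF h(1) img K] by metis
  define n :: nat where "n = 2 ^ k"
  have quad: "{l i j, l i (Suc j), l (Suc i) j, l (Suc i) (Suc j)} \<in> K" if ij: "i < n" "j < n" for i j
  proof -
    let ?s = "real i / 2 ^ k" and ?t = "real j / 2 ^ k"
    have st: "?s \<in> {0..1}" "?t \<in> {0..1}" using ij by (simp_all add: n_def field_simps)
    \<comment> \<open>The node (i, j) belongs to all four blocks, so its image lies in all four
      stars.\<close>
    have sub: "{l i j, l i (Suc j), l (Suc i) j, l (Suc i) (Suc j)} \<subseteq> supp (h (?s, ?t))"
      using kl[OF _ _ st] ij by (simp add: supp_def n_def)
    have "supp (h (?s, ?t)) \<in> K" using supp_realization[OF img] st by simp
    then show ?thesis by (rule complex_face[OF K _ sub]) simp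
  qed
  have l0: "l i 0 = v" and ln: "l i n = w" if i: "i \<le> n" for i
  proof -
    have s: "real i / 2 ^ k \<in> {0..1}" using i by (simp add: n_def field_simps)
    have "h (real i / 2 ^ k, 0) (l i 0) \<noteq> 0" "h (real i / 2 ^ k, 1) (l i n) \<noteq> 0"
      using kl[OF _ _ s, of i] i by (simp_all add: n_def)
    then show "l i 0 = v" "l i n = w" using h(5,6)[OF s] by (auto simp: vertex_def split: if_splits)
  qed
  have row: "edge_eq K (vertex_list n (l i)) (vertex_list n (l (Suc i)))" if i: "i < n" for i
  proof -
    have "0 < n" by (simp add: n_def)
    have "edge_eq K (vertex_list n (l i) @ [w]) (v # vertex_list n (l (Suc i)))"
      using edge_eq_rows[OF K, of "l i" "l (Suc i)" n] quad[OF i] l0[of i] l0[of "Suc i"] ln[of "Suc i"] i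
        complex_face[OF K quad[OF i \<open>0 < n\<close>], of "{l i 0, l (Suc i) 0}"] by simp
    moreover have "edge_eq K (vertex_list n (l i) @ [w]) (vertex_list n (l i))"
    proof -
      have "butlast (vertex_list n (l i)) @ [w] = vertex_list n (l i)"
        using ln[of i] i append_butlast_last_id[of "vertex_list n (l i)"] by simp
      then show ?thesis
        using edge_eq_appendL[OF edge_eq_stutter[of K w "[]"], of "butlast (vertex_list n (l i))"]
        by (metis append_Cons append_Nil append_assoc)
    qed
    moreover have "edge_eq K (v # vertex_list n (l (Suc i))) (vertex_list n (l (Suc i)))"
    proof -
      have "vertex_list n (l (Suc i)) = v # tl (vertex_list n (l (Suc i)))"
        using l0[of "Suc i"] i list.collapse[of "vertex_list n (l (Suc i))"] by simp
      then show ?thesis using edge_eq_stutter[of K v "tl (vertex_list n (l (Suc i)))"] by metis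
    qed
    ultimately show ?thesis by (meson edge_eq_trans equivclp_sym)
  qed
  have rows: "edge_eq K (vertex_list n (l 0)) (vertex_list n (l i))" if "i \<le> n" for i
    using that
  proof (induction i)
    case (Suc i) then show ?case using row[of i] edge_eq_trans by simp
  qed simp
  have "approximates (l 0) (2 ^ k) (poly_path L)"
    unfolding approximates_def using kl[of 0 _ 0] h(3) by simp
  then have "edge_eq K (vertex_list n (l 0)) L"
    unfolding n_def using k walksD(2)[OF L(1)] by (intro approximates_poly_path[OF K]) auto
  moreover have "approximates (l n) (2 ^ k) (poly_path M)"
    unfolding approximates_def using kl[of n _ 1] h(4) by (simp add: n_def)
  then have "edge_eq K (vertex_list n (l n)) M"
    unfolding n_def using k walksD(2)[OF L(2)] by (intro approximates_poly_path[OF K]) auto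
  ultimately show ?thesis using rows[of n] by (meson edge_eq_trans equivclp_sym order_refl)
qed

theorem edge_group_iso_fundamental_group:
  assumes K: "finite_complex K" "{v} \<in> K"
  shows "edge_group K v \<cong> fundamental_group (realization K) (vertex v)"
  unfolding edge_group_def fundamental_group_eq
proof (rule iso_quot_monoids[OF congruence_edge[OF K] congruence_paths[OF vertex_realization[OF K]], where h = poly_path])
  fix p q assume pq: "p \<in> walks K v v" "q \<in> walks K v v"
  show "poly_path p \<in> paths_in (realization K) (vertex v) (vertex v)" by (rule poly_path_in_walks[OF K(1) pq(1)])
  show "homotopic_paths (realization K) (poly_path (p @ tl q)) (poly_path p +++ poly_path q)"
    using walksD[OF pq(1)] walksD[OF pq(2)] by (intro poly_path_join K) simp_all
  show "edge_eq K p q \<longleftrightarrow> homotopic_paths (realization K) (poly_path p) (poly_path q)"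
    using poly_path_inj[OF K(1) pq] poly_path_edge_eq[OF K(1) _ walksD(2)[OF pq(1)]] by blast
next
  fix q assume "q \<in> paths_in (realization K) (vertex v) (vertex v)"
  then show "\<exists>p\<in>walks K v v. homotopic_paths (realization K) (poly_path p) q" by (rule poly_path_surj[OF K(1)])
qed

section \<open>Connectedness\<close>

definition edge_connected :: "'v set set \<Rightarrow> 'v \<Rightarrow> bool" where
  "edge_connected K v \<longleftrightarrow> {v} \<in> K \<and> (\<forall>a. {a} \<in> K \<longrightarrow> walks K v a \<noteq> {})"

lemma path_to_vertex:
  assumes K: "finite_complex K" and x: "x \<in> realization K" and a: "a \<in> supp x"
  shows "seg x (vertex a) \<in> paths_in (realization K) x (vertex a)"
  using supp_realization[OF x] finite_simplex[OF K] a
  by (intro seg_paths_in[OF K, of "supp x"] realization_cell[OF x] vertex_cell) auto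

lemma connected_realization:
  assumes K: "finite_complex K" and c: "edge_connected K v"
  shows "connected (realization K)"
proof (rule path_connected_imp_connected)
  have 1: "\<exists>g. g \<in> paths_in (realization K) x (vertex v)" if x: "x \<in> realization K" for x
  proof -
    have "supp x \<noteq> {}" using supp_realization[OF x] K by (auto simp: finite_complex_def)
    then obtain a where a: "a \<in> supp x" by blast
    then have "{a} \<in> K" using complex_face[OF K supp_realization[OF x], of "{a}"] by simp
    then obtain L where "L \<in> walks K v a" using c by (auto simp: edge_connected_def)
    from paths_in_join[OF path_to_vertex[OF K x a] paths_in_rev[OF poly_path_in_walks[OF K this]]] show ?thesis by blast
  qed
  show "path_connected (realization K)"
    unfolding path_connected_def
  proof (intro ballI)
    fix x y assume "x \<in> realization K" "y \<in> realization K"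
    then obtain g h where "g \<in> paths_in (realization K) x (vertex v)" "h \<in> paths_in (realization K) y (vertex v)"
      using 1 by blast
    from paths_in_join[OF this(1) paths_in_rev[OF this(2)]]
    show "\<exists>g. path g \<and> path_image g \<subseteq> realization K \<and> pathstart g = x \<and> pathfinish g = y"
      by (auto simp: paths_in_def)
  qed
qed

lemma open_star: "open {x :: 'v \<Rightarrow> real. x u \<noteq> 0}"
  by (intro open_Collect_neq continuous_on_product_coordinates continuous_on_const)

text \<open>The open stars of reachable and of unreachable vertices would separate the realization:
  a point in both unions would put a reachable and an unreachable vertex into one simplex.\<close>

lemma edge_connected_if_connected:
  assumes K: "finite_complex K" and c: "connected (realization K)" and v: "{v} \<in> K"
  shows "edge_connected K v"
proof -
  define C where "C = {a. walks K v a \<noteq> {}}"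
  define A where "A = (\<Union>u\<in>C. {x :: 'a \<Rightarrow> real. x u \<noteq> 0})"
  define B where "B = (\<Union>u\<in>-C. {x :: 'a \<Rightarrow> real. x u \<noteq> 0})"
  have "open A" "open B" unfolding A_def B_def by (intro open_UN ballI open_star)+
  moreover have "realization K \<subseteq> A \<union> B"
  proof
    fix x assume "x \<in> realization K"
    then have "supp x \<noteq> {}" using supp_realization K by (fastforce simp: finite_complex_def)
    then show "x \<in> A \<union> B" by (auto simp: A_def B_def supp_def)
  qed
  moreover have "A \<inter> B \<inter> realization K = {}"
  proof (rule ccontr)
    assume "A \<inter> B \<inter> realization K \<noteq> {}"
    then obtain x u w where x: "x \<in> realization K" "u \<in> C" "w \<notin> C" "x u \<noteq> 0" "x w \<noteq> 0" by (auto simp: A_def B_def)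
    have "{u, w} \<in> K" using complex_face[OF K supp_realization[OF x(1)], of "{u, w}"] x by (simp add: supp_def)
    then have "walks K v w \<noteq> {}" using x(2) walks_join[OF _ walks_edge[OF K]] by (fastforce simp: C_def)
    then show False using x(3) by (simp add: C_def)
  qed
  ultimately have "A \<inter> realization K = {} \<or> B \<inter> realization K = {}" using connectedD[OF c] by blast
  moreover have "vertex v \<in> A \<inter> realization K"
    using vertex_realization[OF K v] walks_single[OF v] by (force simp: A_def C_def vertex_def)
  ultimately have B: "B \<inter> realization K = {}" by blast
  have "walks K v a \<noteq> {}" if "{a} \<in> K" for a
  proof (rule ccontr)
    assume "\<not> walks K v a \<noteq> {}"
    then have "vertex a \<in> B" by (auto simp: B_def C_def vertex_def)
    then show False using B vertex_realization[OF K that] by blast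
  qed
  then show ?thesis using v by (simp add: edge_connected_def)
qed

section \<open>Free products\<close>

lemma (in congruence) hom_Q:
  fixes A :: "('c, 'd) monoid_scheme"
  assumes "\<And>p. p \<in> S \<Longrightarrow> h p \<in> carrier A"
    and "\<And>p q. p \<in> S \<Longrightarrow> q \<in> S \<Longrightarrow> h (f p q) = h p \<otimes>\<^bsub>A\<^esub> h q"
    and eq: "\<And>p q. p \<in> S \<Longrightarrow> R p q \<Longrightarrow> h p = h q"
  shows "\<exists>F\<in>hom Q A. \<forall>p\<in>S. F (cls p) = h p"
proof -
  define F where "F C = h (SOME p. p \<in> C)" for C
  have F: "F (cls p) = h p" if "p \<in> S" for p
  proof -
    have "R p (SOME q. R p q)" using refl[OF that] by (rule someI)
    then show ?thesis using eq[OF that] by (simp add: F_def)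
  qed
  have "F \<in> hom Q A"
  proof (rule homI)
    fix x assume "x \<in> carrier Q"
    then show "F x \<in> carrier A" using assms F by (auto simp: carrier_Q)
  next
    fix x y assume "x \<in> carrier Q" "y \<in> carrier Q"
    then obtain p q where pq: "p \<in> S" "q \<in> S" "x = cls p" "y = cls q" by (auto simp: carrier_Q)
    then show "F (x \<otimes>\<^bsub>Q\<^esub> y) = F x \<otimes>\<^bsub>A\<^esub> F y"
      using mult_Q[OF pq(1,2)] F[OF op_closed[OF pq(1,2)]] F[OF pq(1)] F[OF pq(2)] assms(2)[OF pq(1,2)] by simp
  qed
  then show ?thesis using F by blast
qed

section \<open>Words in two groups and the universal property of the free product\<close>

abbreviation letters where
  "letters G H \<equiv> Inl ` carrier G \<union> Inr ` carrier H"

abbreviation fp_eq where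
  "fp_eq G H \<equiv> equivclp (free_product_step G H)"

lemma fp_eq_context:
  assumes "fp_eq G H p q" shows "fp_eq G H (u @ p @ v) (u @ q @ v)"
proof (rule equivclp_map[OF _ assms, where f = "\<lambda>p. u @ p @ v"])
  fix x y assume "free_product_step G H x y"
  then have "free_product_step G H (u @ x @ v) (u @ y @ v)"
  proof cases
    case (one_left u' v')
    then show ?thesis using free_product_step.one_left[of G H "u @ u'" "v' @ v"] by simp
  next
    case (one_right u' v')
    then show ?thesis using free_product_step.one_right[of G H "u @ u'" "v' @ v"] by simp
  next
    case (mult_left a b u' v')
    then show ?thesis using free_product_step.mult_left[of a G b H "u @ u'" "v' @ v"] by simp
  next
    case (mult_right a b u' v')
    then show ?thesis using free_product_step.mult_right[of a H b G "u @ u'" "v' @ v"] by simp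
  qed
  then show "fp_eq G H (u @ x @ v) (u @ y @ v)" by blast
qed

lemma fp_eq_append:
  assumes "fp_eq G H p p'" "fp_eq G H q q'" shows "fp_eq G H (p @ q) (p' @ q')"
  using fp_eq_context[OF assms(1), of "[]" q] fp_eq_context[OF assms(2), of p' "[]"]
  by (simp add: equivclp_trans[of _ "p @ q" "p' @ q"])

lemma fp_step_letters:
  assumes "group G" "group H" "free_product_step G H p q"
  shows "p \<in> lists (letters G H) \<longleftrightarrow> q \<in> lists (letters G H)"
proof -
  interpret G: group G by fact
  interpret H: group H by fact
  show ?thesis using assms(3) by cases auto
qed

lemma congruence_fp:
  assumes "group G" "group H"
  shows "congruence (lists (letters G H)) (@) [] (fp_eq G H)"
proof
  show "q \<in> lists (letters G H)" if "fp_eq G H p q" "p \<in> lists (letters G H)" for p q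
    using equivclp_invariant[where P = "\<lambda>x. x \<in> lists (letters G H)", OF fp_step_letters[OF assms] that(1)] that(2)
    by simp
  show "fp_eq G H q p" if "fp_eq G H p q" for p q by (rule equivclp_sym[OF that])
  show "fp_eq G H p r" if "fp_eq G H p q" "fp_eq G H q r" for p q r by (rule equivclp_trans[OF that])
  show "fp_eq G H (p @ q) (p' @ q')" if "fp_eq G H p p'" "fp_eq G H q q'" for p p' q q'
    by (rule fp_eq_append[OF that])
qed simp_all

lemma free_product_eq: "free_product G H = quot_monoid (lists (letters G H)) (@) [] (fp_eq G H)"
  by (simp add: free_product_def word_group_eq_quot)

lemma group_free_product:
  assumes "group G" "group H" shows "group (free_product G H)"
proof -
  interpret G: group G by fact
  interpret H: group H by fact
  interpret congruence "lists (letters G H)" "(@)" "[]" "fp_eq G H" by (rule congruence_fp[OF assms])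
  show ?thesis unfolding free_product_eq
  proof (rule group_Q)
    fix p assume "p \<in> lists (letters G H)"
    then show "\<exists>q\<in>lists (letters G H). fp_eq G H (q @ p) []"
    proof (induction p)
      case Nil
      show ?case by (rule bexI[of _ "[]"]) simp_all
    next
      case (Cons x p)
      then obtain q where q: "q \<in> lists (letters G H)" "fp_eq G H (q @ p) []" by auto
      obtain y where y: "y \<in> letters G H" "fp_eq G H [y, x] []"
      proof (cases x)
        case (Inl g)
        then have g: "g \<in> carrier G" using Cons.hyps by auto
        have "fp_eq G H [Inl (inv\<^bsub>G\<^esub> g), Inl g] [Inl \<one>\<^bsub>G\<^esub>]"
          using free_product_step.mult_left[of "inv\<^bsub>G\<^esub> g" G g H "[]" "[]"] g by auto
        moreover have "fp_eq G H [Inl \<one>\<^bsub>G\<^esub>] []" using free_product_step.one_left[of G H "[]" "[]"] by auto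
        ultimately have "fp_eq G H [Inl (inv\<^bsub>G\<^esub> g), Inl g] []" by (rule equivclp_trans)
        then show thesis using that[of "Inl (inv\<^bsub>G\<^esub> g)"] g Inl by simp
      next
        case (Inr g)
        then have g: "g \<in> carrier H" using Cons.hyps by auto
        have "fp_eq G H [Inr (inv\<^bsub>H\<^esub> g), Inr g] [Inr \<one>\<^bsub>H\<^esub>]"
          using free_product_step.mult_right[of "inv\<^bsub>H\<^esub> g" H g G "[]" "[]"] g by auto
        moreover have "fp_eq G H [Inr \<one>\<^bsub>H\<^esub>] []" using free_product_step.one_right[of G H "[]" "[]"] by auto
        ultimately have "fp_eq G H [Inr (inv\<^bsub>H\<^esub> g), Inr g] []" by (rule equivclp_trans)
        then show thesis using that[of "Inr (inv\<^bsub>H\<^esub> g)"] g Inr by simp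
      qed
      have "fp_eq G H (q @ [y, x] @ p) (q @ [] @ p)" by (rule fp_eq_context[OF y(2)])
      then have "fp_eq G H ((q @ [y]) @ x # p) []" using equivclp_trans[OF _ q(2)] by simp
      then show ?case using q(1) y(1) by (intro bexI[of _ "q @ [y]"]) auto
    qed
  qed simp_all
qed

definition fp_left where "fp_left G H a = Collect (fp_eq G H [Inl a])"
definition fp_right where "fp_right G H b = Collect (fp_eq G H [Inr b])"

lemma fp_left_hom: assumes "group G" "group H" shows "fp_left G H \<in> hom G (free_product G H)"
proof -
  interpret congruence "lists (letters G H)" "(@)" "[]" "fp_eq G H" by (rule congruence_fp[OF assms])
  show ?thesis unfolding free_product_eq fp_left_def
  proof (rule homI)
    fix x y assume xy: "x \<in> carrier G" "y \<in> carrier G"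
    have "fp_eq G H [Inl (x \<otimes>\<^bsub>G\<^esub> y)] [Inl x, Inl y]"
      using free_product_step.mult_left[of x G y H "[]" "[]"] xy by auto
    moreover have "x \<otimes>\<^bsub>G\<^esub> y \<in> carrier G" using xy assms group.is_monoid monoid.m_closed by metis
    ultimately show "cls [Inl (x \<otimes>\<^bsub>G\<^esub> y)] = cls [Inl x] \<otimes>\<^bsub>Q\<^esub> cls [Inl y]"
      using xy mult_Q[of "[Inl x]" "[Inl y]"] cls_eq_iff[of "[Inl (x \<otimes>\<^bsub>G\<^esub> y)]" "[Inl x, Inl y]"] by simp
  qed (simp add: cls_in_carrier)
qed

lemma fp_right_hom: assumes "group G" "group H" shows "fp_right G H \<in> hom H (free_product G H)"
proof -
  interpret congruence "lists (letters G H)" "(@)" "[]" "fp_eq G H" by (rule congruence_fp[OF assms])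
  show ?thesis unfolding free_product_eq fp_right_def
  proof (rule homI)
    fix x y assume xy: "x \<in> carrier H" "y \<in> carrier H"
    have "fp_eq G H [Inr (x \<otimes>\<^bsub>H\<^esub> y)] [Inr x, Inr y]"
      using free_product_step.mult_right[of x H y G "[]" "[]"] xy by auto
    moreover have "x \<otimes>\<^bsub>H\<^esub> y \<in> carrier H" using xy assms group.is_monoid monoid.m_closed by metis
    ultimately show "cls [Inr (x \<otimes>\<^bsub>H\<^esub> y)] = cls [Inr x] \<otimes>\<^bsub>Q\<^esub> cls [Inr y]"
      using xy mult_Q[of "[Inr x]" "[Inr y]"] cls_eq_iff[of "[Inr (x \<otimes>\<^bsub>H\<^esub> y)]" "[Inr x, Inr y]"] by simp
  qed (simp add: cls_in_carrier)
qed

fun fp_eval :: "('c, 'd) monoid_scheme \<Rightarrow> ('a \<Rightarrow> 'c) \<Rightarrow> ('b \<Rightarrow> 'c) \<Rightarrow> ('a + 'b) list \<Rightarrow> 'c" where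
  "fp_eval A f h [] = \<one>\<^bsub>A\<^esub>"
| "fp_eval A f h (Inl a # w) = f a \<otimes>\<^bsub>A\<^esub> fp_eval A f h w"
| "fp_eval A f h (Inr b # w) = h b \<otimes>\<^bsub>A\<^esub> fp_eval A f h w"

context
  fixes G :: "'a monoid" and H :: "'b monoid" and A :: "'c monoid" and f h
  assumes groups: "group G" "group H" "group A" and f: "f \<in> hom G A" and h: "h \<in> hom H A"
begin

interpretation A: group A by (rule groups)

lemma fp_eval_closed: "w \<in> lists (letters G H) \<Longrightarrow> fp_eval A f h w \<in> carrier A"
  by (induction w) (auto simp: hom_in_carrier[OF f] hom_in_carrier[OF h])

lemma fp_eval_append:
  "u \<in> lists (letters G H) \<Longrightarrow> v \<in> lists (letters G H) \<Longrightarrow>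
    fp_eval A f h (u @ v) = fp_eval A f h u \<otimes>\<^bsub>A\<^esub> fp_eval A f h v"
proof (induction u)
  case (Cons x u)
  then have "fp_eval A f h u \<in> carrier A" "fp_eval A f h v \<in> carrier A" using fp_eval_closed by auto
  with Cons show ?case by (auto simp: hom_in_carrier[OF f] hom_in_carrier[OF h] A.m_assoc)
qed (simp add: fp_eval_closed)

lemma fp_eval_step:
  assumes "free_product_step G H p q" "p \<in> lists (letters G H)"
  shows "fp_eval A f h p = fp_eval A f h q"
proof -
  interpret G: group G by (rule groups)
  interpret H: group H by (rule groups)
  have one: "f \<one>\<^bsub>G\<^esub> = \<one>\<^bsub>A\<^esub>" "h \<one>\<^bsub>H\<^esub> = \<one>\<^bsub>A\<^esub>"
    using hom_one f h groups by metis+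
  show ?thesis using assms(1)
  proof cases
    case (one_left u v)
    then show ?thesis using assms(2) fp_eval_append[of u v] fp_eval_append[of u "Inl \<one>\<^bsub>G\<^esub> # v"]
      by (simp add: one fp_eval_closed)
  next
    case (one_right u v)
    then show ?thesis using assms(2) fp_eval_append[of u v] fp_eval_append[of u "Inr \<one>\<^bsub>H\<^esub> # v"]
      by (simp add: one fp_eval_closed)
  next
    case (mult_left a b u v)
    have uv: "u \<in> lists (letters G H)" "v \<in> lists (letters G H)" using assms(2) mult_left by simp_all
    then show ?thesis using mult_left fp_eval_append[of u "Inl (a \<otimes>\<^bsub>G\<^esub> b) # v"] fp_eval_append[of u "Inl a # Inl b # v"]
      by (simp add: hom_mult[OF f] hom_in_carrier[OF f] A.m_assoc fp_eval_closed)
  next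
    case (mult_right a b u v)
    have uv: "u \<in> lists (letters G H)" "v \<in> lists (letters G H)" using assms(2) mult_right by simp_all
    then show ?thesis using mult_right fp_eval_append[of u "Inr (a \<otimes>\<^bsub>H\<^esub> b) # v"] fp_eval_append[of u "Inr a # Inr b # v"]
      by (simp add: hom_mult[OF h] hom_in_carrier[OF h] A.m_assoc fp_eval_closed)
  qed
qed

lemma fp_eval_eq:
  assumes "fp_eq G H p q" "p \<in> lists (letters G H)"
  shows "fp_eval A f h p = fp_eval A f h q"
proof -
  have "(p \<in> lists (letters G H) \<and> fp_eval A f h p = fp_eval A f h p) \<longleftrightarrow>
        (q \<in> lists (letters G H) \<and> fp_eval A f h q = fp_eval A f h p)"
  proof (rule equivclp_invariant[OF _ assms(1), where P = "\<lambda>x. x \<in> lists (letters G H) \<and> fp_eval A f h x = fp_eval A f h p"])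
    fix x y assume xy: "free_product_step G H x y"
    from fp_step_letters[OF groups(1,2) xy] fp_eval_step[OF xy]
    show "(x \<in> lists (letters G H) \<and> fp_eval A f h x = fp_eval A f h p) \<longleftrightarrow>
        (y \<in> lists (letters G H) \<and> fp_eval A f h y = fp_eval A f h p)" by metis
  qed
  then show ?thesis using assms(2) by simp
qed

lemma free_product_hom:
  "\<exists>F\<in>hom (free_product G H) A. (\<forall>a\<in>carrier G. F (fp_left G H a) = f a) \<and> (\<forall>b\<in>carrier H. F (fp_right G H b) = h b)"
proof -
  interpret congruence "lists (letters G H)" "(@)" "[]" "fp_eq G H" by (rule congruence_fp[OF groups(1,2)])
  obtain F where F: "F \<in> hom Q A" "\<And>p. p \<in> lists (letters G H) \<Longrightarrow> F (cls p) = fp_eval A f h p"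
    using hom_Q[where h = "fp_eval A f h", OF fp_eval_closed fp_eval_append fp_eval_eq] by blast
  have "F (fp_left G H a) = f a" if "a \<in> carrier G" for a
    using F(2)[of "[Inl a]"] that by (simp add: fp_left_def hom_in_carrier[OF f])
  moreover have "F (fp_right G H b) = h b" if "b \<in> carrier H" for b
    using F(2)[of "[Inr b]"] that by (simp add: fp_right_def hom_in_carrier[OF h])
  ultimately show ?thesis using F(1) free_product_eq by metis
qed

end

lemma free_product_induct:
  assumes G: "group G" "group H" and x: "x \<in> carrier (free_product G H)"
    and one: "P \<one>\<^bsub>free_product G H\<^esub>"
    and left: "\<And>a y. a \<in> carrier G \<Longrightarrow> y \<in> carrier (free_product G H) \<Longrightarrow> P y \<Longrightarrow> P (fp_left G H a \<otimes>\<^bsub>free_product G H\<^esub> y)"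
    and right: "\<And>b y. b \<in> carrier H \<Longrightarrow> y \<in> carrier (free_product G H) \<Longrightarrow> P y \<Longrightarrow> P (fp_right G H b \<otimes>\<^bsub>free_product G H\<^esub> y)"
  shows "P x"
proof -
  interpret congruence "lists (letters G H)" "(@)" "[]" "fp_eq G H" by (rule congruence_fp[OF G])
  obtain w where w: "w \<in> lists (letters G H)" "x = cls w" using x by (auto simp: free_product_eq carrier_Q)
  have "P (cls w)" using w(1)
  proof (induction w)
    case Nil then show ?case using one by (simp add: free_product_eq one_Q)
  next
    case (Cons l w)
    then have w: "w \<in> lists (letters G H)" "l \<in> letters G H" by auto
    have eq: "cls (l # w) = cls [l] \<otimes>\<^bsub>free_product G H\<^esub> cls w"
      using mult_Q[of "[l]" w] w by (simp add: free_product_eq)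
    have c: "cls w \<in> carrier (free_product G H)" using cls_in_carrier[OF w(1)] by (simp add: free_product_eq)
    from w(2) show ?case
    proof
      assume "l \<in> Inl ` carrier G"
      then show ?thesis using left[OF _ c] Cons.IH eq by (auto simp: fp_left_def)
    next
      assume "l \<in> Inr ` carrier H"
      then show ?thesis using right[OF _ c] Cons.IH eq by (auto simp: fp_right_def)
    qed
  qed
  then show ?thesis using w(2) by simp
qed

section \<open>Free index zero\<close>

lemma free_group_0: "group (free_group 0)" "carrier (free_group 0) = {\<one>\<^bsub>free_group 0\<^esub>}"
proof -
  have step: "\<not> free_group_step 0 p q" for p q by (auto elim: free_group_step.cases)
  have eq: "equivclp (free_group_step 0) p q \<longleftrightarrow> p = q" for p q
  proof
    assume "equivclp (free_group_step 0) p q"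
    then show "p = q" by (induction rule: equivclp_induct) (use step in auto)
  qed simp
  have e: "free_group 0 = quot_monoid {[]} (@) [] (equivclp (free_group_step 0))"
    by (simp add: free_group_def word_group_eq_quot lists_empty)
  interpret congruence "{[]}" "(@)" "[]" "equivclp (free_group_step 0)"
    by unfold_locales (auto simp: eq)
  show "group (free_group 0)" unfolding e by (rule group_Q) auto
  show "carrier (free_group 0) = {\<one>\<^bsub>free_group 0\<^esub>}" unfolding e by (simp add: carrier_Q one_Q)
qed

text \<open>Evaluation that kills the trivial factor is a left inverse of \<open>fp_left\<close>,
  and induction on words shows that \<open>fp_left\<close> is onto.\<close>

lemma free_product_free_group_0:
  assumes H: "group H" shows "H \<cong> free_product H (free_group 0)"
proof -
  let ?F = "free_group 0 :: (nat \<times> bool) list set monoid"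
  note F = free_group_0
  interpret H: group H by fact
  interpret P: group "free_product H ?F" by (rule group_free_product[OF H F(1)])
  have "(\<lambda>_. \<one>\<^bsub>H\<^esub>) \<in> hom ?F H" by (simp add: hom_def)
  from free_product_hom[OF H F(1) H _ this, of "\<lambda>x. x"] obtain g where
    g: "g \<in> hom (free_product H ?F) H" "\<And>a. a \<in> carrier H \<Longrightarrow> g (fp_left H ?F a) = a"
    by (auto simp: hom_def)
  have l: "fp_left H ?F \<in> hom H (free_product H ?F)" by (rule fp_left_hom[OF H F(1)])
  have one: "fp_left H ?F \<one>\<^bsub>H\<^esub> = \<one>\<^bsub>free_product H ?F\<^esub>" "fp_right H ?F \<one>\<^bsub>?F\<^esub> = \<one>\<^bsub>free_product H ?F\<^esub>"
    using hom_one[OF l H P.is_group] hom_one[OF fp_right_hom[OF H F(1)] F(1) P.is_group] by simp_all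
  have "x \<in> fp_left H ?F ` carrier H" if "x \<in> carrier (free_product H ?F)" for x
  proof (rule free_product_induct[OF H F(1) that])
    show "\<one>\<^bsub>free_product H ?F\<^esub> \<in> fp_left H ?F ` carrier H" using one(1) by (metis H.one_closed image_eqI)
  next
    fix a y assume a: "a \<in> carrier H" and "y \<in> fp_left H ?F ` carrier H"
    then obtain b where b: "b \<in> carrier H" "y = fp_left H ?F b" by auto
    then have "fp_left H ?F a \<otimes>\<^bsub>free_product H ?F\<^esub> y = fp_left H ?F (a \<otimes>\<^bsub>H\<^esub> b)" using hom_mult[OF l a] by simp
    then show "fp_left H ?F a \<otimes>\<^bsub>free_product H ?F\<^esub> y \<in> fp_left H ?F ` carrier H" using a b by auto
  next
    fix b y assume "b \<in> carrier ?F" "y \<in> carrier (free_product H ?F)" "y \<in> fp_left H ?F ` carrier H"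
    moreover from this have "b = \<one>\<^bsub>?F\<^esub>" using F(2) by auto
    ultimately show "fp_right H ?F b \<otimes>\<^bsub>free_product H ?F\<^esub> y \<in> fp_left H ?F ` carrier H" using one(2) by simp
  qed
  moreover have "fp_left H ?F ` carrier H \<subseteq> carrier (free_product H ?F)" using hom_in_carrier[OF l] by blast
  moreover have "inj_on (fp_left H ?F) (carrier H)" using g(2) by (metis inj_onI)
  ultimately have "fp_left H ?F \<in> iso H (free_product H ?F)" using l by (auto simp: iso_def bij_betw_def)
  then show ?thesis by (rule is_isoI)
qed

text \<open>A free factor of rank zero changes nothing, so the complement \<open>H\<close> in
  \<open>has_free_index\<close> is isomorphic to the group itself, and integer free factors are
  transported along this isomorphism.\<close>

lemma has_free_index_0_iff:
  assumes G: "group G" shows "has_free_index G 0 \<longleftrightarrow> \<not> has_integer_free_factor G"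
proof
  assume "has_free_index G 0"
  then obtain H :: "'a monoid" where H: "group H" "\<not> has_integer_free_factor H" "G \<cong> free_product H (free_group 0)"
    by (auto simp: has_free_index_def)
  have "free_product H (free_group 0) \<cong> G" by (rule group.iso_sym[OF G H(3)])
  with free_product_free_group_0[OF H(1)] have HG: "H \<cong> G" by (rule iso_trans)
  show "\<not> has_integer_free_factor G"
  proof
    assume "has_integer_free_factor G"
    then obtain H' :: "'a monoid" where "group H'" "G \<cong> free_product H' integer_group"
      by (auto simp: has_integer_free_factor_def)
    then have "has_integer_free_factor H" using iso_trans[OF HG] unfolding has_integer_free_factor_def by blast
    then show False using H(2) by simp
  qed
next
  assume "\<not> has_integer_free_factor G"
  then show "has_free_index G 0" using G free_product_free_group_0[OF G] unfolding has_free_index_def by blast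
qed

text \<open>Projection to the second factor is a left inverse of \<open>fp_right\<close>, which
  therefore embeds the integers.\<close>

lemma finite_no_integer_free_factor:
  assumes G: "group G" and fin: "finite (carrier G)" shows "\<not> has_integer_free_factor G"
proof
  assume "has_integer_free_factor G"
  then obtain H :: "'a monoid" where H: "group H" "G \<cong> free_product H integer_group"
    by (auto simp: has_integer_free_factor_def)
  have "(\<lambda>_. 0) \<in> hom H integer_group" "(\<lambda>x. x) \<in> hom integer_group integer_group" by (simp_all add: hom_def)
  from free_product_hom[OF H(1) group_integer_group group_integer_group this] obtain g where
    g: "\<And>n. g (fp_right H integer_group n) = n" by auto
  have "finite (carrier (free_product H integer_group))" using iso_finite[OF H(2)] fin by blast
  moreover have "range (fp_right H integer_group) \<subseteq> carrier (free_product H integer_group)"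
    using hom_in_carrier[OF fp_right_hom[OF H(1) group_integer_group]] by auto
  ultimately have "finite (range (fp_right H integer_group))" by (rule finite_subset[rotated])
  moreover have "inj (fp_right H integer_group)" using g by (metis injI)
  ultimately show False using finite_imageD[of "fp_right H integer_group" UNIV] infinite_UNIV_int by auto
qed

section \<open>Edges that lie in no triangle\<close>

text \<open>A multiplicative labelling of the edges already determines a homomorphism; so no
  presentation of the edge-path group by generators and relations is ever formed.\<close>

lemma edge_group_hom:
  assumes "cocycle A K w" "{v} \<in> K"
  shows "\<exists>F\<in>hom (edge_group K v) A. \<forall>L\<in>walks K v v. F (edge_class K L) = label_prod A w L"
proof -
  interpret cocycle A K w by fact
  interpret congruence "walks K v v" "\<lambda>p q. p @ tl q" "[v]" "edge_eq K" by (rule congruence_edge[OF complex assms(2)])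
  show ?thesis unfolding edge_group_def edge_class_def
  proof (rule hom_Q)
    fix p q assume p: "p \<in> walks K v v"
    show "label_prod A w p \<in> carrier A" by (rule label_prod_closed[OF walksD(2)[OF p]])
    show "label_prod A w p = label_prod A w q" if "edge_eq K p q" by (rule label_prod_eq[OF that walksD(2)[OF p]])
    show "label_prod A w (p @ tl q) = label_prod A w p \<otimes>\<^bsub>A\<^esub> label_prod A w q" if q: "q \<in> walks K v v"
      using walksD[OF p] walksD[OF q] by (intro label_prod_join) simp_all
  qed
qed

lemma edge_group_inclusion:
  assumes K: "finite_complex K" "finite_complex K'" "K' \<subseteq> K" "{v} \<in> K'"
  shows "\<exists>F\<in>hom (edge_group K' v) (edge_group K v). \<forall>L\<in>walks K' v v. F (edge_class K' L) = edge_class K L"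
proof -
  interpret congruence "walks K' v v" "\<lambda>p q. p @ tl q" "[v]" "edge_eq K'" by (rule congruence_edge[OF K(2,4)])
  have v: "{v} \<in> K" using K by blast
  note sub = subsetD[OF walks_mono[OF K(3)]]
  show ?thesis unfolding edge_group_def[of K'] edge_class_def[of K']
  proof (rule hom_Q)
    fix p q assume p: "p \<in> walks K' v v"
    show "edge_class K p \<in> carrier (edge_group K v)" using sub[OF p] by (simp add: edge_group_carrier)
    show "edge_class K p = edge_class K q" if "edge_eq K' p q" using edge_eq_mono[OF that K(3)] by (simp add: edge_class_eq_iff)
    show "edge_class K (p @ tl q) = edge_class K p \<otimes>\<^bsub>edge_group K v\<^esub> edge_class K q" if q: "q \<in> walks K' v v"
      by (rule edge_group_mult[OF K(1) v sub[OF p] sub[OF q], symmetric])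
  qed
qed

lemma base_walks:
  assumes "edge_connected K v"
  obtains q where "\<And>a. {a} \<in> K \<Longrightarrow> q a \<in> walks K v a" "q v = [v]"
proof -
  have "\<exists>q. {a} \<in> K \<longrightarrow> q \<in> walks K v a" for a using assms by (auto simp: edge_connected_def)
  then obtain q where q: "\<And>a. {a} \<in> K \<Longrightarrow> q a \<in> walks K v a" by metis
  have "[v] \<in> walks K v v" using assms by (intro walks_single) (simp add: edge_connected_def)
  then show thesis using that[of "q(v := [v])"] q by simp
qed

lemma cocycle_hom:
  assumes "cocycle A K w" "group B" "h \<in> hom A B"
  shows "cocycle B K (\<lambda>a b. h (w a b))"
proof -
  interpret cocycle A K w by fact
  interpret B: group B by fact
  show ?thesis
  proof
    fix a b assume "{a, b} \<in> K" then show "h (w a b) \<in> carrier B" by (rule hom_in_carrier[OF assms(3) label_closed])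
  next
    fix a b c assume abc: "{a, b, c} \<in> K"
    have "{a, b} \<in> K" "{b, c} \<in> K" using complex_face[OF complex abc] by auto
    then show "h (w a b) \<otimes>\<^bsub>B\<^esub> h (w b c) = h (w a c)"
      using hom_mult[OF assms(3)] label_closed label_mult[OF abc] by metis
  qed (rule complex)
qed

lemma finite_complex_remove_edge:
  assumes K: "finite_complex K" and ab: "\<And>s. s \<in> K \<Longrightarrow> {a, b} \<subseteq> s \<Longrightarrow> s = {a, b}"
  shows "finite_complex (K - {{a, b}})"
  unfolding finite_complex_def
proof (intro conjI ballI allI impI)
  show "finite (K - {{a, b}})" using K by (simp add: finite_complex_def)
  fix s assume s: "s \<in> K - {{a, b}}"
  then show "finite s" "s \<noteq> {}" using K unfolding finite_complex_def by blast+
  fix t assume t: "t \<subseteq> s \<and> t \<noteq> {}"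
  then have "t \<in> K" using complex_face[OF K] s by blast
  moreover have "t \<noteq> {a, b}" using s t ab[of s] by blast
  ultimately show "t \<in> K - {{a, b}}" by simp
qed

text \<open>Adding an edge to a connected complex amounts to attaching a circle. \<open>F\<close>
  labels old edges in the left factor and the new edge by the generator of the integers;
  \<open>T\<close> maps back, sending the generator to the loop \<open>z\<close> through the new
  edge. \<open>T\<close> after \<open>F\<close> is the identity, and \<open>F\<close> reaches both
  factors. The approach walks \<open>q\<close> avoid the new edge and play the role of a maximal
  tree.\<close>

lemma edge_group_free_factor:
  fixes K :: "'v set set" and H :: "'h monoid"
  assumes K: "finite_complex K" and ab: "{a, b} \<in> K" "a \<noteq> b" "\<And>s. s \<in> K \<Longrightarrow> {a, b} \<subseteq> s \<Longrightarrow> s = {a, b}"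
    and conn: "edge_connected (K - {{a, b}}) v"
    and H: "group H" "edge_group (K - {{a, b}}) v \<cong> H"
  shows "edge_group K v \<cong> free_product H integer_group"
proof -
  define K0 where "K0 = K - {{a, b}}"
  have K0: "finite_complex K0" unfolding K0_def by (rule finite_complex_remove_edge[OF K ab(3)])
  have sub: "K0 \<subseteq> K" by (auto simp: K0_def)
  have v0: "{v} \<in> K0" using conn by (simp add: edge_connected_def K0_def)
  then have v: "{v} \<in> K" using sub by blast
  have vert: "{c} \<in> K0" if "{c} \<in> K" for c using that ab(2) by (auto simp: K0_def)
  let ?Esub = "edge_group K0 v" and ?E = "edge_group K v" and ?B = "free_product H integer_group"
  have gE0: "group ?Esub" by (rule group_edge_group[OF K0 v0])
  have "group ?E" by (rule group_edge_group[OF K v])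
  then interpret E: group ?E .
  have gB: "group ?B" by (rule group_free_product[OF H(1) group_integer_group])
  interpret B: group ?B by (rule gB)
  obtain q where q0: "\<And>c. {c} \<in> K0 \<Longrightarrow> q c \<in> walks K0 v c" and qv: "q v = [v]"
    using base_walks conn unfolding K0_def by metis
  have q: "q c \<in> walks K v c" if "{c} \<in> K" for c using q0[OF vert[OF that]] walks_mono[OF sub] by blast
  obtain psi where psi: "psi \<in> iso ?Esub H" using H(2) by (auto simp: is_iso_def K0_def)
  then have psi_hom: "psi \<in> hom ?Esub H" by (simp add: iso_def)
  define phi where "phi = inv_into (carrier ?Esub) psi"
  have phi: "phi \<in> iso H ?Esub" unfolding phi_def by (rule group.iso_set_sym[OF gE0 psi])
  have phi_psi: "phi (psi x) = x" if "x \<in> carrier ?Esub" for x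
    using that psi by (simp add: phi_def iso_def bij_betw_def)
  have psi_surj: "\<exists>x\<in>carrier ?Esub. psi x = y" if "y \<in> carrier H" for y
    using that psi by (force simp: iso_def bij_betw_def)
  let ?l = "fp_left H integer_group" and ?r = "fp_right H integer_group"
  have l: "?l \<in> hom H ?B" by (rule fp_left_hom[OF H(1) group_integer_group])
  have r: "?r \<in> hom integer_group ?B" by (rule fp_right_hom[OF H(1) group_integer_group])
  let ?esub = "\<lambda>c d. edge_class K0 (q c @ rev (q d))" and ?e = "\<lambda>c d. edge_class K (q c @ rev (q d))"
  define w0 where "w0 c d = ?l (psi (?esub c d))" for c d
  have c0: "cocycle ?Esub K0 ?esub" by (rule cocycle_edge_group[OF K0 v0 q0])
  have ce: "cocycle ?E K ?e" by (rule cocycle_edge_group[OF K v q])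
  have cw0: "cocycle ?B K0 w0" unfolding w0_def
    by (rule cocycle_hom[OF cocycle_hom[OF c0 H(1) psi_hom] gB l])
  define w where "w c d = (if c = a \<and> d = b then ?r 1 else if c = b \<and> d = a then ?r (- 1) else w0 c d)" for c d
  have w_w0: "w c d = w0 c d" if "{c, d} \<in> K0" for c d
  proof -
    have "{c, d} \<noteq> {a, b}" using that unfolding K0_def by blast
    then have ne: "\<not> (c = a \<and> d = b)" "\<not> (c = b \<and> d = a)" by blast+
    show ?thesis unfolding w_def if_not_P[OF ne(1)] if_not_P[OF ne(2)] ..
  qed
  have r1: "?r 1 \<in> carrier ?B" "?r (- 1) \<in> carrier ?B" using hom_in_carrier[OF r] by simp_all
  have r0: "?r 1 \<otimes>\<^bsub>?B\<^esub> ?r (- 1) = \<one>\<^bsub>?B\<^esub>" "?r (- 1) \<otimes>\<^bsub>?B\<^esub> ?r 1 = \<one>\<^bsub>?B\<^esub>"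
    using hom_mult[OF r, of 1 "- 1"] hom_mult[OF r, of "- 1" 1] hom_one[OF r group_integer_group gB] by simp_all
  have refl: "w c c = \<one>\<^bsub>?B\<^esub>" if "{c} \<in> K" for c
    using cocycle.label_refl[OF cw0 vert[OF that]] w_w0[of c c] vert[OF that] by simp
  have K_cases: "{c, d} \<in> K0 \<or> (c = a \<and> d = b) \<or> (c = b \<and> d = a)" if "{c, d} \<in> K" for c d
    using that unfolding K0_def by (simp add: doubleton_eq_iff) blast
  have cw: "cocycle ?B K w"
  proof
    fix c d assume cd: "{c, d} \<in> K"
    show "w c d \<in> carrier ?B"
      using K_cases[OF cd] w_w0[of c d] cocycle.label_closed[OF cw0, of c d] r1 ab(2) by (auto simp: w_def)
  next
    fix c d e assume cde: "{c, d, e} \<in> K"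
    show "w c d \<otimes>\<^bsub>?B\<^esub> w d e = w c e"
    proof (cases "{c, d, e} = {a, b}")
      case True
      \<comment> \<open>The new edge lies in no larger simplex, so the only triangles on it are
        degenerate.\<close>
      have vab: "{a} \<in> K" "{b} \<in> K" using complex_face[OF K ab(1)] by auto
      have "c \<in> {a, b}" "d \<in> {a, b}" "e \<in> {a, b}" using True by blast+
      moreover have "w a b = ?r 1" "w b a = ?r (- 1)" using ab(2) by (simp_all add: w_def)
      ultimately show ?thesis using refl[OF vab(1)] refl[OF vab(2)] r0 r1 by auto
    next
      case False
      then have cde0: "{c, d, e} \<in> K0" using cde by (simp add: K0_def)
      then have "{c, d} \<in> K0" "{d, e} \<in> K0" "{c, e} \<in> K0" using complex_face[OF K0 cde0] by auto
      then show ?thesis using cocycle.label_mult[OF cw0 cde0] w_w0 by simp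
    qed
  qed (rule K)
  obtain F where F: "F \<in> hom ?E ?B" "\<And>L. L \<in> walks K v v \<Longrightarrow> F (edge_class K L) = label_prod ?B w L"
    using edge_group_hom[OF cw v] by blast
  obtain i where i: "i \<in> hom ?Esub ?E" "\<And>L. L \<in> walks K0 v v \<Longrightarrow> i (edge_class K0 L) = edge_class K L"
    using edge_group_inclusion[OF K K0 sub v0] by blast
  define z where "z = ?e a b"
  have z: "z \<in> carrier ?E" unfolding z_def by (rule cocycle.label_closed[OF ce ab(1)])
  have "i \<circ> phi \<in> hom H ?E" using phi i(1) by (auto simp: iso_def intro: hom_compose)
  from free_product_hom[OF H(1) group_integer_group E.is_group this E.hom_integer_group_pow[OF z]]
  obtain T where T: "T \<in> hom ?B ?E" "\<And>x. x \<in> carrier H \<Longrightarrow> T (?l x) = i (phi x)" "\<And>n. T (?r n) = z [^]\<^bsub>?E\<^esub> (n::int)"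
    by auto
  have Tw: "T (w c d) = ?e c d" if cd: "{c, d} \<in> K" for c d
  proof -
    consider "{c, d} \<in> K0" | "c = a" "d = b" | "c = b" "d = a" using K_cases[OF cd] by blast
    then show ?thesis
    proof cases
      case 1
      then have e0: "?esub c d \<in> carrier ?Esub" by (rule cocycle.label_closed[OF c0])
      have cd0: "{c} \<in> K0" "{d} \<in> K0" using complex_face[OF K0 1] by simp_all
      have "q c @ rev (q d) \<in> walks K0 v v"
        by (rule walks_append[OF q0[OF cd0(1)] walks_rev[OF q0[OF cd0(2)]] 1])
      then show ?thesis
        unfolding w_w0[OF 1] w0_def T(2)[OF hom_in_carrier[OF psi_hom e0]] phi_psi[OF e0] by (rule i(2))
    next
      case 2 then show ?thesis using T(3)[of 1] E.int_pow_1[OF z] by (simp add: w_def z_def)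
    next
      case 3
      have bb: "{b, a, b} \<in> K" "{b} \<in> K" using ab(1) complex_face[OF K ab(1), of "{b}"] by (simp_all add: insert_commute)
      have c1: "?e b a \<in> carrier ?E" using cocycle.label_closed[OF ce, of b a] ab(1) by (simp add: insert_commute)
      have "?e b a \<otimes>\<^bsub>?E\<^esub> z = \<one>\<^bsub>?E\<^esub>"
        unfolding z_def using cocycle.label_mult[OF ce bb(1)] cocycle.label_refl[OF ce bb(2)] by simp
      then have "inv\<^bsub>?E\<^esub> z = ?e b a" by (rule E.inv_equality[OF _ z c1])
      then show ?thesis using 3 T(3)[of "- 1"] z ab(2) by (simp add: w_def E.int_pow_neg)
    qed
  qed
  \<comment> \<open>\<open>T\<close> undoes the labelling edge by edge, and the telescoping product
    returns the loop.\<close>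
  have TF: "T (F x) = x" if "x \<in> carrier ?E" for x
  proof -
    obtain L where L: "L \<in> walks K v v" "x = edge_class K L" using that \<open>x \<in> _\<close> by (auto simp: edge_group_carrier)
    note D = walksD[OF L(1)]
    have "T (label_prod ?B w L) = label_prod ?E (\<lambda>c d. T (w c d)) L"
      by (rule label_prod_hom[OF gB E.is_group T(1) K D(2) cocycle.label_closed[OF cw]])
    also have "\<dots> = label_prod ?E ?e L" by (rule label_prod_cong[OF K D(2) Tw])
    also have "\<dots> = edge_class K (q (hd L) @ tl L @ tl (rev (q (last L))))" by (rule label_prod_edge_group[OF K v q D(2)])
    also have "q (hd L) @ tl L @ tl (rev (q (last L))) = L" using D qv by (cases L) auto
    finally show ?thesis using L F(2) by simp
  qed
  have lp0: "label_prod ?B w L = ?l (psi (edge_class K0 (q (hd L) @ tl L @ tl (rev (q (last L))))))" if "walk K0 L" for L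
  proof -
    have "walk K0 L \<Longrightarrow> label_prod ?B w L = label_prod ?B w0 L" for L by (rule label_prod_cong[OF K0 _ w_w0])
    then have "label_prod ?B w L = label_prod ?B w0 L" using that by blast
    also have "\<dots> = ?l (psi (label_prod ?Esub ?esub L))"
    proof -
      have h: "?l \<circ> psi \<in> hom ?Esub ?B" by (rule hom_compose[OF psi_hom l])
      show ?thesis using label_prod_hom[OF gE0 gB h K0 that cocycle.label_closed[OF c0]] by (simp add: w0_def[abs_def])
    qed
    finally show ?thesis using label_prod_edge_group[OF K0 v0 q0 that] by simp
  qed
  have l1: "?l (psi (edge_class K0 [v])) = \<one>\<^bsub>?B\<^esub>"
    using hom_one[OF psi_hom gE0 H(1)] hom_one[OF l H(1) gB] by (simp add: edge_group_one)
  \<comment> \<open>By \<open>lp0\<close>, this label is the image of the class of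
    \<open>q c\<close> run out and back.\<close>
  have tree: "label_prod ?B w (q c) = \<one>\<^bsub>?B\<^esub>" "label_prod ?B w (rev (q c)) = \<one>\<^bsub>?B\<^esub>" if "{c} \<in> K" for c
  proof -
    note D = walksD[OF q0[OF vert[OF that]]]
    have "edge_class K0 (q c @ tl (rev (q c))) = edge_class K0 [v]"
      using edge_eq_join_rev[OF K0 D(2)] D by (simp add: edge_class_eq_iff)
    note cc = this
    have e: "q (hd (q c)) @ tl (q c) @ tl (rev (q (last (q c)))) = q c @ tl (rev (q c))"
      using D qv by (cases "q c") auto
    show "label_prod ?B w (q c) = \<one>\<^bsub>?B\<^esub>" unfolding lp0[OF D(2)] e cc by (rule l1)
    have r: "walk K0 (rev (q c))" "hd (rev (q c)) = c" "last (rev (q c)) = v"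
      using D by (simp_all add: walk_rev hd_rev last_rev)
    show "label_prod ?B w (rev (q c)) = \<one>\<^bsub>?B\<^esub>" using l1 unfolding lp0[OF r(1)] r(2,3) qv by (simp add: cc)
  qed
  \<comment> \<open>The approach walks contribute nothing, so only the label of the new edge
    remains.\<close>
  have Fz: "F z = ?r 1"
  proof -
    have vab: "{a} \<in> K" "{b} \<in> K" using complex_face[OF K ab(1)] by auto
    note A = walksD[OF q[OF vab(1)]] and Bq = walksD[OF q[OF vab(2)]]
    interpret W: cocycle ?B K w by (rule cw)
    have ab': "[a, b] \<in> walks K a b" by (rule walks_edge[OF K ab(1)])
    have abq: "[a, b] @ tl (rev (q b)) \<in> walks K a v" by (rule walks_join[OF ab' walks_rev[OF q[OF vab(2)]]])
    have "rev (q b) = b # tl (rev (q b))" using Bq by (metis hd_rev list.collapse rev_is_Nil_conv)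
    then have eq: "q a @ rev (q b) = q a @ tl ([a, b] @ tl (rev (q b)))" by simp
    have "label_prod ?B w (q a @ tl ([a, b] @ tl (rev (q b)))) =
        label_prod ?B w (q a) \<otimes>\<^bsub>?B\<^esub> label_prod ?B w ([a, b] @ tl (rev (q b)))"
      using A walksD[OF abq] by (intro W.label_prod_join) simp_all
    also have "label_prod ?B w ([a, b] @ tl (rev (q b))) = label_prod ?B w [a, b] \<otimes>\<^bsub>?B\<^esub> label_prod ?B w (rev (q b))"
      using Bq walksD[OF ab'] walksD[OF walks_rev[OF q[OF vab(2)]]] by (intro W.label_prod_join) simp_all
    finally have "label_prod ?B w (q a @ rev (q b)) = w a b"
      unfolding eq using tree vab W.label_closed[OF ab(1)] by simp
    moreover have "q a @ rev (q b) \<in> walks K v v"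
      by (rule walks_append[OF q[OF vab(1)] walks_rev[OF q[OF vab(2)]] ab(1)])
    ultimately show ?thesis using F(2) by (simp add: z_def w_def)
  qed
  have surj: "x \<in> F ` carrier ?E" if "x \<in> carrier ?B" for x
  proof (rule free_product_induct[OF H(1) group_integer_group that])
    show "\<one>\<^bsub>?B\<^esub> \<in> F ` carrier ?E" using hom_one[OF F(1) E.is_group gB] by (metis E.one_closed image_eqI)
  next
    fix x y assume x: "x \<in> carrier H" and "y \<in> F ` carrier ?E"
    then obtain u where u: "u \<in> carrier ?E" "y = F u" by blast
    obtain L where L: "L \<in> walks K0 v v" "x = psi (edge_class K0 L)" using psi_surj[OF x] by (auto simp: edge_group_carrier)
    note D = walksD[OF L(1)]
    have "q (hd L) @ tl L @ tl (rev (q (last L))) = L" using D qv by (cases L) auto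
    then have "label_prod ?B w L = ?l x" using lp0[OF D(2)] L(2) by simp
    moreover have LK: "L \<in> walks K v v" using L(1) walks_mono[OF sub] by blast
    ultimately have "F (edge_class K L) = ?l x" using F(2) by simp
    moreover have LE: "edge_class K L \<in> carrier ?E" using LK by (simp add: edge_group_carrier)
    ultimately have "?l x \<otimes>\<^bsub>?B\<^esub> y = F (edge_class K L \<otimes>\<^bsub>?E\<^esub> u)" using u hom_mult[OF F(1) LE u(1)] by simp
    then show "?l x \<otimes>\<^bsub>?B\<^esub> y \<in> F ` carrier ?E" using LE u by blast
  next
    fix n :: int and y assume "y \<in> F ` carrier ?E"
    then obtain u where u: "u \<in> carrier ?E" "y = F u" by blast
    have "F (z [^]\<^bsub>?E\<^esub> n) = F z [^]\<^bsub>?B\<^esub> n" by (rule hom_int_pow[OF F(1) z E.is_group gB])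
    also have "\<dots> = ?r n" using hom_int_pow[OF r _ group_integer_group gB, of 1 n] Fz by simp
    finally have "?r n \<otimes>\<^bsub>?B\<^esub> y = F (z [^]\<^bsub>?E\<^esub> n \<otimes>\<^bsub>?E\<^esub> u)" using u hom_mult[OF F(1) _ u(1)] z by simp
    then show "?r n \<otimes>\<^bsub>?B\<^esub> y \<in> F ` carrier ?E" using z u by blast
  qed
  have "F ` carrier ?E = carrier ?B" using surj hom_in_carrier[OF F(1)] by blast
  moreover have "inj_on F (carrier ?E)" using TF by (metis inj_onI)
  ultimately have "F \<in> iso ?E ?B" using F(1) by (simp add: iso_def bij_betw_def)
  then show ?thesis by (rule is_isoI)
qed

section \<open>Contracting an edge\<close>

text \<open>Lifts an edge path in the complex obtained by contracting \<open>b\<close> to a neighbour: an edge that is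
  not in \<open>K\<close> comes from a path of two edges through \<open>b\<close>.\<close>

fun lift_path :: "'v set set \<Rightarrow> 'v \<Rightarrow> 'v list \<Rightarrow> 'v list" where
  "lift_path K b (c # d # L) = (if {c, d} \<in> K then c # lift_path K b (d # L) else c # b # lift_path K b (d # L))"
| "lift_path K b [c] = [c]"
| "lift_path K b [] = []"

lemma lift_path_ends [simp]:
  "L \<noteq> [] \<Longrightarrow> lift_path K b L \<noteq> []" "hd (lift_path K b L) = hd L"
  "L \<noteq> [] \<Longrightarrow> last (lift_path K b L) = last L"
proof -
  show ne: "lift_path K b L \<noteq> []" if "L \<noteq> []" for L using that by (cases "(K, b, L)" rule: lift_path.cases) auto
  show "hd (lift_path K b L) = hd L" by (cases "(K, b, L)" rule: lift_path.cases) auto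
  show "L \<noteq> [] \<Longrightarrow> last (lift_path K b L) = last L"
  proof (induction L rule: induct_list012)
    case (3 c d L) then show ?case using ne[of "d # L"] by simp
  qed simp_all
qed

lemma lift_path_join:
  "p \<noteq> [] \<Longrightarrow> q \<noteq> [] \<Longrightarrow> last p = hd q \<Longrightarrow> lift_path K b (p @ tl q) = lift_path K b p @ tl (lift_path K b q)"
proof (induction p rule: induct_list012)
  case (2 x)
  obtain r where q: "q = x # r" using 2 by (cases q) simp_all
  have "lift_path K b q = x # tl (lift_path K b q)"
    unfolding q using lift_path_ends(1)[of "x # r" K b] lift_path_ends(2)[of K b "x # r"] by (cases "lift_path K b (x # r)") simp_all
  then show ?case using q by simp
qed simp_all

text \<open>By \<open>no_neighbour\<close>, an edge of \<open>K'\<close> from \<open>a\<close> to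
  another vertex comes from an edge at \<open>a\<close> or from one at \<open>b\<close>, but never
  from both. This makes lifting unambiguous.\<close>

locale contraction =
  fixes K :: "'v set set" and a b :: 'v and s :: "'v \<Rightarrow> 'v" and K' :: "'v set set"
  defines "s \<equiv> \<lambda>x. if x = b then a else x" and "K' \<equiv> (`) s ` K"
  assumes complex: "finite_complex K" and edge: "{a, b} \<in> K" "a \<noteq> b"
    and no_triangle: "\<And>t. t \<in> K \<Longrightarrow> {a, b} \<subseteq> t \<Longrightarrow> t = {a, b}"
    and no_neighbour: "\<And>d. {a, d} \<in> K \<Longrightarrow> {b, d} \<in> K \<Longrightarrow> d = a \<or> d = b"
begin

abbreviation lift where "lift \<equiv> lift_path K b"

lemma vertices: "{a} \<in> K" "{b} \<in> K"
  using complex_face[OF complex edge(1)] by simp_all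

lemma complex': "finite_complex K'"
  unfolding K'_def by (rule finite_complex_image[OF complex])

lemma s_image: "t \<in> K \<Longrightarrow> s ` t \<in> K'"
  by (simp add: K'_def)

lemma s_simps: "s b = a" "x \<noteq> b \<Longrightarrow> s x = x" "s x \<noteq> b"
  using edge(2) by (simp_all add: s_def)

lemma vertex'D: assumes "{c} \<in> K'" shows "{c} \<in> K" "c \<noteq> b"
proof -
  obtain t where t: "t \<in> K" "{c} = s ` t" using assms by (auto simp: K'_def)
  then obtain x where x: "x \<in> t" "c = s x" by blast
  then have "{x} \<in> K" using complex_face[OF complex t(1)] by simp
  then show "{c} \<in> K" "c \<noteq> b" using x vertices edge(2) by (auto simp: s_def)
qed

text \<open>A simplex that contains both \<open>a\<close> and \<open>b\<close> is the contracted
  edge and becomes \<open>{a}\<close>; so the second alternative stands for simplices that contain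
  \<open>b\<close> but not \<open>a\<close>.\<close>

lemma simplex'D:
  assumes "t \<in> K'" obtains "t \<in> K" | "a \<in> t" "insert b (t - {a}) \<in> K" "t \<noteq> {a}"
proof -
  obtain u where u: "u \<in> K" "t = s ` u" using assms by (auto simp: K'_def)
  show thesis
  proof (cases "b \<in> u")
    case False
    then have "s ` u = (\<lambda>x. x) ` u" by (intro image_cong) (auto simp: s_def)
    then have "t = u" using u by simp
    then show thesis using that(1) u(1) by simp
  next
    case b: True
    show thesis
    proof (cases "a \<in> u")
      case True
      then have "u = {a, b}" using b no_triangle[OF u(1)] by simp
      then have "t = {a}" using u(2) edge(2) by (simp add: s_def)
      then show thesis using that(1) vertices(1) by simp
    next
      case False
      have "s ` (u - {b}) = (\<lambda>x. x) ` (u - {b})" by (intro image_cong) (auto simp: s_def)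
      moreover have "s ` u = insert (s b) (s ` (u - {b}))" using b by blast
      ultimately have t: "t = insert a (u - {b})" using u(2) by (simp add: s_simps)
      then have "insert b (t - {a}) = u" using False b by blast
      then show thesis using t that(1)[of] that(2) u(1) vertices(1) by (cases "t = {a}") auto
    qed
  qed
qed

lemma edge'_cases:
  assumes "{c, d} \<in> K'" "{c, d} \<notin> K"
  shows "(c = a \<or> d = a) \<and> {c, b} \<in> K \<and> {b, d} \<in> K"
proof (rule simplex'D[OF assms(1)])
  assume x: "a \<in> {c, d}" "insert b ({c, d} - {a}) \<in> K" "{c, d} \<noteq> {a}"
  consider "c = a" "d \<noteq> a" | "d = a" "c \<noteq> a" using x by auto
  then show ?thesis
  proof cases
    case 1
    then have "insert b ({c, d} - {a}) = {b, d}" by auto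
    then show ?thesis using 1 x(2) edge(1) by simp
  next
    case 2
    then have "insert b ({c, d} - {a}) = {c, b}" by auto
    then show ?thesis using 2 x(2) edge(1) by (simp add: insert_commute)
  qed
qed (use assms in simp)

lemma lift_walk: "walk K' L \<Longrightarrow> walk K (lift L)"
proof (induction L rule: induct_list012)
  case (2 c) then show ?case using vertex'D by (simp add: walk_single)
next
  case (3 c d L)
  then have w: "walk K' (d # L)" and cd: "{c, d} \<in> K'" by (simp_all add: walk_Cons_Cons[OF complex'])
  obtain M where M: "lift (d # L) = d # M"
    using lift_path_ends(1)[of "d # L" K b] lift_path_ends(2)[of K b "d # L"] by (cases "lift (d # L)") simp_all
  then have wM: "walk K (d # M)" using 3(2)[OF w] by simp
  show ?case
  proof (cases "{c, d} \<in> K")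
    case True then show ?thesis using M wM by (simp add: walk_Cons_Cons[OF complex])
  next
    case False
    then show ?thesis using M wM edge'_cases[OF cd False] by (simp add: walk_Cons_Cons[OF complex])
  qed
qed (simp add: walk_def)

lemma map_lift: "walk K' L \<Longrightarrow> edge_eq K' (map s (lift L)) L"
proof (induction L rule: induct_list012)
  case (2 c) then show ?case using vertex'D[of c] by (simp add: walk_single s_simps)
next
  case (3 c d L)
  then have w: "walk K' (d # L)" and cd: "{c, d} \<in> K'" by (simp_all add: walk_Cons_Cons[OF complex'])
  have "{c} \<in> K'" by (rule complex_face[OF complex' cd]) simp_all
  then have c: "s c = c" using vertex'D s_simps by simp
  note IH = 3(2)[OF w]
  show ?case
  proof (cases "{c, d} \<in> K")
    case True then show ?thesis using edge_eq_Cons[OF IH, of c] c by simp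
  next
    case False
    have "edge_eq K' (c # a # map s (lift (d # L))) (c # a # d # L)" by (rule edge_eq_Cons[OF edge_eq_Cons[OF IH]])
    also have "edge_eq K' \<dots> (c # d # L)"
      using edge'_cases[OF cd False] edge_eq_stutter[of K' a] edge_eq_Cons[OF edge_eq_stutter[of K' a L], of c] by blast
    finally show ?thesis using False c by (simp add: s_simps)
  qed
qed (simp add: walk_def)

text \<open>Projection moves an end point \<open>b\<close> to \<open>a\<close>, and lifting does not
  move it back; \<open>arm\<close> is the missing step between the two.\<close>

definition arm :: "'v \<Rightarrow> 'v list" where
  "arm x = (if x = b then [a] else [])"

lemma lift_map: "walk K p \<Longrightarrow> edge_eq K (lift (map s p)) (arm (hd p) @ p @ arm (last p))"
proof (induction p rule: induct_list012)
  case (2 c)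
  show ?case
  proof (cases "c = b")
    case True then show ?thesis using equivclp_sym[OF edge_eq_backtrack[OF edge(1), of "[]"]] by (simp add: arm_def s_simps)
  qed (simp add: arm_def s_simps)
next
  case (3 c d L)
  then have w: "walk K (d # L)" and cd: "{c, d} \<in> K" by (simp_all add: walk_Cons_Cons[OF complex])
  let ?M = "lift (s d # map s L)" and ?E = "arm (last (d # L))"
  have IH: "edge_eq K ?M (arm d @ (d # L) @ ?E)" using 3(2)[OF w] by simp
  have ba: "{b, a} \<in> K" using edge(1) by (simp add: insert_commute)
  consider "c \<noteq> b" "d \<noteq> b" | "c = a" "d = b" | "c \<noteq> a" "c \<noteq> b" "d = b" | "c = b" "d = b"
    | "c = b" "d = a" | "c = b" "d \<noteq> a" "d \<noteq> b" by blast
  then have "edge_eq K (lift (s c # s d # map s L)) (arm c @ (c # d # L) @ ?E)"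
  proof cases
    case 1
    then show ?thesis using cd edge_eq_Cons[OF IH, of c] by (simp add: s_simps arm_def)
  next
    case 2
    have "edge_eq K (a # ?M) (a # a # b # L @ ?E)" using edge_eq_Cons[OF IH, of a] 2 by (simp add: arm_def)
    also have "edge_eq K \<dots> (a # b # L @ ?E)" by (rule edge_eq_stutter)
    finally show ?thesis using 2 vertices edge(2) by (simp add: s_simps arm_def)
  next
    case 3
    \<comment> \<open>Hence the lift of the edge from \<open>c\<close> to \<open>a\<close> is the
      detour through \<open>b\<close>.\<close>
    have "{c, a} \<notin> K" using no_neighbour[of c] 3 cd by (auto simp: insert_commute)
    moreover have "edge_eq K (c # b # ?M) (c # b # a # b # L @ ?E)"
      using edge_eq_Cons[OF edge_eq_Cons[OF IH, of b], of c] 3 by (simp add: arm_def)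
    moreover have "edge_eq K (c # b # a # b # L @ ?E) (c # b # L @ ?E)"
      by (rule edge_eq_Cons[OF edge_eq_backtrack[OF ba]])
    ultimately show ?thesis using 3 edge_eq_trans by (fastforce simp: s_simps arm_def)
  next
    case 4
    have "edge_eq K (a # ?M) (a # a # b # L @ ?E)" using edge_eq_Cons[OF IH, of a] 4 by (simp add: arm_def)
    also have "edge_eq K \<dots> (a # b # L @ ?E)" by (rule edge_eq_stutter)
    also have "edge_eq K \<dots> (a # b # b # L @ ?E)" by (rule edge_eq_Cons[OF equivclp_sym[OF edge_eq_stutter]])
    finally show ?thesis using 4 vertices edge(2) by (simp add: s_simps arm_def)
  next
    case 5
    have "edge_eq K (a # ?M) (a # a # L @ ?E)" using edge_eq_Cons[OF IH, of a] 5 edge(2) by (simp add: arm_def)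
    also have "edge_eq K \<dots> (a # L @ ?E)" by (rule edge_eq_stutter)
    also have "edge_eq K \<dots> (a # b # a # L @ ?E)" by (rule equivclp_sym[OF edge_eq_backtrack[OF edge(1)]])
    finally show ?thesis using 5 vertices edge(2) by (simp add: s_simps arm_def)
  next
    case 6
    have "{a, d} \<notin> K" using no_neighbour[of d] 6 cd by auto
    moreover have "edge_eq K (a # b # ?M) (a # b # d # L @ ?E)"
      using edge_eq_Cons[OF edge_eq_Cons[OF IH, of b], of a] 6 by (simp add: arm_def)
    ultimately show ?thesis using 6 by (simp add: s_simps arm_def)
  qed
  then show ?case by simp
qed (simp add: walk_def)

lemma lift_triangle:
  assumes "{c, d, e} \<in> K'" shows "edge_eq K (lift [c, d, e]) (lift [c, e])"
proof (rule simplex'D[OF assms])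
  assume t: "{c, d, e} \<in> K"
  then have "{c, d} \<in> K" "{d, e} \<in> K" "{c, e} \<in> K" using complex_face[OF complex t] by auto
  then show ?thesis using edge_eq_triangle[OF t, of "[]"] by simp
next
  assume t: "a \<in> {c, d, e}" "insert b ({c, d, e} - {a}) \<in> K" "{c, d, e} \<noteq> {a}"
  \<comment> \<open>The triangle in \<open>K\<close> has \<open>b\<close> in the place of
    \<open>a\<close>. Each contracted edge lifts to the corresponding edge of that triangle, and
    \<open>post\<close> adds the step between \<open>a\<close> and \<open>b\<close> at an end equal
    to \<open>a\<close>.\<close>
  define r where "r x = (if x = a then b else x)" for x
  define post where "post x = (if x = a then [a] else [])" for x
  have rt: "{r c, r d, r e} = insert b ({c, d, e} - {a})" using t(1) by (auto simp: r_def)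
  have r: "{r c, r d, r e} \<in> K" unfolding rt by (rule t(2))
  define W where "W x y = post x @ [r x, r y] @ post y" for x y
  have lW: "edge_eq K (lift [x, y]) (W x y)" if xy: "x \<in> {c, d, e}" "y \<in> {c, d, e}" for x y
  proof -
    have bn: "{b, z} \<in> K" if "z \<in> {c, d, e}" "z \<noteq> a" for z
      by (rule complex_face[OF complex t(2)]) (use that in auto)
    have an: "{a, z} \<notin> K" if z: "z \<in> {c, d, e}" "z \<noteq> a" for z
    proof
      assume "{a, z} \<in> K"
      then have zb: "z = b" using no_neighbour[OF _ bn[OF z]] z by blast
      have "{z} \<in> K'" by (rule complex_face[OF complex' assms]) (use z in auto)
      then show False using vertex'D(2) zb by blast
    qed
    have xyK: "{x, y} \<in> K" if "x \<noteq> a" "y \<noteq> a"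
      by (rule complex_face[OF complex t(2)]) (use that xy in auto)
    consider "x = a" "y = a" | "x = a" "y \<noteq> a" | "x \<noteq> a" "y = a" | "x \<noteq> a" "y \<noteq> a" by blast
    then show ?thesis
    proof cases
      case 1
      then show ?thesis using vertices(1) edge_eq_same_simplex[OF complex edge(1), of "[a, a]" "[a, b, b, a]"]
        by (simp add: W_def post_def r_def)
    next
      case 2 then show ?thesis using an[OF xy(2)] by (simp add: W_def post_def r_def)
    next
      case 3
      then have "{x, a} \<notin> K" using an[OF xy(1)] by (simp add: insert_commute)
      with 3 show ?thesis by (simp add: W_def post_def r_def)
    next
      case 4 then show ?thesis using xyK by (simp add: W_def post_def r_def)
    qed
  qed
  have l: "lift [c, d, e] = lift [c, d] @ tl (lift [d, e])"
    using lift_path_join[of "[c, d]" "[d, e]" K b] by simp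
  have "edge_eq K (lift [c, d, e]) (W c d @ tl (W d e))"
    unfolding l by (rule edge_eq_join[OF lW lW]) simp_all
  also have "edge_eq K \<dots> (post c @ [r c, r d, r e] @ post e)"
  proof (cases "d = a")
    case True
    have "edge_eq K (b # a # b # r e # post e) (b # r e # post e)"
      using edge(1) by (intro edge_eq_backtrack) (simp add: insert_commute)
    from edge_eq_appendL[OF this, of "post c @ [r c]"] show ?thesis using True by (simp add: W_def post_def r_def)
  next
    case False then show ?thesis by (simp add: W_def post_def r_def)
  qed
  also have "edge_eq K \<dots> (post c @ [r c, r e] @ post e)"
    by (rule edge_eq_context[OF edge_eq_triangle[OF r, of "[]"]])
  also have "edge_eq K \<dots> (lift [c, e])" using equivclp_sym[OF lW[of c e]] by (simp add: W_def)
  finally show ?thesis .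
qed

text \<open>Lifting works edge by edge, so it splits at the end vertices of the replaced piece, and
  these stay the same.\<close>

lemma lift_replace:
  assumes "edge_eq K (lift m) (lift m')" "m \<noteq> []" "m' \<noteq> []" "hd m = hd m'" "last m = last m'"
  shows "edge_eq K (lift (u @ m @ v)) (lift (u @ m' @ v))"
proof -
  have split: "lift (u @ n @ v) = butlast (lift (u @ [hd n])) @ lift n @ tl (lift (last n # v))" if "n \<noteq> []" for n
  proof -
    have 1: "u @ n @ v = (u @ [hd n]) @ tl (n @ v)" using that by simp
    have 2: "n @ v = n @ tl (last n # v)" by simp
    have n: "lift (n @ v) = lift n @ tl (lift (last n # v))"
      by (subst 2, rule lift_path_join) (use that in simp_all)
    note ne = that
    obtain r where r: "lift (n @ v) = hd n # r"
      using ne lift_path_ends(1)[of "n @ v" K b] lift_path_ends(2)[of K b "n @ v"] by (cases "lift (n @ v)") simp_all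
    have b: "butlast (lift (u @ [hd n])) @ [hd n] = lift (u @ [hd n])"
      using append_butlast_last_id[of "lift (u @ [hd n])"] lift_path_ends(3)[of "u @ [hd n]" K b]
        lift_path_ends(1)[of "u @ [hd n]" K b] by simp
    have "lift (u @ n @ v) = lift (u @ [hd n]) @ tl (lift (n @ v))"
      by (subst 1, rule lift_path_join) (use that in simp_all)
    also have "\<dots> = (butlast (lift (u @ [hd n])) @ [hd n]) @ r" unfolding b r by simp
    also have "\<dots> = butlast (lift (u @ [hd n])) @ lift (n @ v)" unfolding r by simp
    finally show ?thesis using n by simp
  qed
  show ?thesis unfolding split[OF assms(2)] split[OF assms(3)] assms(4,5)
    by (rule edge_eq_context[OF assms(1)])
qed

lemma lift_step: "edge_step K' p q \<Longrightarrow> walk K' p \<Longrightarrow> edge_eq K (lift p) (lift q)"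
proof (cases rule: edge_step.cases, assumption)
  fix u c v assume pq: "p = u @ [c, c] @ v" "q = u @ [c] @ v" and p: "walk K' p"
  then have "{c} \<in> K" using vertex'D by (simp add: walk_def)
  then have "edge_eq K (lift [c, c]) (lift [c])" using edge_eq_stutter[of K c "[]"] by simp
  then show ?thesis unfolding pq by (rule lift_replace) simp_all
next
  fix u c d e v assume pq: "p = u @ [c, d, e] @ v" "q = u @ [c, e] @ v" and t: "{c, d, e} \<in> K'"
  show ?thesis unfolding pq by (rule lift_replace[OF lift_triangle[OF t]]) simp_all
qed

lemma lift_eq:
  assumes "edge_eq K' p q" "walk K' p" shows "edge_eq K (lift p) (lift q)"
  using assms(1)
proof (induction rule: equivclp_induct)
  case (step y z)
  have "walk K' y" "walk K' z" using step(1,2) assms(2) walk_edge_eq[OF complex'] walk_edge_step[OF complex'] by metis+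
  then have "edge_eq K (lift y) (lift z)" using step(2) lift_step equivclp_sym by metis
  then show ?case using step.IH edge_eq_trans by metis
qed simp

lemma edge_group_iso:
  assumes v: "{v} \<in> K" "v \<noteq> b" shows "edge_group K v \<cong> edge_group K' v"
proof -
  have sv: "s v = v" using v by (simp add: s_simps)
  have "edge_group K v \<cong> edge_group K' (s v)"
  proof (rule edge_group_iso_map[OF complex v(1) complex' s_image, where g = lift], unfold sv)
    fix p assume p: "p \<in> walks K' v v"
    note D = walksD[OF p]
    show "edge_eq K (lift p) (lift q)" if "edge_eq K' p q" for q by (rule lift_eq[OF that D(2)])
    show "lift p \<in> walks K v v" using D by (intro walksI lift_walk) simp_all
    show "edge_eq K' (map s (lift p)) p" by (rule map_lift[OF D(2)])
  next
    fix p assume p: "p \<in> walks K v v"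
    show "edge_eq K (lift (map s p)) p" using lift_map[OF walksD(2)[OF p]] walksD[OF p] v(2) by (simp add: arm_def)
  qed
  then show ?thesis by (simp add: sv)
qed

lemma edge_connected':
  assumes "edge_connected K v" "v \<noteq> b" shows "edge_connected K' v"
  unfolding edge_connected_def
proof (intro conjI allI impI)
  have v: "{v} \<in> K" "s v = v" using assms by (simp_all add: edge_connected_def s_simps)
  then show "{v} \<in> K'" using s_image[OF v(1)] by simp
  fix c assume "{c} \<in> K'"
  then have c: "{c} \<in> K" "s c = c" using vertex'D[of c] by (simp_all add: s_simps)
  then obtain L where "L \<in> walks K v c" using assms(1) by (auto simp: edge_connected_def)
  then have "map s L \<in> walks K' v c" using walks_map[OF s_image, where p = L and a = v and b = c] v c by simp
  then show "walks K' v c \<noteq> {}" by blast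
qed

lemma card_image_s: "t \<in> K \<Longrightarrow> card (s ` t) \<le> card t"
  by (rule card_image_le[OF finite_simplex[OF complex]])

lemma dim': "dim_at_most K d \<Longrightarrow> dim_at_most K' d"
  unfolding dim_at_most_def
proof (intro allI impI)
  fix n assume K: "\<forall>n>d. simplices_of_dim n K = {}" and n: "d < n"
  show "simplices_of_dim n K' = {}"
  proof (rule ccontr)
    assume "simplices_of_dim n K' \<noteq> {}"
    then obtain t where t: "t \<in> K" "card (s ` t) = Suc n" by (auto simp: simplices_of_dim_def K'_def)
    then have "n \<le> card t - 1" "card t = Suc (card t - 1)" using card_image_s[OF t(1)] by simp_all
    then have "t \<in> simplices_of_dim (card t - 1) K" "d < card t - 1" using t n by (simp_all add: simplices_of_dim_def)
    then show False using K by blast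
  qed
qed

text \<open>Images do not gain dimension, so a simplex of the top dimension \<open>d\<close> is the
  image of a simplex of the same dimension.\<close>

lemma card_simplices':
  assumes "dim_at_most K d" shows "card (simplices_of_dim d K') \<le> card (simplices_of_dim d K)"
proof -
  have fin: "finite (simplices_of_dim d K)" using complex by (simp add: simplices_of_dim_def finite_complex_def)
  have "simplices_of_dim d K' \<subseteq> (`) s ` simplices_of_dim d K"
  proof
    fix u assume "u \<in> simplices_of_dim d K'"
    then obtain t where t: "t \<in> K" "u = s ` t" "card (s ` t) = Suc d" by (auto simp: simplices_of_dim_def K'_def)
    have "\<not> Suc d < card t"
    proof
      assume "Suc d < card t"
      then have "t \<in> simplices_of_dim (card t - 1) K" "d < card t - 1" using t by (simp_all add: simplices_of_dim_def)
      then show False using assms by (auto simp: dim_at_most_def)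
    qed
    then have "card t = Suc d" using card_image_s[OF t(1)] t(3) by simp
    then show "u \<in> (`) s ` simplices_of_dim d K" using t by (auto simp: simplices_of_dim_def)
  qed
  then have "card (simplices_of_dim d K') \<le> card ((`) s ` simplices_of_dim d K)" by (intro card_mono) (use fin in simp_all)
  also have "\<dots> \<le> card (simplices_of_dim d K)" by (rule card_image_le[OF fin])
  finally show ?thesis .
qed

text \<open>Strictness comes from the vertices \<open>{a}\<close> and \<open>{b}\<close>, which have
  the same image.\<close>

lemma card': "card K' < card K"
proof -
  have fin: "finite K" using complex by (simp add: finite_complex_def)
  have "s ` {a} = s ` {b}" by (simp add: s_def)
  then have "\<not> inj_on ((`) s) K" using inj_onD[OF _ _ vertices, of "(`) s"] edge(2) by auto
  then have "card K' \<noteq> card K" unfolding K'_def using eq_card_imp_inj_on[OF fin, of "(`) s"] by metis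
  moreover have "card K' \<le> card K" unfolding K'_def by (rule card_image_le[OF fin])
  ultimately show ?thesis by simp
qed

end

section \<open>Minimal complexes\<close>

text \<open>The detour a, d, b replaces the deleted edge in every walk.\<close>

lemma edge_connected_remove_edge:
  assumes K: "finite_complex K" and ab: "\<And>s. s \<in> K \<Longrightarrow> {a, b} \<subseteq> s \<Longrightarrow> s = {a, b}" "a \<noteq> b"
    and d: "{a, d} \<in> K" "{b, d} \<in> K" "d \<noteq> a" "d \<noteq> b" and conn: "edge_connected K v"
  shows "edge_connected (K - {{a, b}}) v"
proof -
  define K0 where "K0 = K - {{a, b}}"
  have K0: "finite_complex K0" unfolding K0_def by (rule finite_complex_remove_edge[OF K ab(1)])
  have vert: "{c} \<in> K0" if "{c} \<in> K" for c using that ab(2) by (auto simp: K0_def)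
  have "{a, d} \<noteq> {a, b}" "{d, b} \<noteq> {a, b}" using d by (auto simp: doubleton_eq_iff)
  then have "{a, d} \<in> K0" "{d, b} \<in> K0" using d by (simp_all add: K0_def insert_commute)
  then have W: "[a, d] @ tl [d, b] \<in> walks K0 a b" by (intro walks_join[of _ _ _ d] walks_edge K0)
  have edge: "walks K0 x y \<noteq> {}" if "{x, y} \<in> K" for x y
  proof (cases "{x, y} = {a, b}")
    case True
    then have "(x = a \<and> y = b) \<or> (x = b \<and> y = a)" by (simp add: doubleton_eq_iff)
    then show ?thesis using W walks_rev[OF W] by blast
  next
    case False
    then have "{x, y} \<in> K0" using that by (simp add: K0_def)
    then show ?thesis using walks_edge[OF K0] by blast
  qed
  have reach: "walk K L \<Longrightarrow> walks K0 (hd L) (last L) \<noteq> {}" for L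
  proof (induction L rule: induct_list012)
    case (2 c) then show ?case using walks_single[OF vert, of c] by (auto simp: walk_single)
  next
    case (3 c d L)
    then have w: "walk K (d # L)" and cd: "{c, d} \<in> K" by (simp_all add: walk_Cons_Cons[OF K])
    obtain M where "M \<in> walks K0 d (last (d # L))" using 3(2)[OF w] by auto
    moreover obtain N where "N \<in> walks K0 c d" using edge[OF cd] by blast
    ultimately have "N @ tl M \<in> walks K0 c (last (d # L))" using walks_join by metis
    then show ?case by auto
  qed (simp add: walk_def)
  show ?thesis unfolding edge_connected_def K0_def[symmetric]
  proof (intro conjI allI impI)
    show "{v} \<in> K0" using conn vert by (simp add: edge_connected_def)
    fix c assume "{c} \<in> K0"
    then have "{c} \<in> K" by (simp add: K0_def)
    then obtain L where "L \<in> walks K v c" using conn by (auto simp: edge_connected_def)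
    then show "walks K0 v c \<noteq> {}" using reach[of L] walksD[of L K v c] by auto
  qed
qed

text \<open>The number of triangles is only bounded, because contractions may lower it while the
  total number of simplices is being minimized.\<close>

definition realizes :: "nat \<Rightarrow> 'g monoid \<Rightarrow> nat set set \<Rightarrow> nat \<Rightarrow> bool" where
  "realizes T G K v \<longleftrightarrow> finite_complex K \<and> dim_at_most K 2 \<and> edge_connected K v \<and>
     card (simplices_of_dim 2 K) \<le> T \<and> edge_group K v \<cong> G"

lemma simplicial_complexity_le_iff:
  "simplicial_complexity G \<le> enat T \<longleftrightarrow> (\<exists>K v. realizes T G K v)"
proof
  assume "simplicial_complexity G \<le> enat T"
  \<comment> \<open>A strict bound on the infimum provides a complex below it.\<close>
  also have "enat T < enat (Suc T)" by simp
  finally obtain K :: "nat set set" where "finite_complex K" "dim_at_most K 2" "connected (realization K)"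
    "\<exists>x\<in>realization K. fundamental_group (realization K) x \<cong> G" and "enat (card (simplices_of_dim 2 K)) < enat (Suc T)"
    unfolding simplicial_complexity_def INF_less_iff by blast
  then obtain x where K: "finite_complex K" "dim_at_most K 2" "connected (realization K)" "card (simplices_of_dim 2 K) \<le> T"
    and x: "x \<in> realization K" "fundamental_group (realization K) x \<cong> G" by auto
  have sx: "supp x \<in> K" by (rule supp_realization[OF x(1)])
  then have "supp x \<noteq> {}" using K(1) by (auto simp: finite_complex_def)
  then obtain v where v: "v \<in> supp x" by blast
  then have vK: "{v} \<in> K" using complex_face[OF K(1) sx] by simp
  have "edge_group K v \<cong> fundamental_group (realization K) (vertex v)" by (rule edge_group_iso_fundamental_group[OF K(1) vK])
  also have "\<dots> \<cong> fundamental_group (realization K) x"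
    by (rule fundamental_group_base_change[OF paths_in_rev[OF path_to_vertex[OF K(1) x(1) v]]])
  also note x(2)
  finally show "\<exists>K v. realizes T G K v"
    using K edge_connected_if_connected[OF K(1,3) vK] unfolding realizes_def by blast
next
  assume "\<exists>K v. realizes T G K v"
  then obtain K :: "nat set set" and v where K: "finite_complex K" "dim_at_most K 2" "edge_connected K v" "card (simplices_of_dim 2 K) \<le> T"
    "edge_group K v \<cong> G" by (auto simp: realizes_def)
  have v: "{v} \<in> K" using K(3) by (simp add: edge_connected_def)
  have "fundamental_group (realization K) (vertex v) \<cong> edge_group K v"
    by (rule group.iso_sym[OF group_edge_group[OF K(1) v] edge_group_iso_fundamental_group[OF K(1) v]])
  then have "fundamental_group (realization K) (vertex v) \<cong> G" using K(5) by (rule iso_trans)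
  then have "simplicial_complexity G \<le> enat (card (simplices_of_dim 2 K))"
    unfolding simplicial_complexity_def
    using K connected_realization[OF K(1,3)] vertex_realization[OF K(1) v] by (intro INF_lower) blast
  also have "\<dots> \<le> enat T" using K(4) by simp
  finally show "simplicial_complexity G \<le> enat T" .
qed

lemma realizes_contract:
  assumes "realizes T G K v" and ab: "{a, b} \<in> K" "a \<noteq> b" "\<And>t. t \<in> K \<Longrightarrow> {a, b} \<subseteq> t \<Longrightarrow> t = {a, b}"
    and nb: "\<And>d. {a, d} \<in> K \<Longrightarrow> {b, d} \<in> K \<Longrightarrow> d = a \<or> d = b" and v: "v \<noteq> b"
  shows "\<exists>K'. realizes T G K' v \<and> card K' < card K"
proof -
  have K: "finite_complex K" "dim_at_most K 2" "edge_connected K v" "card (simplices_of_dim 2 K) \<le> T" "edge_group K v \<cong> G"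
    using assms(1) by (auto simp: realizes_def)
  have vK: "{v} \<in> K" using K(3) by (simp add: edge_connected_def)
  define s where "s = (\<lambda>x. if x = b then a else x)"
  define K' where "K' = (`) s ` K"
  interpret contraction K a b s K'
  proof unfold_locales
    show "s \<equiv> \<lambda>x. if x = b then a else x" by (rule eq_reflection[OF s_def])
    show "K' \<equiv> (`) s ` K" by (rule eq_reflection[OF K'_def])
  qed (fact K(1) ab nb)+
  have "edge_group K' v \<cong> edge_group K v"
    by (rule group.iso_sym[OF group_edge_group[OF K(1) vK] edge_group_iso[OF vK v]])
  then have "edge_group K' v \<cong> G" using K(5) by (rule iso_trans)
  then have "realizes T G K' v"
    using complex' dim'[OF K(2)] edge_connected'[OF K(3) v] card_simplices'[OF K(2)] K(4) by (simp add: realizes_def)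
  then show ?thesis using card' by blast
qed

section \<open>Complexes with the least number of simplices\<close>

lemma countable_edge_group: "countable (carrier (edge_group (K :: nat set set) v))"
  unfolding edge_group_carrier by (intro countable_image) simp

lemma realizes_minimal:
  fixes G :: "nat monoid"
  assumes G: "group G" "\<not> has_integer_free_factor G" and ex: "\<exists>K v. realizes T G K v"
  obtains K v where "realizes T G K v"
    "\<And>a b. {a, b} \<in> K \<Longrightarrow> a \<noteq> b \<Longrightarrow> \<exists>t\<in>simplices_of_dim 2 K. {a, b} \<subseteq> t"
proof -
  obtain z where z: "case z of (K, v) \<Rightarrow> realizes T G K v"
    and min: "\<And>z'. (case z' of (K, v) \<Rightarrow> realizes T G K v) \<Longrightarrow> card (fst z) \<le> card (fst z')"
  proof -
    obtain z0 where "case z0 of (K, v) \<Rightarrow> realizes T G K v" using ex by auto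
    from ex_has_least_nat[of "\<lambda>z. case z of (K, v) \<Rightarrow> realizes T G K v", OF this, of "\<lambda>z. card (fst z)"]
    show thesis using that by blast
  qed
  obtain K v where zKv: "z = (K, v)" by (cases z)
  have R: "realizes T G K v" using z zKv by simp
  have min: "card K \<le> card K'" if "realizes T G K' v'" for K' v' using min[of "(K', v')"] that zKv by simp
  have K: "finite_complex K" "dim_at_most K 2" "edge_connected K v" "edge_group K v \<cong> G"
    using R by (auto simp: realizes_def)
  show thesis
  proof (rule that[OF R], rule ccontr)
    fix a b assume ab: "{a, b} \<in> K" "a \<noteq> b" and no: "\<not> (\<exists>t\<in>simplices_of_dim 2 K. {a, b} \<subseteq> t)"
    have nt: "t = {a, b}" if t: "t \<in> K" "{a, b} \<subseteq> t" for t
    proof (rule ccontr)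
      assume "t \<noteq> {a, b}"
      then obtain c where c: "c \<in> t" "c \<notin> {a, b}" using t by blast
      have "{a, b, c} \<in> K" using t c by (intro complex_face[OF K(1) t(1)]) auto
      moreover have "card {a, b, c} = Suc 2" using ab(2) c by auto
      ultimately have "{a, b, c} \<in> simplices_of_dim 2 K" by (simp add: simplices_of_dim_def)
      then show False using no by blast
    qed
    show False
    proof (cases "\<exists>d. {a, d} \<in> K \<and> {b, d} \<in> K \<and> d \<noteq> a \<and> d \<noteq> b")
      case True
      then obtain d where d: "{a, d} \<in> K" "{b, d} \<in> K" "d \<noteq> a" "d \<noteq> b" by blast
      have conn: "edge_connected (K - {{a, b}}) v" by (rule edge_connected_remove_edge[OF K(1) nt ab(2) d K(3)])
      have fc: "finite_complex (K - {{a, b}})" by (rule finite_complex_remove_edge[OF K(1) nt])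
      have v0: "{v} \<in> K - {{a, b}}" using conn by (simp add: edge_connected_def)
      obtain H :: "nat monoid" where H: "group H" "edge_group (K - {{a, b}}) v \<cong> H"
        using countable_group_nat[OF group_edge_group[OF fc v0] countable_edge_group] by blast
      have E: "edge_group K v \<cong> free_product H integer_group"
        by (rule edge_group_free_factor[OF K(1) ab nt conn H])
      have "G \<cong> edge_group K v"
        using group.iso_sym[OF group_edge_group[OF K(1)] K(4)] K(3) by (simp add: edge_connected_def)
      then have "G \<cong> free_product H integer_group" using E by (rule iso_trans)
      then show False using G(2) H(1) unfolding has_integer_free_factor_def by blast
    next
      case False
      then have nb: "d = a \<or> d = b" if "{a, d} \<in> K" "{b, d} \<in> K" for d using that by blast
      show False
      proof (cases "v = b")
        case False
        then show False using realizes_contract[OF R ab nt nb] min by (meson not_le)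
      next
        case True
        \<comment> \<open>The base point has to survive the contraction, so \<open>a\<close> and
          \<open>b\<close> exchange their roles.\<close>
        then have va: "v \<noteq> a" using ab(2) by simp
        have "{b, a} \<in> K" "b \<noteq> a" using ab by (simp_all add: insert_commute)
        moreover have "t = {b, a}" if "t \<in> K" "{b, a} \<subseteq> t" for t using nt[OF that(1)] that(2) by (simp add: insert_commute)
        moreover have "d = b \<or> d = a" if "{b, d} \<in> K" "{a, d} \<in> K" for d using nb[OF that(2,1)] by blast
        ultimately show False using realizes_contract[OF R _ _ _ _ va] min by (meson not_le)
      qed
    qed
  qed
qed

section \<open>Counting\<close>

text \<open>The base vertex is inserted separately for the family without triangles, which has to
  generate a single point.\<close>

definition generated :: "nat set set \<Rightarrow> nat \<Rightarrow> nat set set" where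
  "generated L v = insert {v} {s. s \<noteq> {} \<and> (\<exists>t\<in>L. s \<subseteq> t)}"

lemma generated_image: "(`) f ` generated L v = generated ((`) f ` L) (f v)"
proof
  show "(`) f ` generated L v \<subseteq> generated ((`) f ` L) (f v)" unfolding generated_def by blast
  show "generated ((`) f ` L) (f v) \<subseteq> (`) f ` generated L v"
  proof
    fix s assume "s \<in> generated ((`) f ` L) (f v)"
    then consider "s = f ` {v}" | t where "s \<noteq> {}" "t \<in> L" "s \<subseteq> f ` t" unfolding generated_def by auto
    then show "s \<in> (`) f ` generated L v"
    proof cases
      case 1 then show ?thesis by (simp add: generated_def)
    next
      case 2
      then obtain r where r: "r \<subseteq> t" "s = f ` r" by (auto simp: subset_image_iff)
      then have "r \<in> generated L v" using 2 unfolding generated_def by blast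
      then show ?thesis using r(2) by blast
    qed
  qed
qed

lemma walk_last_edge:
  assumes K: "finite_complex K"
  shows "walk K L \<Longrightarrow> hd L \<noteq> last L \<Longrightarrow> \<exists>x. x \<noteq> last L \<and> {x, last L} \<in> K"
proof (induction L rule: induct_list012)
  case (3 c d L)
  then have w: "walk K (d # L)" and cd: "{c, d} \<in> K" by (simp_all add: walk_Cons_Cons[OF K])
  show ?case
  proof (cases "d = last (d # L)")
    case True
    then have "last (c # d # L) = d" by simp
    then show ?thesis using 3(4) cd by (intro exI[of _ c]) simp
  next
    case False then show ?thesis using 3(2)[OF w] by simp
  qed
qed (simp_all add: walk_def)

text \<open>A vertex other than \<open>v\<close> is the end of a walk from \<open>v\<close>, hence
  it lies on an edge and therefore in a triangle.\<close>

lemma complex_generated: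
  assumes K: "finite_complex K" "dim_at_most K 2" "edge_connected K v"
    and e: "\<And>a b. {a, b} \<in> K \<Longrightarrow> a \<noteq> b \<Longrightarrow> \<exists>t\<in>simplices_of_dim 2 K. {a, b} \<subseteq> t"
  shows "K = generated (simplices_of_dim 2 K) v"
proof
  show "generated (simplices_of_dim 2 K) v \<subseteq> K"
    using K(3) complex_face[OF K(1)] unfolding generated_def edge_connected_def simplices_of_dim_def by blast
  show "K \<subseteq> generated (simplices_of_dim 2 K) v"
  proof
    fix s assume s: "s \<in> K"
    have ne: "s \<noteq> {}" and fin: "finite s" using s K(1) by (simp_all add: finite_complex_def)
    have "\<not> 3 < card s"
    proof
      assume "3 < card s"
      then have "s \<in> simplices_of_dim (card s - 1) K" "2 < card s - 1" using s by (simp_all add: simplices_of_dim_def)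
      then show False using K(2) by (auto simp: dim_at_most_def)
    qed
    moreover have "card s \<noteq> 0" using ne fin by simp
    ultimately consider "card s = 1" | "card s = 2" | "card s = 3" by linarith
    then show "s \<in> generated (simplices_of_dim 2 K) v"
    proof cases
      case 1
      then obtain c where c: "s = {c}" by (rule card_1_singletonE)
      show ?thesis
      proof (cases "c = v")
        case True then show ?thesis using c by (simp add: generated_def)
      next
        case False
        obtain L where L: "L \<in> walks K v c" using K(3) c s by (auto simp: edge_connected_def)
        obtain x where "x \<noteq> c" "{x, c} \<in> K"
          using walk_last_edge[OF K(1) walksD(2)[OF L]] walksD(3,4)[OF L] False by auto
        then obtain t where "t \<in> simplices_of_dim 2 K" "{x, c} \<subseteq> t" using e by blast
        then show ?thesis using c by (auto simp: generated_def)
      qed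
    next
      case 2
      then obtain a b where "s = {a, b}" "a \<noteq> b" by (auto simp: card_2_iff)
      then show ?thesis using e s ne by (auto simp: generated_def)
    next
      case 3
      then have "s \<in> simplices_of_dim 2 K" using s by (simp add: simplices_of_dim_def)
      then show ?thesis using ne by (auto simp: generated_def)
    qed
  qed
qed

definition triples :: "nat \<Rightarrow> nat set set" where
  "triples T = {t. t \<subseteq> {..3 * T} \<and> card t = 3}"

text \<open>Recovers an isomorphism class from the triangles alone, with base point 0, so that
  families of triples can be counted in place of groups.\<close>

definition class_of_triples :: "nat set set \<Rightarrow> nat monoid set" where
  "class_of_triples L = {H. group H \<and> edge_group (generated L 0) 0 \<cong> H}"

lemma group_class_of_triples:
  assumes "C \<in> groups_of_complexity T"
  shows "\<exists>L. L \<subseteq> triples T \<and> card L \<le> T \<and> C = class_of_triples L"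
proof -
  obtain G :: "nat monoid" where G: "group G" "has_free_index G 0" "simplicial_complexity G \<le> enat T" "C = iso_class G"
    using assms by (auto simp: groups_of_complexity_def)
  obtain K v where R: "realizes T G K v"
    and e: "\<And>a b. {a, b} \<in> K \<Longrightarrow> a \<noteq> b \<Longrightarrow> \<exists>t\<in>simplices_of_dim 2 K. {a, b} \<subseteq> t"
    using realizes_minimal[OF G(1)] G(2,3) has_free_index_0_iff[OF G(1)] simplicial_complexity_le_iff by metis
  have K: "finite_complex K" "dim_at_most K 2" "edge_connected K v" "card (simplices_of_dim 2 K) \<le> T" "edge_group K v \<cong> G"
    using R by (auto simp: realizes_def)
  define L where "L = simplices_of_dim 2 K"
  have gen: "K = generated L v" unfolding L_def by (rule complex_generated[OF K(1-3) e])
  have finL: "finite L" using K(1) by (simp add: L_def simplices_of_dim_def finite_complex_def)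
  have card3: "card t = 3" "finite t" if "t \<in> L" for t
    using that K(1) by (simp_all add: L_def simplices_of_dim_def finite_complex_def)
  have UK: "\<Union>K = insert v (\<Union>L)"
  proof
    show "\<Union>K \<subseteq> insert v (\<Union>L)" unfolding gen generated_def by blast
    have "t \<in> K" if "t \<in> L" for t using that by (simp add: L_def simplices_of_dim_def)
    then show "insert v (\<Union>L) \<subseteq> \<Union>K" using K(3) unfolding edge_connected_def by blast
  qed
  have finU: "finite (\<Union>L)" using finL card3 by blast
  have "card (\<Union>L) \<le> (\<Sum>t\<in>L. card t)" by (rule card_Union_le_sum_card)
  also have "\<dots> = 3 * card L" using card3 by simp
  also have "\<dots> \<le> 3 * T" using K(4) by (simp add: L_def)
  finally have cU: "card (\<Union>L) \<le> 3 * T" .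
  \<comment> \<open>The base point is renamed 0 whether or not it lies in a triangle. At most
    \<open>3 * T\<close> other vertices remain, and they receive positive numbers.\<close>
  define M where "M = \<Union>L - {v}"
  have finM: "finite M" and cM: "card M \<le> 3 * T" using finU cU card_Diff1_le[of "\<Union>L" v] by (simp_all add: M_def)
  obtain h where h: "bij_betw h M {0..<card M}" using ex_bij_betw_finite_nat[OF finM] by blast
  define f where "f x = (if x = v then 0 else Suc (h x))" for x
  have f_le: "f x \<le> 3 * T" if "x \<in> \<Union>L" for x
  proof (cases "x = v")
    case False
    then have "x \<in> M" using that unfolding M_def by blast
    then have "h x \<in> {0..<card M}" by (rule bij_betwE[OF h, rule_format])
    then show ?thesis using False cM by (simp add: f_def)
  qed (simp add: f_def)
  have "inj_on h M" "v \<notin> M" using bij_betw_imp_inj_on[OF h] by (simp_all add: M_def)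
  then have "inj_on f (insert v M)" by (auto simp: inj_on_def f_def)
  moreover have "insert v M = \<Union>K" unfolding UK M_def by blast
  ultimately have inj: "inj_on f (\<Union>K)" by simp
  have fv: "f v = 0" by (simp add: f_def)
  define L' where "L' = (`) f ` L"
  have K': "(`) f ` K = generated L' 0" unfolding gen L'_def generated_image fv ..
  have "L' \<subseteq> triples T"
  proof
    fix u assume "u \<in> L'"
    then obtain t where t: "t \<in> L" "u = f ` t" by (auto simp: L'_def)
    have "inj_on f t" by (rule inj_on_subset[OF inj]) (use t UK in blast)
    then have "card u = 3" using t card3 by (simp add: card_image)
    moreover have "u \<subseteq> {..3 * T}" using t f_le by auto
    ultimately show "u \<in> triples T" by (simp add: triples_def)
  qed
  moreover have "card L' \<le> T" using card_image_le[OF finL, of "(`) f"] K(4) by (simp add: L'_def L_def)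
  moreover have "C = class_of_triples L'"
  proof -
    have v: "{v} \<in> K" using K(3) by (simp add: edge_connected_def)
    have iso: "edge_group K v \<cong> edge_group (generated L' 0) 0"
      using edge_group_relabel[OF K(1) v inj] unfolding K' fv .
    interpret E: group "edge_group K v" by (rule group_edge_group[OF K(1) v])
    have f0: "{0} \<in> generated L' 0" by (simp add: generated_def)
    have fc: "finite_complex (generated L' 0)" using finite_complex_image[OF K(1), of f] unfolding K' .
    interpret E': group "edge_group (generated L' 0) 0" by (rule group_edge_group[OF fc f0])
    have EG: "edge_group (generated L' 0) 0 \<cong> G" using E.iso_sym[OF iso] K(5) by (rule iso_trans)
    have GE: "G \<cong> edge_group (generated L' 0) 0" by (rule E'.iso_sym[OF EG])
    have "G \<cong> H \<longleftrightarrow> edge_group (generated L' 0) 0 \<cong> H" for H :: "nat monoid"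
      using iso_trans[OF EG, of H] iso_trans[OF GE, of H] by blast
    then show ?thesis unfolding G(4) iso_class_def class_of_triples_def by simp
  qed
  ultimately show ?thesis by blast
qed

section \<open>Counting families of triples\<close>

lemma card_small_subsets:
  assumes A: "finite A" "{} \<notin> A"
  shows "finite {L. L \<subseteq> A \<and> card L \<le> T}" "card {L. L \<subseteq> A \<and> card L \<le> T} \<le> (card A + 1) ^ T"
proof -
  \<comment> \<open>A set with at most \<open>T\<close> members is listed and padded to length
    \<open>T\<close> with \<open>{}\<close>, which is not in \<open>A\<close>; this is the origin of
    the added one.\<close>
  let ?X = "{xs. set xs \<subseteq> insert {} A \<and> length xs = T}"
  have finX: "finite ?X" by (rule finite_lists_length_eq) (use A in simp)
  have sub: "{L. L \<subseteq> A \<and> card L \<le> T} \<subseteq> (\<lambda>xs. set xs - {{}}) ` ?X"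
  proof
    fix L assume "L \<in> {L. L \<subseteq> A \<and> card L \<le> T}"
    then have L: "L \<subseteq> A" "card L \<le> T" by simp_all
    then obtain l where l: "set l = L" "distinct l" using finite_distinct_list[of L] finite_subset[OF _ A(1)] by blast
    then have len: "length l \<le> T" using L(2) distinct_card[OF l(2)] by simp
    define xs where "xs = l @ replicate (T - length l) {}"
    have "xs \<in> ?X" using l L(1) len by (auto simp: xs_def)
    moreover have "set xs - {{}} = L" using l L(1) A(2) by (auto simp: xs_def)
    ultimately show "L \<in> (\<lambda>xs. set xs - {{}}) ` ?X" by blast
  qed
  show "finite {L. L \<subseteq> A \<and> card L \<le> T}" by (rule finite_subset[OF sub finite_imageI[OF finX]])
  have "card {L. L \<subseteq> A \<and> card L \<le> T} \<le> card ((\<lambda>xs. set xs - {{}}) ` ?X)" by (rule card_mono[OF finite_imageI[OF finX] sub])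
  also have "\<dots> \<le> card ?X" by (rule card_image_le[OF finX])
  also have "\<dots> = (card A + 1) ^ T" using A by (subst card_lists_length_eq) simp_all
  finally show "card {L. L \<subseteq> A \<and> card L \<le> T} \<le> (card A + 1) ^ T" .
qed

text \<open>The number of triples is at most 9/2 times \<open>T ^ 3\<close>. Since
  \<open>T ^ 3\<close> is at least 8, the bound \<open>T ^ 6\<close> is at least 8 times
  \<open>T ^ 3\<close>, which leaves room for the added one.\<close>

lemma card_triples_less:
  assumes "2 \<le> T" shows "card (triples T) + 1 \<le> T ^ 6"
proof -
  have "card (triples T) = (3 * T + 1) choose 3"
    using n_subsets[of "{..3 * T}" 3] by (simp add: triples_def)
  moreover have "6 * ((3 * T + 1) choose 3) = (3 * T + 1) * (3 * T) * (3 * T - 1)"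
  proof -
    obtain m where m: "3 * T = Suc m" using assms by (cases "3 * T") auto
    have "Suc (Suc m) * (Suc m choose 2) = (Suc (Suc m) choose 3) * 3"
      using Suc_times_binomial_eq[of "Suc m" 2] by (simp add: numeral_3_eq_3)
    moreover have "Suc m * (m choose 1) = (Suc m choose 2) * 2"
      using Suc_times_binomial_eq[of m 1] by (simp add: numeral_2_eq_2)
    ultimately have "6 * (Suc (Suc m) choose 3) = Suc (Suc m) * Suc m * m" by (simp add: algebra_simps)
    then show ?thesis using m by simp
  qed
  ultimately have "6 * card (triples T) = (3 * T + 1) * (3 * T) * (3 * T - 1)" by simp
  also have "\<dots> \<le> 27 * T ^ 3"
  proof -
    obtain m where m: "3 * T = Suc m" using assms by (cases "3 * T") auto
    have "(Suc m + 1) * m \<le> Suc m * Suc m" by simp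
    then have "(3 * T + 1) * (3 * T - 1) \<le> (3 * T) * (3 * T)" unfolding m by simp
    then have "(3 * T) * ((3 * T + 1) * (3 * T - 1)) \<le> (3 * T) * ((3 * T) * (3 * T))" by (rule mult_le_mono2)
    moreover have "(3 * T) * ((3 * T) * (3 * T)) = 27 * T ^ 3" by (simp add: power3_eq_cube)
    moreover have "(3 * T) * ((3 * T + 1) * (3 * T - 1)) = (3 * T + 1) * (3 * T) * (3 * T - 1)" by (simp only: ac_simps)
    ultimately show ?thesis by metis
  qed
  finally have c: "6 * card (triples T) \<le> 27 * T ^ 3" .
  have "2 ^ 3 \<le> T ^ 3" by (rule power_mono) (use assms in simp_all)
  then have t: "8 \<le> T ^ 3" by simp
  then have "8 * T ^ 3 \<le> T ^ 3 * T ^ 3" by (rule mult_le_mono1)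
  then have "8 * T ^ 3 \<le> T ^ 6" by (simp flip: power_add)
  then show ?thesis using c t by linarith
qed

theorem card_groups_of_complexity:
  assumes "2 \<le> T"
  shows "finite (groups_of_complexity T)" "card (groups_of_complexity T) \<le> T ^ (6 * T)"
proof -
  let ?S = "{L. L \<subseteq> triples T \<and> card L \<le> T}"
  have fin: "finite (triples T)" unfolding triples_def by (rule finite_subset[of _ "Pow {..3 * T}"]) auto
  have ne: "{} \<notin> triples T" by (simp add: triples_def)
  have sub: "groups_of_complexity T \<subseteq> class_of_triples ` ?S" using group_class_of_triples by blast
  note S = card_small_subsets[OF fin ne, of T]
  show "finite (groups_of_complexity T)" by (rule finite_subset[OF sub finite_imageI[OF S(1)]])
  have "card (groups_of_complexity T) \<le> card (class_of_triples ` ?S)" by (rule card_mono[OF finite_imageI[OF S(1)] sub])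
  also have "\<dots> \<le> card ?S" by (rule card_image_le[OF S(1)])
  also have "\<dots> \<le> (card (triples T) + 1) ^ T" by (rule S(2))
  also have "\<dots> \<le> (T ^ 6) ^ T" by (rule power_mono[OF card_triples_less[OF assms]]) simp
  finally show "card (groups_of_complexity T) \<le> T ^ (6 * T)" by (simp add: power_mult)
qed

section \<open>Complexes with cyclic fundamental group\<close>

text \<open>All vertices are joined to the base point \<open>0\<close>, so that an edge from \<open>a\<close> to \<open>b\<close> closes up to the
  loop \<open>[0, a, b, 0]\<close>. The label \<open>w a b\<close> is the exponent of this loop as a power of the loop
  \<open>[0, 1, 2, 0]\<close>.\<close>

definition labelled :: "nat set set \<Rightarrow> (nat \<Rightarrow> nat \<Rightarrow> int) \<Rightarrow> nat \<Rightarrow> bool" where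
  "labelled K w t \<longleftrightarrow> finite_complex K \<and> dim_at_most K 2 \<and> card (simplices_of_dim 2 K) \<le> t \<and>
     {0} \<in> K \<and> (\<forall>a. {a} \<in> K \<longrightarrow> {0, a} \<in> K \<and> w 0 a = 0) \<and> cocycle integer_group K w \<and>
     {1, 2} \<in> K \<and> w 1 2 = 1 \<and>
     (\<forall>a b. {a, b} \<in> K \<longrightarrow>
        edge_class K [0, a, b, 0] = edge_class K [0, 1, 2, 0] [^]\<^bsub>edge_group K 0\<^esub> w a b)"

lemma labelledD:
  assumes "labelled K w t"
  shows "finite_complex K" "dim_at_most K 2" "card (simplices_of_dim 2 K) \<le> t" "{0} \<in> K"
    "\<And>a. {a} \<in> K \<Longrightarrow> {0, a} \<in> K" "\<And>a. {a} \<in> K \<Longrightarrow> w 0 a = 0" "cocycle integer_group K w"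
    "{1, 2} \<in> K" "w 1 2 = 1"
    "\<And>a b. {a, b} \<in> K \<Longrightarrow>
        edge_class K [0, a, b, 0] = edge_class K [0, 1, 2, 0] [^]\<^bsub>edge_group K 0\<^esub> w a b"
  using assms unfolding labelled_def by blast+

lemma cocycle_integer_group:
  assumes "finite_complex K" "\<And>a b c. {a, b, c} \<in> K \<Longrightarrow> w a b + w b c = w a c"
  shows "cocycle integer_group K w"
  by (intro cocycle.intro cocycle_axioms.intro group_integer_group) (use assms in simp_all)

lemma labelled_cocycle:
  assumes "labelled K w t"
  shows "{a, b, c} \<in> K \<Longrightarrow> w a b + w b c = w a c" "{a} \<in> K \<Longrightarrow> w a a = 0" "{a, b} \<in> K \<Longrightarrow> w b a = - w a b"
proof -
  interpret cocycle integer_group K w by (rule labelledD(7)[OF assms])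
  show 1: "w a b + w b c = w a c" if "{a, b, c} \<in> K" for a b c using label_mult[OF that] by simp
  show 2: "w a a = 0" if "{a} \<in> K" for a using label_refl[OF that] by simp
  assume ab: "{a, b} \<in> K"
  then have "{a} \<in> K" using complex_face[OF complex ab] by simp
  then show "w b a = - w a b" using 1[of a b a] 2[of a] ab by (simp add: insert_commute)
qed

lemma spokes:
  assumes K: "finite_complex K" and star: "\<And>a. {a} \<in> K \<Longrightarrow> {0, a} \<in> K" and a: "{a} \<in> K"
  shows "[0, a] \<in> walks K 0 a"
  by (rule walks_edge[OF K star[OF a]])

lemma cocycle_spokes:
  assumes K: "finite_complex K" "{0} \<in> K" and star: "\<And>a. {a} \<in> K \<Longrightarrow> {0, a} \<in> K"
  shows "cocycle (edge_group K 0) K (\<lambda>a b. edge_class K [0, a, b, 0])"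
  using cocycle_edge_group[OF K, of "\<lambda>a. [0, a]"] spokes[OF K(1) star] by simp

text \<open>The homomorphism induced by the inclusion preserves powers, so it carries the relation
  between loops and exponents along.\<close>

lemma labelled_old_edge:
  assumes lab: "labelled K w t" and K': "finite_complex K'" "K \<subseteq> K'" and ab: "{a, b} \<in> K"
  shows "edge_class K' [0, a, b, 0] = edge_class K' [0, 1, 2, 0] [^]\<^bsub>edge_group K' 0\<^esub> w a b"
proof -
  note D = labelledD[OF lab]
  have v: "{0} \<in> K'" using D(4) K'(2) by blast
  have gK: "group (edge_group K 0)" by (rule group_edge_group[OF D(1,4)])
  have gK': "group (edge_group K' 0)" by (rule group_edge_group[OF K'(1) v])
  obtain F where F: "F \<in> hom (edge_group K 0) (edge_group K' 0)"
    "\<And>L. L \<in> walks K 0 0 \<Longrightarrow> F (edge_class K L) = edge_class K' L"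
    using edge_group_inclusion[OF K'(1) D(1) K'(2) D(4)] by blast
  have loop: "[0, c, d, 0] \<in> walks K 0 0" if cd: "{c, d} \<in> K" for c d
  proof -
    have "{c} \<in> K" "{d} \<in> K" using complex_face[OF D(1) cd] by simp_all
    then show ?thesis
      using walks_append[OF spokes[OF D(1,5)] walks_rev[OF spokes[OF D(1,5)]] cd] by simp
  qed
  have X: "edge_class K [0, 1, 2, 0] \<in> carrier (edge_group K 0)"
    by (rule cocycle.label_closed[OF cocycle_spokes[OF D(1,4,5)] D(8)])
  have "edge_class K' [0, a, b, 0] = F (edge_class K [0, 1, 2, 0] [^]\<^bsub>edge_group K 0\<^esub> w a b)"
    using F(2)[OF loop[OF ab]] D(10)[OF ab] by simp
  also have "\<dots> = F (edge_class K [0, 1, 2, 0]) [^]\<^bsub>edge_group K' 0\<^esub> w a b"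
    by (rule hom_int_pow[OF F(1) X gK gK'])
  finally show ?thesis using F(2)[OF loop[OF D(8)]] by simp
qed

text \<open>The labels of old edges and of degenerate edges carry over to a larger complex, so the
  relation between loops and labels has to be checked only on the new edges.\<close>

lemma labelled_extend:
  assumes lab: "labelled K w t" and K': "finite_complex K'" "K \<subseteq> K'" "dim_at_most K' 2"
    and card: "card (simplices_of_dim 2 K') \<le> t'"
    and star: "\<And>a. {a} \<in> K' \<Longrightarrow> {0, a} \<in> K' \<and> w' 0 a = 0"
    and w': "\<And>a b. {a, b} \<in> K \<Longrightarrow> w' a b = w a b" and coc: "cocycle integer_group K' w'"
    and new: "\<And>a b. {a, b} \<in> K' \<Longrightarrow> {a, b} \<notin> K \<Longrightarrow> a \<noteq> b \<Longrightarrow>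
       (\<And>a b. {a, b} \<in> K \<Longrightarrow> edge_class K' [0, a, b, 0] = edge_class K' [0, 1, 2, 0] [^]\<^bsub>edge_group K' 0\<^esub> w a b) \<Longrightarrow>
       edge_class K' [0, a, b, 0] = edge_class K' [0, 1, 2, 0] [^]\<^bsub>edge_group K' 0\<^esub> w' a b"
  shows "labelled K' w' t'"
proof -
  note D = labelledD[OF lab]
  have v: "{0} \<in> K'" using D(4) K'(2) by blast
  interpret S': cocycle "edge_group K' 0" K' "\<lambda>a b. edge_class K' [0, a, b, 0]"
    by (rule cocycle_spokes[OF K'(1) v]) (use star in blast)
  note old = labelled_old_edge[OF lab K'(1,2)]
  have all: "edge_class K' [0, a, b, 0] = edge_class K' [0, 1, 2, 0] [^]\<^bsub>edge_group K' 0\<^esub> w' a b" if ab: "{a, b} \<in> K'" for a b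
  proof -
    consider "{a, b} \<in> K" | "a = b" | "{a, b} \<notin> K" "a \<noteq> b" by blast
    then show ?thesis
    proof cases
      case 1 then show ?thesis using old w' by simp
    next
      case 2
      then have "{a} \<in> K'" using ab by simp
      then have "edge_class K' [0, a, a, 0] = \<one>\<^bsub>edge_group K' 0\<^esub>" "w' a a = 0"
        using S'.label_refl cocycle.label_refl[OF coc] by simp_all
      then show ?thesis using 2 by simp
    next
      case 3 then show ?thesis using new[OF ab 3] old by blast
    qed
  qed
  have "{1, 2} \<in> K'" "w' 1 2 = 1" using D(8,9) K'(2) w' by auto
  then show ?thesis unfolding labelled_def
    by (intro conjI allI impI all) (use K' card star coc v in blast)+
qed

section \<open>Elementary expansions of labelled complexes\<close>

lemma dim_at_most_insert:
  "dim_at_most K d \<Longrightarrow> card s \<le> Suc d \<Longrightarrow> dim_at_most (insert s K) d"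
  by (auto simp: dim_at_most_def simplices_of_dim_def)

lemma simplices_of_dim_insert:
  "simplices_of_dim d (insert s K) = (if card s = Suc d then insert s (simplices_of_dim d K) else simplices_of_dim d K)"
  by (auto simp: simplices_of_dim_def)

lemma finite_complex_insert:
  assumes K: "finite_complex K" and s: "finite s" "s \<noteq> {}" "\<And>t. t \<subset> s \<Longrightarrow> t \<noteq> {} \<Longrightarrow> t \<in> K"
  shows "finite_complex (insert s K)"
  unfolding finite_complex_def
proof (intro conjI ballI allI impI)
  show "finite (insert s K)" using K by (simp add: finite_complex_def)
  fix r assume r: "r \<in> insert s K"
  then show "finite r" "r \<noteq> {}" using K s(1,2) unfolding finite_complex_def by blast+
  fix t assume "t \<subseteq> r \<and> t \<noteq> {}"
  then show "t \<in> insert s K" using r s(3)[of t] complex_face[OF K, of r t] by blast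
qed

text \<open>A whisker at 0. The loops through its edge stay inside the simplex \<open>{0, c}\<close>
  and are trivial, which is why all labels at \<open>c\<close> are 0.\<close>

lemma labelled_new_vertex:
  assumes lab: "labelled K w t" and c: "{c} \<notin> K"
  shows "labelled (insert {0, c} (insert {c} K)) (\<lambda>a b. if a = c \<or> b = c then 0 else w a b) t"
    (is "labelled ?K ?w t")
proof -
  note D = labelledD[OF lab]
  have c0: "c \<noteq> 0" using c D(4) by metis
  have K1: "finite_complex (insert {c} K)" by (rule finite_complex_insert[OF D(1)]) auto
  have K': "finite_complex ?K"
  proof (rule finite_complex_insert[OF K1])
    fix s :: "nat set" assume "s \<subset> {0, c}" "s \<noteq> {}"
    then have "s = {0} \<or> s = {c}" by blast
    then show "s \<in> insert {c} K" using D(4) by blast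
  qed auto
  have notin: "c \<notin> s" if "s \<in> K" for s using complex_face[OF D(1) that, of "{c}"] c by auto
  have simplex: "s \<in> K \<or> s \<subseteq> {0, c}" if "s \<in> ?K" for s using that by auto
  have sub: "{0, c} \<subseteq> s \<Longrightarrow> s \<in> ?K \<Longrightarrow> s = {0, c}" for s using notin c0 by auto
  show ?thesis
  proof (rule labelled_extend[OF lab K'])
    show "dim_at_most ?K 2" by (intro dim_at_most_insert D(2)) (simp_all add: card_insert_if)
    show "card (simplices_of_dim 2 ?K) \<le> t" using D(3) c0 by (simp add: simplices_of_dim_insert)
    show "{0, a} \<in> ?K \<and> ?w 0 a = 0" if "{a} \<in> ?K" for a
      using that c0 D(4,5,6) by (cases "a = c") (auto simp: doubleton_eq_iff)
    show "?w a b = w a b" if "{a, b} \<in> K" for a b using notin[OF that] by auto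
    show "cocycle integer_group ?K ?w"
    proof (rule cocycle_integer_group[OF K'])
      fix a b d assume abd: "{a, b, d} \<in> ?K"
      show "?w a b + ?w b d = ?w a d"
      proof (cases "{a, b, d} \<in> K")
        case True
        then show ?thesis using notin[OF True] labelled_cocycle(1)[OF lab True] by auto
      next
        case False
        then have "{a, b, d} \<subseteq> {0, c}" using simplex[OF abd] by blast
        moreover have "w 0 0 = 0" by (rule labelled_cocycle(2)[OF lab D(4)])
        ultimately show ?thesis by auto
      qed
    qed
    fix a b assume ab: "{a, b} \<in> ?K" "{a, b} \<notin> K" "a \<noteq> b"
    have "{a, b} = {0, c}"
    proof (rule ccontr)
      assume "{a, b} \<noteq> {0, c}"
      then have "{a, b} = {c}" using ab(1,2) by simp
      then show False using ab(3) by (metis insertI1 insertI2 singletonD)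
    qed
    then have "(a = 0 \<and> b = c) \<or> (a = c \<and> b = 0)" unfolding doubleton_eq_iff by blast
    moreover have "edge_eq ?K [0, 0, c, 0] [0]" "edge_eq ?K [0, c, 0, 0] [0]"
    proof -
      have s: "{0, c} \<in> ?K" by simp
      show "edge_eq ?K [0, 0, c, 0] [0]" "edge_eq ?K [0, c, 0, 0] [0]"
        using edge_eq_same_simplex[OF K' s, of "[0, 0, c, 0]" "[0]"] edge_eq_same_simplex[OF K' s, of "[0, c, 0, 0]" "[0]"]
        by auto
    qed
    ultimately have "edge_eq ?K [0, a, b, 0] [0]" by blast
    then have e1: "edge_class ?K [0, a, b, 0] = \<one>\<^bsub>edge_group ?K 0\<^esub>" by (simp add: edge_class_eq_iff edge_group_one)
    have e2: "?w a b = 0" using \<open>(a = 0 \<and> b = c) \<or> (a = c \<and> b = 0)\<close> by (elim disjE) simp_all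
    show "edge_class ?K [0, a, b, 0] = edge_class ?K [0, 1, 2, 0] [^]\<^bsub>edge_group ?K 0\<^esub> ?w a b"
      unfolding e1 e2 int_pow_0 ..
  qed blast
qed

text \<open>The new edge from \<open>u\<close> to \<open>v\<close> is a free face of the new
  triangle, which forces its label to be the sum of the labels along the other two edges.\<close>

lemma labelled_triangle:
  assumes lab: "labelled K w t" and ux: "{u, x} \<in> K" and xv: "{x, v} \<in> K" and uv: "{u, v} \<notin> K"
  shows "labelled (insert {u, x, v} (insert {u, v} K))
    (\<lambda>a b. if a = u \<and> b = v then w u x + w x v else if a = v \<and> b = u then - (w u x + w x v) else w a b) (Suc t)"
    (is "labelled ?K ?w _")
proof -
  note D = labelledD[OF lab]
  have vert: "{u} \<in> K" "{x} \<in> K" "{v} \<in> K" using complex_face[OF D(1) ux] complex_face[OF D(1) xv] by simp_all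
  have "{u, v} \<noteq> {u}" "{u, v} \<noteq> {x, v}" "{u, v} \<noteq> {u, x}" using vert ux xv uv by metis+
  then have ne: "u \<noteq> v" "u \<noteq> x" "x \<noteq> v" by auto
  \<comment> \<open>An end at 0 is impossible because every vertex is already joined to 0. So no
    spoke is relabelled.\<close>
  have n0: "u \<noteq> 0" "v \<noteq> 0" using D(5)[OF vert(3)] D(5)[OF vert(1)] uv by (metis insert_commute)+
  have K1: "finite_complex (insert {u, v} K)"
  proof (rule finite_complex_insert[OF D(1)])
    fix s assume "s \<subset> {u, v}" "s \<noteq> {}"
    then have "s = {u} \<or> s = {v}" by blast
    then show "s \<in> K" using vert by blast
  qed auto
  have K': "finite_complex ?K"
  proof (rule finite_complex_insert[OF K1])
    fix s assume s: "s \<subset> {u, x, v}" "s \<noteq> {}"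
    then have "s \<subseteq> {u, v} \<or> s \<subseteq> {u, x} \<or> s \<subseteq> {x, v}" by blast
    then show "s \<in> insert {u, v} K"
      using complex_face[OF K1, of "{u, v}" s] complex_face[OF D(1) ux, of s] complex_face[OF D(1) xv, of s] s(2) by blast
  qed auto
  have keep: "?w a b = w a b" if "{a, b} \<in> K" for a b
  proof -
    have "{a, b} \<noteq> {u, v}" using that uv by metis
    then have ne: "\<not> (a = u \<and> b = v)" "\<not> (a = v \<and> b = u)" by blast+
    show ?thesis unfolding if_not_P[OF ne(1)] if_not_P[OF ne(2)] ..
  qed
  \<comment> \<open>On the three vertices the labels are differences of a potential that vanishes at
    \<open>x\<close>, so the cocycle condition holds for all triangles on them, including degenerate
    ones.\<close>
  define pot where "pot a = (if a = u then - w u x else if a = v then w x v else 0)" for a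
  have pot: "?w a b = pot b - pot a" if "a \<in> {u, x, v}" "b \<in> {u, x, v}" for a b
  proof -
    have "w u u = 0" "w v v = 0" "w x x = 0" "w x u = - w u x" "w v x = - w x v"
      using labelled_cocycle(2,3)[OF lab] vert ux xv by blast+
    then show ?thesis using that ne by (auto simp: pot_def)
  qed
  show ?thesis
  proof (rule labelled_extend[OF lab K'])
    show "dim_at_most ?K 2" by (intro dim_at_most_insert D(2)) (simp_all add: card_insert_if)
    have fin: "finite (simplices_of_dim 2 K)" using D(1) by (simp add: simplices_of_dim_def finite_complex_def)
    have "card {u, v} = 2" "card {u, x, v} = 3" using ne by auto
    then have "simplices_of_dim 2 ?K = insert {u, x, v} (simplices_of_dim 2 K)" by (simp add: simplices_of_dim_insert)
    then show "card (simplices_of_dim 2 ?K) \<le> Suc t" using D(3) fin card_insert_le_m1[of "Suc t"] by (simp add: card_insert_if)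
    show "{0, a} \<in> ?K \<and> ?w 0 a = 0" if "{a} \<in> ?K" for a
    proof -
      have "{a} \<in> K" using that ne by (auto dest: sym)
      then show ?thesis using D(5,6)[of a] n0 by simp
    qed
    show "?w a b = w a b" if "{a, b} \<in> K" for a b by (rule keep[OF that])
    show "cocycle integer_group ?K ?w"
    proof (rule cocycle_integer_group[OF K'])
      fix a b c assume abc: "{a, b, c} \<in> ?K"
      show "?w a b + ?w b c = ?w a c"
      proof (cases "{a, b, c} \<in> K")
        case True
        have "{a, b} \<in> K" "{b, c} \<in> K" "{a, c} \<in> K" using complex_face[OF D(1) True] by auto
        then have "?w a b = w a b" "?w b c = w b c" "?w a c = w a c" using keep by blast+
        then show ?thesis using labelled_cocycle(1)[OF lab True] by simp
      next
        case False
        then have "{a, b, c} \<subseteq> {u, x, v}" using abc by auto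
        then have "?w a b = pot b - pot a" "?w b c = pot c - pot b" "?w a c = pot c - pot a" using pot by simp_all
        then show ?thesis by simp
      qed
    qed
    fix a b assume ab: "{a, b} \<in> ?K" "{a, b} \<notin> K" "a \<noteq> b"
      and old: "\<And>a b. {a, b} \<in> K \<Longrightarrow> edge_class ?K [0, a, b, 0] = edge_class ?K [0, 1, 2, 0] [^]\<^bsub>edge_group ?K 0\<^esub> w a b"
    have star: "{0, d} \<in> ?K" if "{d} \<in> ?K" for d
    proof -
      have "{d} \<in> K" using that ne by (auto dest: sym)
      then show ?thesis using D(5)[of d] by simp
    qed
    have v0: "{0} \<in> ?K" using D(4) by simp
    interpret S: cocycle "edge_group ?K 0" ?K "\<lambda>a b. edge_class ?K [0, a, b, 0]"
      by (rule cocycle_spokes[OF K' v0 star])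
    have X: "edge_class ?K [0, 1, 2, 0] \<in> carrier (edge_group ?K 0)" using S.label_closed[of 1 2] D(8) by simp
    have "edge_class ?K [0, u, v, 0] = edge_class ?K [0, u, x, 0] \<otimes>\<^bsub>edge_group ?K 0\<^esub> edge_class ?K [0, x, v, 0]"
      using S.label_mult[of u x v] by simp
    also have "\<dots> = edge_class ?K [0, 1, 2, 0] [^]\<^bsub>edge_group ?K 0\<^esub> (w u x + w x v)"
      using old[OF ux] old[OF xv] S.int_pow_mult[OF X] by simp
    finally have euv: "edge_class ?K [0, u, v, 0] = edge_class ?K [0, 1, 2, 0] [^]\<^bsub>edge_group ?K 0\<^esub> (w u x + w x v)" .
    have uvK: "{u, v} \<in> ?K" "{v, u} \<in> ?K" "{v, u, v} \<in> ?K" "{v} \<in> ?K" using vert by (simp_all add: insert_commute)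
    have "edge_class ?K [0, v, u, 0] \<otimes>\<^bsub>edge_group ?K 0\<^esub> edge_class ?K [0, u, v, 0] = \<one>\<^bsub>edge_group ?K 0\<^esub>"
      using S.label_mult[OF uvK(3)] S.label_refl[OF uvK(4)] by simp
    then have "inv\<^bsub>edge_group ?K 0\<^esub> edge_class ?K [0, u, v, 0] = edge_class ?K [0, v, u, 0]"
      by (rule S.inv_equality[OF _ S.label_closed[OF uvK(1)] S.label_closed[OF uvK(2)]])
    then have evu: "edge_class ?K [0, v, u, 0] = edge_class ?K [0, 1, 2, 0] [^]\<^bsub>edge_group ?K 0\<^esub> (- (w u x + w x v))"
      using S.int_pow_neg[OF X, of "w u x + w x v"] euv by simp
    have "card {a, b} = 2" "card {u, x, v} = 3" using ab(3) ne by auto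
    then have "{a, b} \<noteq> {u, x, v}" by (intro notI) (drule arg_cong[of _ _ card], linarith)
    then have "{a, b} = {u, v}" using ab(1,2) by simp
    then consider "a = u" "b = v" | "a = v" "b = u" unfolding doubleton_eq_iff by blast
    then show "edge_class ?K [0, a, b, 0] = edge_class ?K [0, 1, 2, 0] [^]\<^bsub>edge_group ?K 0\<^esub> ?w a b"
    proof cases
      case 1 then show ?thesis using euv by simp
    next
      case 2 then show ?thesis using evu ne(1) by simp
    qed
  qed blast
qed

lemma labelled_circle:
  defines "w \<equiv> \<lambda>a b :: nat. if a = 1 \<and> b = 2 then 1 else if a = 2 \<and> b = 1 then - 1 else 0 :: int"
  shows "labelled {{0}, {1}, {2}, {0, 1}, {0, 2}, {1, 2}} w 0" (is "labelled ?K w 0")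
proof -
  define K where "K = ?K"
  have fc: "finite_complex K"
  proof -
    have e: "finite_complex ({} :: nat set set)" by (simp add: finite_complex_def)
    have 1: "finite_complex {{2 :: nat}}" by (rule finite_complex_insert[OF e]) auto
    have 2: "finite_complex {{1 :: nat}, {2}}" by (rule finite_complex_insert[OF 1]) auto
    have 3: "finite_complex {{0 :: nat}, {1}, {2}}" by (rule finite_complex_insert[OF 2]) auto
    have sub: "t = {a} \<or> t = {b}" if "t \<subset> {a, b}" "t \<noteq> {}" for t and a b :: nat using that by blast
    have 4: "finite_complex {{1, 2 :: nat}, {0}, {1}, {2}}" by (rule finite_complex_insert[OF 3]) (auto dest!: sub)
    have 5: "finite_complex {{0, 2 :: nat}, {1, 2}, {0}, {1}, {2}}" by (rule finite_complex_insert[OF 4]) (auto dest!: sub)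
    have 6: "finite_complex {{0, 1 :: nat}, {0, 2}, {1, 2}, {0}, {1}, {2}}" by (rule finite_complex_insert[OF 5]) (auto dest!: sub)
    have eq: "?K = {{0, 1 :: nat}, {0, 2}, {1, 2}, {0}, {1}, {2}}" by (simp add: insert_commute)
    show ?thesis unfolding K_def eq by (rule 6)
  qed
  have small: "card s \<le> 2" if "s \<in> K" for s using that by (auto simp: K_def)
  have dim: "dim_at_most K 2"
    unfolding dim_at_most_def simplices_of_dim_def using small by fastforce
  have tri: "simplices_of_dim 2 K = {}" unfolding simplices_of_dim_def using small by fastforce
  have v: "{0} \<in> K" by (simp add: K_def)
  have star: "{0, a} \<in> K \<and> w 0 a = 0" if "{a} \<in> K" for a using that by (auto simp: w_def K_def)
  have sub: "s \<subseteq> {0, 1} \<or> s \<subseteq> {0, 2} \<or> s \<subseteq> {1, 2}" if "s \<in> K" for s using that by (auto simp: K_def)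
  have coc: "cocycle integer_group K w"
  proof (rule cocycle_integer_group[OF fc])
    fix a b c assume "{a, b, c} \<in> K"
    from sub[OF this] show "w a b + w b c = w a c" by (auto simp: w_def)
  qed
  interpret S: cocycle "edge_group K 0" K "\<lambda>a b. edge_class K [0, a, b, 0]"
    by (rule cocycle_spokes[OF fc v]) (use star in blast)
  have e: "{1, 2} \<in> K" "{0, 1} \<in> K" "{0, 2} \<in> K" by (simp_all add: K_def)
  note X = S.label_closed[OF e(1)]
  have pw: "edge_class K [0, a, b, 0] = edge_class K [0, 1, 2, 0] [^]\<^bsub>edge_group K 0\<^esub> w a b" if ab: "{a, b} \<in> K" for a b
  proof -
    consider "a = 1" "b = 2" | "a = 2" "b = 1" | "{a, b} \<subseteq> {0, 1} \<or> {a, b} \<subseteq> {0, 2} \<or> a = b" "w a b = 0"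
      using sub[OF ab] by (auto simp: w_def)
    then show ?thesis
    proof cases
      case 1 then show ?thesis using S.int_pow_1[OF X] by (simp add: w_def)
    next
      case 2
      have K: "{1, 2, 1} \<in> K" "{1 :: nat} \<in> K" "{2, 1} \<in> K" "{2, 1, 2} \<in> K" "{2 :: nat} \<in> K" using e(1) complex_face[OF fc e(1)] by (simp_all add: insert_commute)
      have "edge_class K [0, 2, 1, 0] \<otimes>\<^bsub>edge_group K 0\<^esub> edge_class K [0, 1, 2, 0] = \<one>\<^bsub>edge_group K 0\<^esub>"
        using S.label_mult[OF K(4)] S.label_refl[OF K(5)] by simp
      then have "inv\<^bsub>edge_group K 0\<^esub> edge_class K [0, 1, 2, 0] = edge_class K [0, 2, 1, 0]"
        by (rule S.inv_equality[OF _ X S.label_closed[OF K(3)]])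
      then show ?thesis using 2 S.int_pow_neg[OF X, of 1] S.int_pow_1[OF X] by (simp add: w_def)
    next
      case 3
      have "edge_eq K [0, a, b, 0] [0]"
      proof (cases "a = b")
        case True
        have "{0, a} \<in> K" using ab star True by simp
        then show ?thesis using True by (intro edge_eq_same_simplex[OF fc, of "{0, a}"]) simp_all
      next
        case False
        then have "{0, a, b} \<subseteq> {0, 1} \<or> {0, a, b} \<subseteq> {0, 2}" using 3(1) by blast
        then have "{0, a, b} \<in> K"
          using complex_face[OF fc e(2), of "{0, a, b}"] complex_face[OF fc e(3), of "{0, a, b}"] by blast
        then show ?thesis by (intro edge_eq_same_simplex[OF fc, of "{0, a, b}"]) simp_all
      qed
      then show ?thesis using 3(2) edge_class_eq_iff[of K "[0, a, b, 0]" "[0]"] by (simp add: edge_group_one)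
    qed
  qed
  have "labelled K w 0" unfolding labelled_def
  proof (intro conjI allI impI)
    show "card (simplices_of_dim 2 K) \<le> 0" unfolding tri by simp
    show "w 1 2 = 1" by (simp add: w_def)
    show "finite_complex K" by (rule fc)
    show "dim_at_most K 2" by (rule dim)
    show "cocycle integer_group K w" by (rule coc)
    show "{0} \<in> K" "{1, 2} \<in> K" by (rule v, rule e(1))
    show "{0, a} \<in> K" "w 0 a = 0" if "{a} \<in> K" for a using star[OF that] by simp_all
    show "edge_class K [0, a, b, 0] = edge_class K [0, 1, 2, 0] [^]\<^bsub>edge_group K 0\<^esub> w a b" if "{a, b} \<in> K" for a b
      by (rule pw[OF that])
  qed
  then show ?thesis by (simp add: K_def)
qed

section \<open>Killing a power of the generating loop\<close>

lemma doubleton_neq_triple: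
  assumes "x \<noteq> y" "y \<noteq> z" "x \<noteq> z" shows "{a, b} \<noteq> {x, y, z}"
proof
  assume "{a, b} = {x, y, z}"
  then have "card {a, b} = card {x, y, z}" by (rule arg_cong)
  moreover have "card {a, b} \<le> 2" by (simp add: card_insert_if)
  ultimately show False using assms by simp
qed

text \<open>All edges of the new triangle \<open>{0, u, v}\<close> are already present, and it makes
  the loop with exponent \<open>m\<close> trivial. The generator has order exactly \<open>m\<close>
  because the labels modulo \<open>m\<close> still form a cocycle.\<close>

lemma labelled_fill:
  assumes lab: "labelled K w t" and uv: "{u, v} \<in> K" "w u v = int m" "u \<noteq> v" "u \<noteq> 0" "v \<noteq> 0" and m: "0 < m"
  shows "\<exists>K' :: nat set set. finite_complex K' \<and> dim_at_most K' 2 \<and> edge_connected K' 0 \<and> card (simplices_of_dim 2 K') \<le> Suc t \<and>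
    edge_group K' 0 \<cong> integer_mod_group m"
proof -
  note D = labelledD[OF lab]
  define K' where "K' = insert {0, u, v} K"
  have vert: "{u} \<in> K" "{v} \<in> K" using complex_face[OF D(1) uv(1)] by simp_all
  have K': "finite_complex K'"
    unfolding K'_def
  proof (rule finite_complex_insert[OF D(1)])
    fix s assume s: "s \<subset> {0, u, v}" "s \<noteq> {}"
    then have "s \<subseteq> {0, u} \<or> s \<subseteq> {0, v} \<or> s \<subseteq> {u, v}" by blast
    then show "s \<in> K" using complex_face[OF D(1) D(5)[OF vert(1)], of s] complex_face[OF D(1) D(5)[OF vert(2)], of s]
        complex_face[OF D(1) uv(1), of s] s(2) by blast
  qed auto
  have sub: "K \<subseteq> K'" by (auto simp: K'_def)
  have dim: "dim_at_most K' 2" unfolding K'_def by (intro dim_at_most_insert D(2)) (simp_all add: card_insert_if)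
  have fin: "finite (simplices_of_dim 2 K)" using D(1) by (simp add: simplices_of_dim_def finite_complex_def)
  have card: "card (simplices_of_dim 2 K') \<le> Suc t"
    unfolding K'_def using D(3) fin by (simp add: simplices_of_dim_insert card_insert_if)
  have v0: "{0} \<in> K'" using D(4) sub by blast
  have one: "{a} \<in> K" if "{a} \<in> K'" for a using that uv by (auto simp: K'_def dest: sym)
  have star: "{0, a} \<in> K'" if "{a} \<in> K'" for a using D(5)[OF one[OF that]] sub by blast
  have conn: "edge_connected K' 0"
    unfolding edge_connected_def using v0 walks_edge[OF K' star] by blast
  let ?E = "edge_group K' 0" and ?Z = "integer_mod_group m"
  have gE: "group ?E" by (rule group_edge_group[OF K' v0])
  interpret E: group ?E by (rule gE)
  have sp: "cocycle ?E K' (\<lambda>a b. edge_class K' [0, a, b, 0])" by (rule cocycle_spokes[OF K' v0 star])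
  define X where "X = edge_class K' [0, 1, 2, 0]"
  have "{1, 2} \<in> K'" using D(8) sub by blast
  then have X: "X \<in> carrier ?E" unfolding X_def by (rule cocycle.label_closed[OF sp])
  have edgeK: "{a, b} \<in> K" if "{a, b} \<in> K'" for a b
  proof -
    have "{a, b} \<noteq> {0, u, v}" by (rule doubleton_neq_triple) (use uv in simp_all)
    then show ?thesis using that by (simp add: K'_def)
  qed
  have pw: "edge_class K' [0, a, b, 0] = X [^]\<^bsub>?E\<^esub> w a b" if "{a, b} \<in> K'" for a b
    unfolding X_def by (rule labelled_old_edge[OF lab K' sub edgeK[OF that]])
  have Xm: "X [^]\<^bsub>?E\<^esub> int m = \<one>\<^bsub>?E\<^esub>"
  proof -
    have s: "{0, u, v} \<in> K'" by (simp add: K'_def)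
    have uvK': "{u, v} \<in> K'" using uv(1) sub by blast
    have "edge_eq K' [0, u, v, 0] [0]" by (rule edge_eq_same_simplex[OF K' s]) auto
    then show ?thesis using pw[OF uvK'] uv(2) by (simp add: edge_group_one edge_class_eq_iff[symmetric])
  qed
  have gZ: "group ?Z" by simp
  have cZ: "cocycle ?Z K' (\<lambda>a b. w a b mod int m)"
  proof (intro cocycle.intro cocycle_axioms.intro gZ K')
    fix a b c assume abc: "{a, b, c} \<in> K'"
    show "(w a b mod int m) \<otimes>\<^bsub>?Z\<^esub> (w b c mod int m) = w a c mod int m"
    proof (cases "{a, b, c} \<in> K")
      case True
      from labelled_cocycle(1)[OF lab True] show ?thesis by (simp add: mod_add_eq flip: \<open>w a b + w b c = w a c\<close>)
    next
      case False
      then have *: "{a, b, c} = {0, u, v}" using abc by (simp add: K'_def)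
      \<comment> \<open>On the new triangle the spokes have label 0 and the remaining edge has label
        \<open>m\<close> or \<open>- m\<close>.\<close>
      have "w x y mod int m = 0" if "x \<in> {0, u, v}" "y \<in> {0, u, v}" for x y
      proof -
        have "w 0 0 = 0" "w u u = 0" "w v v = 0" using labelled_cocycle(2)[OF lab] vert D(4) by blast+
        moreover have "w v u = - int m" using labelled_cocycle(3)[OF lab uv(1)] uv(2) by simp
        moreover have "w 0 u = 0" "w 0 v = 0" using D(6) vert by blast+
        moreover have "w u 0 = 0" "w v 0 = 0"
          using labelled_cocycle(3)[OF lab D(5)[OF vert(1)]] labelled_cocycle(3)[OF lab D(5)[OF vert(2)]] D(6) vert by simp_all
        ultimately show ?thesis using that uv(2) by auto
      qed
      moreover have "a \<in> {0, u, v}" "b \<in> {0, u, v}" "c \<in> {0, u, v}" using * by blast+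
      ultimately show ?thesis by simp
    qed
  qed (use m in \<open>simp add: carrier_integer_mod_group\<close>)
  obtain h where h: "h \<in> hom ?E ?Z" "\<And>L. L \<in> walks K' 0 0 \<Longrightarrow> h (edge_class K' L) = label_prod ?Z (\<lambda>a b. w a b mod int m) L"
    using edge_group_hom[OF cZ v0] by blast
  have hX: "h X = 1 mod int m"
  proof -
    have w12: "[0, 1, 2, 0] \<in> walks K' 0 0"
    proof -
      have v12: "{1} \<in> K'" "{2} \<in> K'" using complex_face[OF K' \<open>{1, 2} \<in> K'\<close>] by simp_all
      show ?thesis using walks_append[OF walks_edge[OF K' star[OF v12(1)]] walks_rev[OF walks_edge[OF K' star[OF v12(2)]]] \<open>{1, 2} \<in> K'\<close>] by simp
    qed
    have v12: "{1} \<in> K" "{2} \<in> K" using complex_face[OF D(1,8)] by simp_all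
    have "w 0 1 = 0" "w 2 0 = 0" using D(6) v12 labelled_cocycle(3)[OF lab D(5)[OF v12(2)]] by simp_all
    then show ?thesis using h(2)[OF w12] D(9) by (simp add: X_def)
  qed
  have hpow: "h (X [^]\<^bsub>?E\<^esub> n) = n mod int m" for n :: int
  proof -
    have "h (X [^]\<^bsub>?E\<^esub> n) = h X [^]\<^bsub>?Z\<^esub> n" by (rule hom_int_pow[OF h(1) X gE gZ])
    then show ?thesis unfolding hX int_pow_integer_mod_group by (simp add: mod_mult_right_eq)
  qed
  \<comment> \<open>By telescoping, every loop is a product of loops [0, a, b, 0], and each of these
    is a power of \<open>X\<close>.\<close>
  have cyc: "\<exists>n :: int. x = X [^]\<^bsub>?E\<^esub> n" if x: "x \<in> carrier ?E" for x
  proof -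
    obtain L where L: "L \<in> walks K' 0 0" "x = edge_class K' L" using x by (auto simp: edge_group_carrier)
    note W = walksD[OF L(1)]
    have "edge_class K' ([0, hd L] @ tl L @ tl (rev [0, last L])) = label_prod ?E (\<lambda>a b. edge_class K' ([0, a] @ rev [0, b])) L"
      by (rule label_prod_edge_group[OF K' v0 spokes[OF K' star] W(2), symmetric])
    also have "\<dots> = label_prod ?E (\<lambda>a b. X [^]\<^bsub>?E\<^esub> w a b) L"
      by (rule label_prod_cong[OF K' W(2)]) (simp add: pw)
    also have "\<dots> = X [^]\<^bsub>?E\<^esub> label_prod integer_group w L"
      by (rule label_prod_hom[OF group_integer_group gE E.hom_integer_group_pow[OF X] K' W(2), symmetric]) simp
    also have "edge_class K' ([0, hd L] @ tl L @ tl (rev [0, last L])) = edge_class K' L"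
    proof -
      obtain M where M: "L = M @ [0]" using W by (metis append_butlast_last_id)
      have "edge_eq K' (0 # L) L" using W edge_eq_stutter[of K' 0 "tl L"] by (cases L) auto
      moreover have "edge_eq K' ((0 # M) @ [0, 0]) ((0 # M) @ [0])" by (rule edge_eq_appendL[OF edge_eq_stutter])
      moreover have "[0, hd L] @ tl L @ tl (rev [0, last L]) = (0 # M) @ [0, 0]" "0 # L = (0 # M) @ [0]"
        using W M by (cases M; simp)+
      ultimately show ?thesis unfolding edge_class_eq_iff by (metis edge_eq_trans)
    qed
    finally show ?thesis using L(2) by blast
  qed
  have "inj_on h (carrier ?E)"
  proof (rule inj_onI)
    fix x y assume xy: "x \<in> carrier ?E" "y \<in> carrier ?E" and eq: "h x = h y"
    obtain n k :: int where nk: "x = X [^]\<^bsub>?E\<^esub> n" "y = X [^]\<^bsub>?E\<^esub> k" using cyc xy by blast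
    then have "n mod int m = k mod int m" using eq hpow by simp
    then obtain q where q: "n = k + int m * q" by (metis mod_eqE mult.commute add.commute diff_add_cancel mod_eq_dvd_iff dvdE)
    have "X [^]\<^bsub>?E\<^esub> (int m * q) = (X [^]\<^bsub>?E\<^esub> int m) [^]\<^bsub>?E\<^esub> q" by (rule E.int_pow_pow[OF X, symmetric])
    then have "X [^]\<^bsub>?E\<^esub> (int m * q) = \<one>\<^bsub>?E\<^esub>" by (simp add: Xm)
    then show "x = y" using nk X q E.int_pow_mult[OF X, of k "int m * q"] by simp
  qed
  moreover have "h ` carrier ?E = carrier ?Z"
  proof
    show "h ` carrier ?E \<subseteq> carrier ?Z" using hom_in_carrier[OF h(1)] by blast
    show "carrier ?Z \<subseteq> h ` carrier ?E"
    proof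
      fix n assume "n \<in> carrier ?Z"
      then have "h (X [^]\<^bsub>?E\<^esub> n) = n" using hpow[of n] m by (simp add: carrier_integer_mod_group)
      then show "n \<in> h ` carrier ?E" using X by (metis E.int_pow_closed image_eqI)
    qed
  qed
  ultimately have "h \<in> iso ?E ?Z" using h(1) by (simp add: iso_def bij_betw_def)
  then have iso: "?E \<cong> ?Z" by (rule is_isoI)
  show ?thesis by (intro exI[of _ K'] conjI K' dim conn card iso)
qed

section \<open>Binary expansion\<close>

text \<open>The complex is hidden behind the partial function of its labels, undefined off the
  edges. Rewriting then decides the presence of an edge and computes its label at once.\<close>

definition built :: "(nat \<Rightarrow> nat \<Rightarrow> int option) \<Rightarrow> nat \<Rightarrow> bool" where
  "built l t \<longleftrightarrow> (\<exists>K w. labelled K w t \<and> (\<forall>u v. l u v = (if {u, v} \<in> K then Some (w u v) else None)))"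

definition add_edge where
  "add_edge u v n l = (\<lambda>a b. if a = u \<and> b = v then Some n else if a = v \<and> b = u then Some (- n) else l a b)"

text \<open>The degenerate edge at \<open>c\<close> is recorded as well, in accordance with
  \<open>{c, c}\<close> being \<open>{c}\<close>.\<close>

definition add_vertex :: "nat \<Rightarrow> (nat \<Rightarrow> nat \<Rightarrow> int option) \<Rightarrow> nat \<Rightarrow> nat \<Rightarrow> int option" where
  "add_vertex c l = (\<lambda>a b. if (a = c \<and> (b = 0 \<or> b = c)) \<or> (a = 0 \<and> b = c) then Some 0 else l a b)"

lemma built_triangle:
  assumes b: "built l t" and "l u x = Some i" "l x v = Some j" "l u v = None"
  shows "built (add_edge u v (i + j) l) (Suc t)"
proof -
  obtain K w where K: "labelled K w t" and l: "\<And>u v. l u v = (if {u, v} \<in> K then Some (w u v) else None)"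
    using b by (auto simp: built_def)
  have e: "{u, x} \<in> K" "{x, v} \<in> K" "{u, v} \<notin> K" and w: "w u x = i" "w x v = j"
    using assms l by (auto split: if_splits)
  have vert: "{u} \<in> K" using complex_face[OF labelledD(1)[OF K] e(1), of "{u}"] by simp
  then have "u \<noteq> v" "u \<noteq> x" "x \<noteq> v" using e by (metis insert_absorb2)+
  then have "{a, b} \<noteq> {u, x, v}" for a b by (intro doubleton_neq_triple) simp_all
  then have mem: "{a, b} \<in> insert {u, x, v} (insert {u, v} K) \<longleftrightarrow> (a = u \<and> b = v) \<or> (a = v \<and> b = u) \<or> {a, b} \<in> K" for a b
    by (auto simp: doubleton_eq_iff)
  have *: "(if P then Some y else if Q then Some z else if R then Some z' else None) =
      (if P \<or> Q \<or> R then Some (if P then y else if Q then z else z') else None)" for P Q R and y z z' :: int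
    by simp
  show ?thesis unfolding built_def
  proof (intro exI conjI allI)
    show "labelled (insert {u, x, v} (insert {u, v} K))
      (\<lambda>a b. if a = u \<and> b = v then w u x + w x v else if a = v \<and> b = u then - (w u x + w x v) else w a b) (Suc t)"
      by (rule labelled_triangle[OF K e])
    fix a b
    show "add_edge u v (i + j) l a b = (if {a, b} \<in> insert {u, x, v} (insert {u, v} K) then
      Some (if a = u \<and> b = v then w u x + w x v else if a = v \<and> b = u then - (w u x + w x v) else w a b) else None)"
      unfolding mem add_edge_def w l[of a b] by (rule *)
  qed
qed

lemma built_vertex:
  assumes b: "built l t" obtains c where "2 < c" "\<And>a. l a c = None" "\<And>a. l c a = None" "built (add_vertex c l) t"
proof -
  obtain K w where K: "labelled K w t" and l: "\<And>u v. l u v = (if {u, v} \<in> K then Some (w u v) else None)"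
    using b by (auto simp: built_def)
  note D = labelledD[OF K]
  have "finite K" "\<And>s. s \<in> K \<Longrightarrow> finite s" using D(1) by (simp_all add: finite_complex_def)
  then have fin: "finite (insert 1 (insert 2 (\<Union>K)))" by simp
  obtain c where "c \<notin> insert 1 (insert 2 (\<Union>K))"
    by (rule exE[OF ex_new_if_finite[OF infinite_UNIV_nat fin]])
  then have cU: "c \<notin> \<Union>K" and "c \<noteq> 1" "c \<noteq> 2" by simp_all
  have "0 \<in> \<Union>K" by (rule UnionI[OF D(4)]) simp
  then have "c \<noteq> 0" using cU by metis
  then have c2: "2 < c" using \<open>c \<noteq> 1\<close> \<open>c \<noteq> 2\<close> by linarith
  have notin: "s \<notin> K" if "c \<in> s" for s using UnionI[OF _ that] cU by metis
  have nc: "{a, c} \<notin> K" "{c, a} \<notin> K" "{c} \<notin> K" for a by (rule notin, simp)+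
  have mem: "{a, b} \<in> insert {0, c} (insert {c} K) \<longleftrightarrow> (a = c \<and> (b = 0 \<or> b = c)) \<or> (a = 0 \<and> b = c) \<or> {a, b} \<in> K" for a b
    by (auto simp: doubleton_eq_iff)
  have *: "(if P \<or> Q then Some 0 else if R then Some z else None) = (if P \<or> Q \<or> R then Some (if S then 0 else z) else None)"
    if "R \<Longrightarrow> \<not> S" "P \<Longrightarrow> S" "Q \<Longrightarrow> S" for P Q R S and z :: int
    using that by (cases P; cases Q; cases R) simp_all
  have "built (add_vertex c l) t" unfolding built_def
  proof (intro exI conjI allI)
    show "labelled (insert {0, c} (insert {c} K)) (\<lambda>a b. if a = c \<or> b = c then 0 else w a b) t"
      by (rule labelled_new_vertex[OF K nc(3)])
    fix a b
    have "\<not> (a = c \<or> b = c)" if "{a, b} \<in> K" using that nc by metis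
    moreover have "a = c \<or> b = c" if "a = c \<and> (b = 0 \<or> b = c)" using that by blast
    moreover have "a = c \<or> b = c" if "a = 0 \<and> b = c" using that by blast
    ultimately show "add_vertex c l a b = (if {a, b} \<in> insert {0, c} (insert {c} K) then Some (if a = c \<or> b = c then 0 else w a b) else None)"
      unfolding mem add_vertex_def l[of a b] by (rule *)
  qed
  then show thesis using that[of c] c2 nc l by simp
qed

text \<open>Provides the two sides of the many triangles below whose middle vertex is 0.\<close>

lemma built_spoke:
  assumes b: "built l t" and ab: "l a b = Some n"
  shows "l 0 a = Some 0" "l a 0 = Some 0" "l 0 b = Some 0" "l b 0 = Some 0" "l b a = Some (- n)"
proof -
  obtain K w where K: "labelled K w t" and l: "\<And>u v. l u v = (if {u, v} \<in> K then Some (w u v) else None)"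
    using b by (auto simp: built_def)
  note D = labelledD[OF K]
  have e: "{a, b} \<in> K" "w a b = n" using ab l[of a b] by (simp_all split: if_splits)
  have v: "{a} \<in> K" "{b} \<in> K" using complex_face[OF D(1) e(1)] by simp_all
  have "{b, a} \<in> K" "w b a = - n" using e labelled_cocycle(3)[OF K e(1)] by (simp_all add: insert_commute)
  then show "l b a = Some (- n)" using l by simp
  have spoke: "l 0 c = Some 0 \<and> l c 0 = Some 0" if c: "{c} \<in> K" for c
  proof -
    have "{0, c} \<in> K" "w 0 c = 0" using D(5,6)[OF c] by simp_all
    moreover from this have "{c, 0} \<in> K" "w c 0 = 0" using labelled_cocycle(3)[OF K, of 0 c] by (simp_all add: insert_commute)
    ultimately show ?thesis using l by simp
  qed
  show "l 0 a = Some 0" "l a 0 = Some 0" "l 0 b = Some 0" "l b 0 = Some 0" using spoke v by simp_all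
qed

lemma built_generator: "built l t \<Longrightarrow> l 1 2 = Some 1"
  using labelledD(8,9) by (auto simp: built_def)

lemma labelled_mono: "labelled K w t \<Longrightarrow> t \<le> t' \<Longrightarrow> labelled K w t'"
  unfolding labelled_def by (elim conjE) (intro conjI; (assumption | linarith))

lemma built_mono: "built l t \<Longrightarrow> t \<le> t' \<Longrightarrow> built l t'"
  unfolding built_def using labelled_mono by blast

lemma built_circle: "\<exists>l. built l 0"
proof -
  have "\<exists>l. built l t" if "labelled K w t" for K w t
    unfolding built_def using that by (intro exI[of _ "\<lambda>u v. if {u, v} \<in> K then Some (w u v) else None"]) blast
  then show ?thesis using labelled_circle by blast
qed

text \<open>Moves the generating edge from 1, 2 to a copy that avoids 1: \<open>built_double\<close>
  joins its new vertex \<open>d\<close> to both ends of the doubled edge, yet must leave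
  \<open>d\<close> unconnected to 1.\<close>

lemma built_start: "\<exists>l a. built l 2 \<and> l a 2 = Some 1 \<and> 2 < a"
proof -
  obtain l where b: "built l 0" using built_circle by blast
  obtain c where c: "2 < c" "\<And>x. l x c = None" "\<And>x. l c x = None" and b1: "built (add_vertex c l) 0"
    by (rule built_vertex[OF b], rule that)
  define l1 where "l1 = add_vertex c l"
  have b1: "built l1 0" using b1 by (simp add: l1_def)
  note g = built_generator[OF b] and s = built_spoke[OF b built_generator[OF b]]
  define l2 where "l2 = add_edge c 1 (0 + 0) l1"
  have b2: "built l2 (Suc 0)" unfolding l2_def
    by (rule built_triangle[OF b1, where x = 0]) (use c s in \<open>simp_all add: l1_def add_vertex_def\<close>)
  define l3 where "l3 = add_edge c 2 (0 + 1) l2"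
  have b3: "built l3 (Suc (Suc 0))" unfolding l3_def
    by (rule built_triangle[OF b2, where x = 1]) (use c s g in \<open>simp_all add: l1_def l2_def add_vertex_def add_edge_def\<close>)
  have "l3 c 2 = Some 1" by (simp add: l3_def add_edge_def)
  then show ?thesis using b3 c(1) by (metis numeral_2_eq_2)
qed

text \<open>The new triangles form a disc with one interior vertex \<open>p\<close>. Its boundary runs twice through the
  loop \<open>0, a, b\<close> and then backwards through the loop \<open>0, c, d\<close>.\<close>

lemma built_double:
  assumes b: "built l t" and ab: "l a b = Some n" "1 < a" "1 < b" "a \<noteq> b"
  shows "\<exists>l' c d. built l' (t + 9) \<and> l' c d = Some (2 * n) \<and> 2 < c \<and> 2 < d \<and> c \<noteq> d \<and> l' d 1 = None"
proof -
  obtain c where c: "2 < c" "\<And>x. l x c = None" "\<And>x. l c x = None" and b1: "built (add_vertex c l) t"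
    by (rule built_vertex[OF b], rule that)
  define l1 where "l1 = add_vertex c l"
  have b1: "built l1 t" using b1 by (simp add: l1_def)
  obtain d where d: "2 < d" "\<And>x. l1 x d = None" "\<And>x. l1 d x = None" and b2: "built (add_vertex d l1) t"
    by (rule built_vertex[OF b1], rule that)
  define l2 where "l2 = add_vertex d l1"
  have b2: "built l2 t" using b2 by (simp add: l2_def)
  obtain p where p: "2 < p" "\<And>x. l2 x p = None" "\<And>x. l2 p x = None" and b3: "built (add_vertex p l2) t"
    by (rule built_vertex[OF b2], rule that)
  define l3 where "l3 = add_vertex p l2"
  have b3: "built l3 t" using b3 by (simp add: l3_def)
  have "l1 c c = Some 0" by (simp add: l1_def add_vertex_def)
  then have dc: "d \<noteq> c" using d(2)[of c] by auto
  have "l2 d d = Some 0" by (simp add: l2_def add_vertex_def)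
  then have pd: "p \<noteq> d" using p(2)[of d] by auto
  have "l2 c c = Some 0" using dc by (simp add: l1_def l2_def add_vertex_def)
  then have pc: "p \<noteq> c" using p(2)[of c] by auto
  have ld: "l x d = None" "l d x = None" for x
    using d(2)[of x] d(3)[of x] by (simp_all add: l1_def add_vertex_def split: if_splits)
  have lp: "l x p = None" "l p x = None" for x
    using p(2)[of x] p(3)[of x] by (simp_all add: l1_def l2_def add_vertex_def split: if_splits)
  note s = built_spoke[OF b ab(1)]
  have ne: "a \<noteq> c" "b \<noteq> c" "a \<noteq> d" "b \<noteq> d" "a \<noteq> p" "b \<noteq> p"
    using c(2)[of a] c(3)[of b] ld(1)[of a] ld(2)[of b] lp(1)[of a] lp(2)[of b] ab(1) c(3)[of b] s(5) by auto
  note facts = c ld lp dc dc[symmetric] pd pd[symmetric] pc pc[symmetric] ne ne[symmetric] s ab ab(4)[symmetric] d(1) p(1)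
  note vdefs = l1_def l2_def l3_def add_vertex_def add_edge_def
  define m1 where "m1 = add_edge a c (0 + 0) l3"
  have n1: "built m1 (Suc t)" unfolding m1_def
    by (rule built_triangle[OF b3, where x = 0]) (use facts in \<open>simp_all add: vdefs\<close>)
  define m2 where "m2 = add_edge b d (0 + 0) m1"
  have n2: "built m2 (Suc (Suc t))" unfolding m2_def
    by (rule built_triangle[OF n1, where x = 0]) (use facts in \<open>simp_all add: vdefs m1_def\<close>)
  define m3 where "m3 = add_edge p b (0 + 0) m2"
  have n3: "built m3 (Suc (Suc (Suc t)))" unfolding m3_def
    by (rule built_triangle[OF n2, where x = 0]) (use facts in \<open>simp_all add: vdefs m1_def m2_def\<close>)
  define m4 where "m4 = add_edge p a (0 + 0) m3"
  have n4: "built m4 (Suc (Suc (Suc (Suc t))))" unfolding m4_def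
    by (rule built_triangle[OF n3, where x = 0]) (use facts in \<open>simp_all add: vdefs m1_def m2_def m3_def\<close>)
  \<comment> \<open>The old edge is now used in both directions: \<open>b\<close> reaches
    \<open>c\<close> with exponent \<open>- n\<close>, and next \<open>a\<close> reaches
    \<open>d\<close> with exponent \<open>n\<close>.\<close>
  define m5 where "m5 = add_edge b c (- n + 0) m4"
  have n5: "built m5 (Suc (Suc (Suc (Suc (Suc t)))))" unfolding m5_def
    by (rule built_triangle[OF n4, where x = a]) (use facts in \<open>simp_all add: vdefs m1_def m2_def m3_def m4_def\<close>)
  define m6 where "m6 = add_edge a d (n + 0) m5"
  have n6: "built m6 (Suc (Suc (Suc (Suc (Suc (Suc t))))))" unfolding m6_def
    by (rule built_triangle[OF n5, where x = b]) (use facts in \<open>simp_all add: vdefs m1_def m2_def m3_def m4_def m5_def\<close>)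
  define m7 where "m7 = add_edge p d (0 + n) m6"
  have n7: "built m7 (Suc (Suc (Suc (Suc (Suc (Suc (Suc t)))))))" unfolding m7_def
    by (rule built_triangle[OF n6, where x = a]) (use facts in \<open>simp_all add: vdefs m1_def m2_def m3_def m4_def m5_def m6_def\<close>)
  define m8 where "m8 = add_edge p c (0 + - n) m7"
  have n8: "built m8 (Suc (Suc (Suc (Suc (Suc (Suc (Suc (Suc t))))))))" unfolding m8_def
    by (rule built_triangle[OF n7, where x = b]) (use facts in \<open>simp_all add: vdefs m1_def m2_def m3_def m4_def m5_def m6_def m7_def\<close>)
  \<comment> \<open>The edge from \<open>p\<close> to \<open>c\<close> has exponent
    \<open>- n\<close>, so the way from \<open>c\<close> over \<open>p\<close> to \<open>d\<close>
    counts \<open>n\<close> twice.\<close>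
  define m9 where "m9 = add_edge c d (n + n) m8"
  have n9: "built m9 (Suc (Suc (Suc (Suc (Suc (Suc (Suc (Suc (Suc t)))))))))" unfolding m9_def
    by (rule built_triangle[OF n8, where x = p]) (use facts in \<open>simp_all add: vdefs m1_def m2_def m3_def m4_def m5_def m6_def m7_def m8_def\<close>)
  have "m9 c d = Some (2 * n)" by (simp add: m9_def add_edge_def)
  \<comment> \<open>The neighbours of \<open>d\<close> are 0, \<open>a\<close>, \<open>b\<close>,
    \<open>p\<close> and \<open>c\<close>, all different from 1; \<open>built_increment\<close> will
    insert the edge from \<open>d\<close> to 1.\<close>
  moreover have "m9 d 1 = None"
    using facts by (simp add: vdefs m1_def m2_def m3_def m4_def m5_def m6_def m7_def m8_def m9_def)
  moreover have "built m9 (t + 9)" using n9 by (simp add: numeral_eq_Suc)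
  ultimately show ?thesis using c(1) d(1) dc by blast
qed

text \<open>The edge from \<open>1\<close> to the new vertex \<open>g\<close> is a copy of the one from \<open>1\<close> to \<open>2\<close>. Taking a new copy
  for each step ensures that the edges added here do not exist yet.\<close>

lemma built_increment:
  assumes b: "built l t" and cd: "l c d = Some n" "2 < c" "2 < d" "c \<noteq> d" and d1: "l d 1 = None"
  shows "\<exists>l' g. built l' (t + 5) \<and> l' c g = Some (n + 1) \<and> 2 < g \<and> c \<noteq> g"
proof -
  obtain g where g: "2 < g" "\<And>x. l x g = None" "\<And>x. l g x = None" and b1: "built (add_vertex g l) t"
    by (rule built_vertex[OF b], rule that)
  define l1 where "l1 = add_vertex g l"
  have b1: "built l1 t" using b1 by (simp add: l1_def)
  note s = built_spoke[OF b cd(1)] and x = built_generator[OF b] and s12 = built_spoke[OF b built_generator[OF b]]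
  have ne: "c \<noteq> g" "d \<noteq> g" using g(2)[of c] g(3)[of d] cd(1) s(5) by auto
  note facts = g ne ne[symmetric] s x s12 cd cd(4)[symmetric] d1
  note defs = l1_def add_vertex_def add_edge_def
  define m1 where "m1 = add_edge 2 g (0 + 0) l1"
  have n1: "built m1 (Suc t)" unfolding m1_def
    by (rule built_triangle[OF b1, where x = 0]) (use facts in \<open>simp_all add: defs\<close>)
  define m2 where "m2 = add_edge 1 g (1 + 0) m1"
  have n2: "built m2 (Suc (Suc t))" unfolding m2_def
    by (rule built_triangle[OF n1, where x = 2]) (use facts in \<open>simp_all add: defs m1_def\<close>)
  \<comment> \<open>A label 0 from \<open>d\<close> to 1 turns the copy at 1 into an edge from
    \<open>d\<close> to \<open>g\<close> with label 1, which can be appended to the edge from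
    \<open>c\<close> to \<open>d\<close>.\<close>
  define m3 where "m3 = add_edge d 1 (0 + 0) m2"
  have n3: "built m3 (Suc (Suc (Suc t)))" unfolding m3_def
    by (rule built_triangle[OF n2, where x = 0]) (use facts in \<open>simp_all add: defs m1_def m2_def\<close>)
  define m4 where "m4 = add_edge d g (0 + 1) m3"
  have n4: "built m4 (Suc (Suc (Suc (Suc t))))" unfolding m4_def
    by (rule built_triangle[OF n3, where x = 1]) (use facts in \<open>simp_all add: defs m1_def m2_def m3_def\<close>)
  define m5 where "m5 = add_edge c g (n + 1) m4"
  have n5: "built m5 (Suc (Suc (Suc (Suc (Suc t)))))" unfolding m5_def
    by (rule built_triangle[OF n4, where x = d]) (use facts in \<open>simp_all add: defs m1_def m2_def m3_def m4_def\<close>)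
  have "m5 c g = Some (n + 1)" by (simp add: m5_def add_edge_def)
  moreover have "built m5 (t + 5)" using n5 by (simp add: numeral_eq_Suc)
  ultimately show ?thesis using g(1) ne(1) by blast
qed

text \<open>At most k + 1 binary digits mean at most k doublings, each followed by at most one
  increment. The summand 2 is the cost of \<open>built_start\<close>.\<close>

lemma built_number:
  "0 < m \<Longrightarrow> m < 2 ^ Suc k \<Longrightarrow>
    \<exists>l a b. built l (14 * k + 2) \<and> l a b = Some (int m) \<and> 1 < a \<and> 1 < b \<and> a \<noteq> b"
proof (induction k arbitrary: m)
  case 0
  then have m: "m = 1" by simp
  obtain l a where l: "built l 2" "l a 2 = Some 1" "2 < a" using built_start by blast
  have "built l (14 * 0 + 2)" by (rule built_mono[OF l(1)]) simp
  moreover have "l a 2 = Some (int m)" "1 < a" "(1 :: nat) < 2" "a \<noteq> 2" using l m by simp_all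
  ultimately show ?case by blast
next
  case (Suc k)
  show ?case
  proof (cases "m = 1")
    case True
    \<comment> \<open>Here \<open>m div 2\<close> would be 0, so the complex for fewer digits is
      reused.\<close>
    have "(1 :: nat) < 2 ^ Suc k" by (rule one_less_power) simp_all
    then obtain l a b where l: "built l (14 * k + 2)" "l a b = Some (int m)" "1 < a" "1 < b" "a \<noteq> b"
      using Suc.IH[OF Suc.prems(1)] True by blast
    have "built l (14 * Suc k + 2)" by (rule built_mono[OF l(1)]) simp
    then show ?thesis using l by blast
  next
    case False
    have "0 < m div 2" "m div 2 < 2 ^ Suc k" using Suc.prems False by auto
    then obtain l a b where l: "built l (14 * k + 2)" "l a b = Some (int (m div 2))" "1 < a" "1 < b" "a \<noteq> b"
      using Suc.IH by blast
    obtain l' c d where l': "built l' (14 * k + 2 + 9)" "l' c d = Some (2 * int (m div 2))" "2 < c" "2 < d" "c \<noteq> d" "l' d 1 = None"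
      using built_double[OF l] by blast
    show ?thesis
    proof (cases "even m")
      case True
      have "built l' (14 * Suc k + 2)" by (rule built_mono[OF l'(1)]) simp
      moreover have "2 * int (m div 2) = int m" using True by (metis dvd_mult_div_cancel of_nat_mult of_nat_numeral)
      ultimately have "built l' (14 * Suc k + 2) \<and> l' c d = Some (int m) \<and> 1 < c \<and> 1 < d \<and> c \<noteq> d"
        using l' by simp
      then show ?thesis by blast
    next
      case odd: False
      obtain l'' g where l'': "built l'' (14 * k + 2 + 9 + 5)" "l'' c g = Some (2 * int (m div 2) + 1)" "2 < g" "c \<noteq> g"
        using built_increment[OF l'] by blast
      have "built l'' (14 * Suc k + 2)" by (rule built_mono[OF l''(1)]) simp
      moreover have "2 * int (m div 2) + 1 = int m" using odd by (metis odd_two_times_div_two_succ of_nat_Suc of_nat_mult of_nat_numeral add.commute plus_1_eq_Suc)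
      ultimately have "built l'' (14 * Suc k + 2) \<and> l'' c g = Some (int m) \<and> 1 < c \<and> 1 < g \<and> c \<noteq> g"
        using l'' l'(3) by simp
      then show ?thesis by blast
    qed
  qed
qed

section \<open>Counting cyclic groups by their order\<close>

lemma simplicial_complexity_cyclic:
  fixes G :: "nat monoid"
  assumes m: "0 < m" "m < 2 ^ Suc k" and G: "integer_mod_group m \<cong> G"
  shows "simplicial_complexity G \<le> enat (14 * k + 3)"
proof -
  obtain l a b where l: "built l (14 * k + 2)" "l a b = Some (int m)" "1 < a" "1 < b" "a \<noteq> b"
    using built_number[OF m] by blast
  obtain K w where K: "labelled K w (14 * k + 2)" and lw: "\<And>u v. l u v = (if {u, v} \<in> K then Some (w u v) else None)"
    using l(1) by (auto simp: built_def)
  have e: "{a, b} \<in> K" "w a b = int m" using l(2) lw[of a b] by (simp_all split: if_splits)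
  obtain K' :: "nat set set" where K': "finite_complex K'" "dim_at_most K' 2" "edge_connected K' 0"
    "card (simplices_of_dim 2 K') \<le> Suc (14 * k + 2)" "edge_group K' 0 \<cong> integer_mod_group m"
    using labelled_fill[OF K e l(5)] l(3,4) m(1) by auto
  have "edge_group K' 0 \<cong> G" using K'(5) G by (rule iso_trans)
  then have "realizes (14 * k + 3) G K' 0" using K' by (simp add: realizes_def)
  then show ?thesis using simplicial_complexity_le_iff by blast
qed

text \<open>Cyclic groups of different orders are not isomorphic. The orders run from 1, the trivial
  group, to \<open>2 ^ Suc k - 1\<close>; adding one in the conclusion avoids truncated
  subtraction.\<close>

lemma card_finite_abelian_groups_of_complexity:
  assumes T: "3 \<le> T" shows "2 ^ Suc ((T - 3) div 14) \<le> card (finite_abelian_groups_of_complexity T) + 1"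
proof -
  define k where "k = (T - 3) div 14"
  have kT: "14 * k + 3 \<le> T" using T by (simp add: k_def)
  have "\<exists>G :: nat monoid. group G \<and> integer_mod_group m \<cong> G" for m
  proof -
    have "countable (carrier (integer_mod_group m))" by simp
    from countable_group_nat[OF group_integer_mod_group this] show ?thesis by blast
  qed
  then obtain G :: "nat \<Rightarrow> nat monoid" where G: "\<And>m. group (G m)" "\<And>m. integer_mod_group m \<cong> G m" by metis
  let ?M = "{1..<2 ^ Suc k} :: nat set"
  have card: "finite (carrier (G m))" "card (carrier (G m)) = m" if "0 < m" for m
    using iso_finite[OF G(2)[of m]] iso_same_card[OF G(2)[of m]] that by (simp_all add: carrier_integer_mod_group)
  have mem: "iso_class (G m) \<in> finite_abelian_groups_of_complexity T" if m: "m \<in> ?M" for m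
  proof -
    have m0: "0 < m" "m < 2 ^ Suc k" using m by simp_all
    have "simplicial_complexity (G m) \<le> enat (14 * k + 3)" by (rule simplicial_complexity_cyclic[OF m0 G(2)])
    also have "\<dots> \<le> enat T" using kT by simp
    finally have sc: "simplicial_complexity (G m) \<le> enat T" .
    have fi: "has_free_index (G m) 0"
      using has_free_index_0_iff[OF G(1)[of m]] finite_no_integer_free_factor[OF G(1) card(1)[OF m0(1)]] by simp
    have "iso_class (G m) \<in> groups_of_complexity T"
      unfolding groups_of_complexity_def by (intro CollectI exI[of _ "G m"] conjI refl G(1) fi sc)
    moreover have "G m \<in> iso_class (G m)" using G(1) iso_refl by (simp add: iso_class_def)
    moreover have "comm_group (G m)"
      by (rule comm_group.iso_imp_comm_group[OF abelian_integer_mod_group G(2) group.is_monoid[OF G(1)]])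
    ultimately show ?thesis unfolding finite_abelian_groups_of_complexity_def
      by (intro CollectI conjI bexI[of _ "G m"] card(1)[OF m0(1)])
  qed
  have inj: "inj_on (\<lambda>m. iso_class (G m)) ?M"
  proof (rule inj_onI)
    fix m n assume mn: "m \<in> ?M" "n \<in> ?M" and eq: "iso_class (G m) = iso_class (G n)"
    have "G n \<in> iso_class (G n)" using G(1) iso_refl by (simp add: iso_class_def)
    then have "G n \<in> iso_class (G m)" unfolding eq .
    then have "G m \<cong> G n" by (simp add: iso_class_def)
    then have "card (carrier (G m)) = card (carrier (G n))" by (rule iso_same_card)
    then show "m = n" using card(2)[of m] card(2)[of n] mn by simp
  qed
  have fin: "finite (finite_abelian_groups_of_complexity T)"
    using card_groups_of_complexity(1)[of T] T by (simp add: finite_abelian_groups_of_complexity_def)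
  have "card ?M \<le> card (finite_abelian_groups_of_complexity T)"
    using card_mono[OF fin image_subsetI[of ?M "\<lambda>m. iso_class (G m)", OF mem]] card_image[OF inj] by simp
  then show ?thesis by (simp add: k_def)
qed

theorem theorem1p3:
  fixes T :: nat
  assumes "2 \<le> T"
  shows "finite (groups_of_complexity T)
    \<and> \<lfloor>2 powr ((real T - 3) / 14)\<rfloor> \<le> int (card (finite_abelian_groups_of_complexity T))
    \<and> card (finite_abelian_groups_of_complexity T) \<le> card (groups_of_complexity T)
    \<and> real (card (groups_of_complexity T)) \<le> 2 powr (6 * real T * log 2 (real T))"
proof (intro conjI)
  note upper = card_groups_of_complexity[OF assms]
  show "finite (groups_of_complexity T)" by (rule upper(1))
  show "card (finite_abelian_groups_of_complexity T) \<le> card (groups_of_complexity T)"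
    by (rule card_mono[OF upper(1)]) (auto simp: finite_abelian_groups_of_complexity_def)
  show "\<lfloor>2 powr ((real T - 3) / 14)\<rfloor> \<le> int (card (finite_abelian_groups_of_complexity T))"
  proof (cases "3 \<le> T")
    case True
    define k where "k = (T - 3) div 14"
    \<comment> \<open>Rounding the exponent down loses less than one, so the power stays below
      \<open>2 ^ Suc k\<close> and its integral part is at most
      \<open>2 ^ Suc k - 1\<close>.\<close>
    have "T - 3 < 14 * (k + 1)" unfolding k_def by simp
    then have "real (T - 3) < real (14 * (k + 1))" unfolding of_nat_less_iff .
    then have "real T - 3 < 14 * (real k + 1)" using True by (simp add: of_nat_diff)
    then have "2 powr ((real T - 3) / 14) < 2 powr real (Suc k)" by (intro powr_less_mono) simp_all
    also have "\<dots> = real_of_int (2 ^ Suc k)" by (subst powr_realpow) simp_all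
    finally have "\<lfloor>2 powr ((real T - 3) / 14)\<rfloor> < 2 ^ Suc k" by (simp add: floor_less_iff)
    moreover have "int (2 ^ Suc k) \<le> int (card (finite_abelian_groups_of_complexity T) + 1)"
      using card_finite_abelian_groups_of_complexity[OF True] unfolding k_def of_nat_le_iff .
    ultimately show ?thesis by simp
  next
    case False
    \<comment> \<open>For \<open>T = 2\<close> the exponent is negative, so the integral part is at
      most 0.\<close>
    then have "(real T - 3) / 14 < 0" by simp
    then have "2 powr ((real T - 3) / 14) < 2 powr 0" by (intro powr_less_mono) simp_all
    then have "\<lfloor>2 powr ((real T - 3) / 14)\<rfloor> < 1" by (simp add: floor_less_iff)
    then show ?thesis by linarith
  qed
  have "2 powr (6 * real T * log 2 (real T)) = (2 powr log 2 (real T)) powr (6 * real T)"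
    by (simp add: powr_powr mult.commute)
  also have "\<dots> = real T powr real (6 * T)" using assms by simp
  also have "\<dots> = real (T ^ (6 * T))" using assms by (subst powr_realpow) simp_all
  finally have "2 powr (6 * real T * log 2 (real T)) = real (T ^ (6 * T))" .
  moreover have "real (card (groups_of_complexity T)) \<le> real (T ^ (6 * T))" using upper(2) unfolding of_nat_le_iff .
  ultimately show "real (card (groups_of_complexity T)) \<le> 2 powr (6 * real T * log 2 (real T))" by simp
qed

end
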